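(* Consider the $\mathrm{ARX}_d(p,q)$ model in closed loop with the adaptive tracking control, with the parameter estimated by the weighted least squares (WLS) algorithm with exponent $\gamma>0$, as described in the context. Assume that the model is strongly controllable, i.e. $\det B(z)\neq 0$ for all $z\in\mathbb{C}$ with $|z|\le 1$ and $\det(\Pi)\neq 0$. In addition, suppose that either $(\varepsilon_n)$ is a white noise or $(\varepsilon_n)$ has finite conditional moment of order $>2$. Then, for the WLS algorithm, $$\lim_{n\to\infty}(\log n)^{1+\gamma}\,\frac{S_n(a)}{n}=\Lambda\quad\text{a.s.},$$ where $\Lambda=\begin{pmatrix} L & K^t\\ K & H\end{pmatrix}$. In addition, the tracking is optimal, with $$\|C_n-\Gamma_n\|=o\left(\frac{(\log n)^{1+\gamma}}{n}\right)\quad\text{a.s.}$$ Finally, $\widehat\theta_n$ converges almost surely to $\theta$, with $$\|\widehat\theta_n-\theta\|^2=\mathcal{O}\left(\frac{(\log n)^{1+\gamma}}{n}\right)\quad\text{a.s.}$$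
   Context: **Model.** Let $d,p,q\ge1$ be integers and $\delta=d(p+q)$. Let $A_1,\dots,A_p,B_1,\dots,B_q$ be unknown $d\times d$ matrices, and set $A(z)=I_d-A_1z-\cdots-A_pz^p$, $B(z)=I_d+B_1z+\cdots+B_qz^q$, and $\theta^t=(A_1,\dots,A_p,B_1,\dots,B_q)$, so $\theta$ is a $\delta\times d$ matrix ($^t$ denotes transpose). The $\mathrm{ARX}_d(p,q)$ model is, for all $n\ge0$, $$X_{n+1}=\theta^t\Phi_n+U_n+\varepsilon_{n+1},$$ where $X_n,U_n,\varepsilon_n$ are the $\mathbb{R}^d$-valued system output, input and driven noise, and $\Phi_n=(X_n^t,\dots,X_{n-p+1}^t,U_{n-1}^t,\dots,U_{n-q}^t)^t\in\mathbb{R}^\delta$. **Noise.** $(\varepsilon_n)$ is a martingale difference sequence adapted to the filtration $(\mathcal F_n)$, where $\mathcal F_n$ is the $\sigma$-algebra of the events occurring up to time $n$, with $\mathbb{E}[\varepsilon_{n+1}\varepsilon_{n+1}^t|\mathcal F_n]=\Gamma$ a.s. for all $n\ge0$, where $\Gamma$ is a positive definite deterministic covariance matrix. It is assumed that $\Gamma_n=\frac1n\sum_{k=1}^n\varepsilon_k\varepsilon_k^t$ converges a.s. to $\Gamma$. As usual, "finite conditional moment of order $>2$" means that for some $\alpha>2$, $\sup_{n\ge0}\mathbb{E}[\|\varepsilon_{n+1}\|^\alpha|\mathcal F_n]<\infty$ a.s. **WLS algorithm.** Fix $\gamma>0$. Let $s_n=\sum_{k=0}^n\|\Phi_k\|^2$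 and $$a_n=\Bigl(\frac{1}{\log s_n}\Bigr)^{1+\gamma}.$$ Let $S_n(a)=\sum_{k=0}^na_k\Phi_k\Phi_k^t+I_\delta$. For all $n\ge0$, with $\widehat\theta_0$ an arbitrarily chosen initial value, $$\widehat\theta_{n+1}=\widehat\theta_n+a_nS_n^{-1}(a)\Phi_n\big(X_{n+1}-U_n-\widehat\theta_n^{\,t}\Phi_n\big)^t .$$ **Control.** The reference trajectory $(x_n)$ is $\mathbb{R}^d$-valued and predictable, with $\sum_{k=1}^n\|x_k\|^2=o(n)$ a.s. The adaptive tracking control is $U_n=x_{n+1}-\widehat\theta_n^{\,t}\Phi_n$ for all $n\ge0$. The average cost matrix is $C_n=\frac1n\sum_{k=1}^n(X_k-x_k)(X_k-x_k)^t$; the tracking is called optimal if $C_n\to\Gamma$ a.s. **Matrices.** When $\det B(z)\ne0$ for $|z|\le1$, the $d\times d$ matrices $P_k$ are defined by the power series $B^{-1}(z)(A(z)-I_d)=\sum_{k=1}^\infty P_kz^k$, which converges on a disc of radius $>1$. Put $P_k=0$ for $k\le0$. - $\Pi$ is the $dq\times dq$ matrix whose $(i,j)$ block of size $d\times d$ is $P_{p+j-i}$, $1\le i,j\le q$. - $L$ is the $dp\times dp$ block diagonal matrix $\mathrm{diag}(\Gamma,\dots,\Gamma)$. - $K$ is the $dq\times dp$ matrix whose $(i,j)$ block ($1\le i\le q$, $1\le j\le p$) is $P_{j-i}\Gamma$ if $j>i$ and $0$ otherwise. - For $1\le i\le q$, $H_i=\sum_{k=i}^\infty P_k\Gamma P_{k-i+1}^t$.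 $H$ is the symmetric $dq\times dq$ matrix whose $(i,j)$ block is $H_{j-i+1}$ if $j\ge i$ and $H_{i-j+1}^t$ if $j<i$. *)

theory Defs
  imports "HOL-Probability.Probability" "HOL-Library.Landau_Symbols"
begin

text \<open>The dimension \<open>d\<close> and the orders \<open>p\<close>, \<open>q\<close> are the cardinalities of finite index types
  \<open>'d\<close>, \<open>'p\<close>, \<open>'q\<close>. The vectors and matrices made of \<open>d\<close>-blocks are indexed by \<open>'p \<times> 'd\<close>,
  \<open>'q \<times> 'd\<close> and their disjoint sum (of cardinality \<open>d (p + q)\<close>), a pair \<open>(i, a)\<close> denoting
  coordinate \<open>a\<close> of block \<open>i\<close>. The order on \<open>'p\<close> and \<open>'q\<close> numbers the blocks from 1 up to \<open>p\<close>
  or \<open>q\<close>.\<close>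

definition pos :: "'a::{finite,linorder} \<Rightarrow> nat" where
  "pos i = card {..i}"

definition outer :: "real^'m \<Rightarrow> real^'n \<Rightarrow> real^'n^'m" where
  "outer u v = (\<chi> i j. u $ i * v $ j)"

definition pos_definite :: "real^'n^'n \<Rightarrow> bool" where
  "pos_definite G \<longleftrightarrow> transpose G = G \<and> (\<forall>v. v \<noteq> 0 \<longrightarrow> v \<bullet> (G *v v) > 0)"

definition avg_outer :: "(nat \<Rightarrow> real^'d) \<Rightarrow> nat \<Rightarrow> real^'d^'d" where
  "avg_outer v n = (1 / real n) *\<^sub>R (\<Sum>k=1..n. outer (v k) (v k))"


subsection \<open>The ARX model\<close>

definition cscale :: "complex \<Rightarrow> real^'d^'d \<Rightarrow> complex^'d^'d" where
  "cscale z M = (\<chi> i j. z * complex_of_real (M $ i $ j))"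

definition A_poly :: "nat \<Rightarrow> (nat \<Rightarrow> real^'d^'d) \<Rightarrow> complex \<Rightarrow> complex^'d^'d" where
  "A_poly p A z = mat 1 - (\<Sum>k=1..p. cscale (z ^ k) (A k))"

definition B_poly :: "nat \<Rightarrow> (nat \<Rightarrow> real^'d^'d) \<Rightarrow> complex \<Rightarrow> complex^'d^'d" where
  "B_poly q B z = mat 1 + (\<Sum>k=1..q. cscale (z ^ k) (B k))"

text \<open>\<open>\<theta>\<close> itself has rows indexed by the blocks; its transpose is \<open>(A\<^sub>1, \<dots>, A\<^sub>p, B\<^sub>1, \<dots>, B\<^sub>q)\<close>.\<close>

definition arx_param :: "(nat \<Rightarrow> real^'d^'d) \<Rightarrow> (nat \<Rightarrow> real^'d^'d)
    \<Rightarrow> real^'d^(('p::{finite,linorder} \<times> 'd) + ('q::{finite,linorder} \<times> 'd))" where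
  "arx_param A B = transpose (\<chi> c r. case r of
       Inl (i, a) \<Rightarrow> A (pos i) $ c $ a
     | Inr (i, a) \<Rightarrow> B (pos i) $ c $ a)"

text \<open>Time is an integer for outputs and inputs, since the first regressors involve the initial
  values at negative times.\<close>

definition regressor :: "(int \<Rightarrow> 'w \<Rightarrow> real^'d) \<Rightarrow> (int \<Rightarrow> 'w \<Rightarrow> real^'d) \<Rightarrow> nat \<Rightarrow> 'w
    \<Rightarrow> real^(('p::{finite,linorder} \<times> 'd) + ('q::{finite,linorder} \<times> 'd))" where
  "regressor X U n \<omega> = (\<chi> r. case r of
       Inl (i, a) \<Rightarrow> X (int n - int (pos i) + 1) \<omega> $ a
     | Inr (i, a) \<Rightarrow> U (int n - int (pos i)) \<omega> $ a)"


subsection \<open>The noise\<close>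

definition mart_diff_noise ::
    "'w measure \<Rightarrow> (nat \<Rightarrow> 'w measure) \<Rightarrow> (nat \<Rightarrow> 'w \<Rightarrow> real^'d) \<Rightarrow> real^'d^'d \<Rightarrow> bool" where
  "mart_diff_noise M F \<epsilon> G \<longleftrightarrow>
     (\<forall>n. \<epsilon> (Suc n) \<in> borel_measurable (F (Suc n))) \<and>
     (\<forall>n i. integrable M (\<lambda>\<omega>. \<epsilon> (Suc n) \<omega> $ i) \<and>
        (AE \<omega> in M. real_cond_exp M (F n) (\<lambda>\<omega>. \<epsilon> (Suc n) \<omega> $ i) \<omega> = 0)) \<and>
     (\<forall>n i j. integrable M (\<lambda>\<omega>. \<epsilon> (Suc n) \<omega> $ i * \<epsilon> (Suc n) \<omega> $ j) \<and>
        (AE \<omega> in M. real_cond_exp M (F n)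
           (\<lambda>\<omega>. \<epsilon> (Suc n) \<omega> $ i * \<epsilon> (Suc n) \<omega> $ j) \<omega> = G $ i $ j))"

text \<open>White noise means independent and identically distributed; the mean zero and the covariance
  are already part of \<^const>\<open>mart_diff_noise\<close>.\<close>

definition white_noise :: "'w measure \<Rightarrow> (nat \<Rightarrow> 'w \<Rightarrow> real^'d) \<Rightarrow> bool" where
  "white_noise M \<epsilon> \<longleftrightarrow>
     prob_space.indep_vars M (\<lambda>_. borel) (\<lambda>n. \<epsilon> (Suc n)) UNIV \<and>
     (\<forall>n. distr M borel (\<epsilon> (Suc n)) = distr M borel (\<epsilon> 1))"

definition cond_moment_gt2 ::
    "'w measure \<Rightarrow> (nat \<Rightarrow> 'w measure) \<Rightarrow> (nat \<Rightarrow> 'w \<Rightarrow> real^'d) \<Rightarrow> bool" where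
  "cond_moment_gt2 M F \<epsilon> \<longleftrightarrow> (\<exists>\<alpha>>2. AE \<omega> in M.
     (SUP n. nn_cond_exp M (F n) (\<lambda>\<omega>. ennreal (norm (\<epsilon> (Suc n) \<omega>) powr \<alpha>)) \<omega>) < \<infinity>)"


subsection \<open>The weighted least squares algorithm\<close>

definition energy :: "(nat \<Rightarrow> 'w \<Rightarrow> real^'k) \<Rightarrow> nat \<Rightarrow> 'w \<Rightarrow> real" where
  "energy \<Phi> n \<omega> = (\<Sum>k\<le>n. (norm (\<Phi> k \<omega>))\<^sup>2)"

definition wls_S ::
    "(nat \<Rightarrow> 'w \<Rightarrow> real) \<Rightarrow> (nat \<Rightarrow> 'w \<Rightarrow> real^'k) \<Rightarrow> nat \<Rightarrow> 'w \<Rightarrow> real^'k^'k" where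
  "wls_S a \<Phi> n \<omega> = (\<Sum>k\<le>n. a k \<omega> *\<^sub>R outer (\<Phi> k \<omega>) (\<Phi> k \<omega>)) + mat 1"

text \<open>The formula \<open>(1 / log s\<^sub>n)\<^sup>1\<^sup>+\<^sup>\<gamma>\<close> for the weights is meaningful only for \<open>s\<^sub>n > 1\<close>. Where
  \<open>s\<^sub>n \<le> 1\<close>, the weight is left to be an arbitrary nonnegative value known at time \<open>n\<close>, which
  covers every convention for it.\<close>

definition wls_weights :: "'w measure \<Rightarrow> (nat \<Rightarrow> 'w measure) \<Rightarrow> real
    \<Rightarrow> (nat \<Rightarrow> 'w \<Rightarrow> real^'k) \<Rightarrow> (nat \<Rightarrow> 'w \<Rightarrow> real) \<Rightarrow> bool" where
  "wls_weights M F \<gamma> \<Phi> a \<longleftrightarrow> (\<forall>n.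
     a n \<in> borel_measurable (F n) \<and>
     (\<forall>\<omega>\<in>space M. 0 \<le> a n \<omega> \<and>
        (energy \<Phi> n \<omega> > 1 \<longrightarrow> a n \<omega> = (1 / ln (energy \<Phi> n \<omega>)) powr (1 + \<gamma>))))"


subsection \<open>The limit matrix\<close>

text \<open>The power series expansion of \<open>B(z)\<^sup>-\<^sup>1 (A(z) - I)\<close>. It determines the coefficients uniquely,
  and it exists if \<open>det B(z)\<close> does not vanish on the closed unit disc.\<close>

definition arx_expansion :: "nat \<Rightarrow> nat \<Rightarrow> (nat \<Rightarrow> real^'d^'d) \<Rightarrow> (nat \<Rightarrow> real^'d^'d)
    \<Rightarrow> (int \<Rightarrow> real^'d^'d) \<Rightarrow> bool" where
  "arx_expansion p q A B P \<longleftrightarrow>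
     (\<forall>k\<le>0. P k = 0) \<and>
     (\<exists>r>1. \<forall>z. norm z < r \<longrightarrow>
        (\<lambda>k. cscale (z ^ Suc k) (P (int (Suc k))))
          sums (matrix_inv (B_poly q B z) ** (A_poly p A z - mat 1)))"

definition arx_P :: "nat \<Rightarrow> nat \<Rightarrow> (nat \<Rightarrow> real^'d^'d) \<Rightarrow> (nat \<Rightarrow> real^'d^'d)
    \<Rightarrow> int \<Rightarrow> real^'d^'d" where
  "arx_P p q A B = (THE P. arx_expansion p q A B P)"

definition Pi_mat :: "nat \<Rightarrow> (int \<Rightarrow> real^'d^'d)
    \<Rightarrow> real^('q::{finite,linorder} \<times> 'd)^('q \<times> 'd)" where
  "Pi_mat p P = (\<chi> r c. case r of (i, a) \<Rightarrow> case c of (j, b) \<Rightarrow>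
     P (int p + int (pos j) - int (pos i)) $ a $ b)"

definition L_mat :: "real^'d^'d \<Rightarrow> real^('p::{finite,linorder} \<times> 'd)^('p \<times> 'd)" where
  "L_mat G = (\<chi> r c. case r of (i, a) \<Rightarrow> case c of (j, b) \<Rightarrow> if i = j then G $ a $ b else 0)"

definition K_mat :: "(int \<Rightarrow> real^'d^'d) \<Rightarrow> real^'d^'d
    \<Rightarrow> real^('p::{finite,linorder} \<times> 'd)^('q::{finite,linorder} \<times> 'd)" where
  "K_mat P G = (\<chi> r c. case r of (i, a) \<Rightarrow> case c of (j, b) \<Rightarrow>
     if pos j > pos i then (P (int (pos j) - int (pos i)) ** G) $ a $ b else 0)"

text \<open>The sum over \<open>k \<ge> i\<close> is reindexed by \<open>k = i + m\<close>.\<close>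

definition H_block :: "(int \<Rightarrow> real^'d^'d) \<Rightarrow> real^'d^'d \<Rightarrow> nat \<Rightarrow> real^'d^'d" where
  "H_block P G i = (\<Sum>m. P (int (i + m)) ** G ** transpose (P (int (m + 1))))"

definition H_mat :: "(int \<Rightarrow> real^'d^'d) \<Rightarrow> real^'d^'d
    \<Rightarrow> real^('q::{finite,linorder} \<times> 'd)^('q \<times> 'd)" where
  "H_mat P G = (\<chi> r c. case r of (i, a) \<Rightarrow> case c of (j, b) \<Rightarrow>
     if pos i \<le> pos j then H_block P G (pos j - pos i + 1) $ a $ b
     else transpose (H_block P G (pos i - pos j + 1)) $ a $ b)"

definition block_mat :: "real^'m^'m \<Rightarrow> real^'n^'m \<Rightarrow> real^'m^'n \<Rightarrow> real^'n^'n
    \<Rightarrow> real^('m + 'n)^('m + 'n)" where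
  "block_mat M11 M12 M21 M22 = (\<chi> r c. case r of
       Inl i \<Rightarrow> (case c of Inl j \<Rightarrow> M11 $ i $ j | Inr j \<Rightarrow> M12 $ i $ j)
     | Inr i \<Rightarrow> (case c of Inl j \<Rightarrow> M21 $ i $ j | Inr j \<Rightarrow> M22 $ i $ j))"

definition Lambda_mat :: "(int \<Rightarrow> real^'d^'d) \<Rightarrow> real^'d^'d
    \<Rightarrow> real^(('p::{finite,linorder} \<times> 'd) + ('q::{finite,linorder} \<times> 'd))^(('p \<times> 'd) + ('q \<times> 'd))"
  where
  "Lambda_mat P G = block_mat (L_mat G) (transpose (K_mat P G)) (K_mat P G) (H_mat P G)"

end

theory Submission
  imports Defs "HOL-Complex_Analysis.Complex_Analysis" "HOL-Real_Asymp.Real_Asymp"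
begin

text \<open>Writing \<open>\<pi>\<^sub>n = (\<theta> - \<theta>\<^sub>n)\<^sup>t \<Phi>\<^sub>n\<close> for the prediction error of the estimate \<open>\<theta>\<^sub>n\<close>, the closed loop reads
  \<open>X\<^sub>n\<^sub>+\<^sub>1 = x\<^sub>n\<^sub>+\<^sub>1 + \<pi>\<^sub>n + \<epsilon>\<^sub>n\<^sub>+\<^sub>1\<close>. The only probabilistic input is that, almost surely, a martingale
  transform \<open>\<Sum> w\<^sub>k \<epsilon>\<^sub>k\<^sub>+\<^sub>1\<close> is at most \<open>C + \<eta> \<Sum> w\<^sub>k\<^sup>2\<close> for every \<open>\<eta> > 0\<close>; everything else is argued path by
  path. With \<open>w = x + \<pi>\<close> it shows that \<open>s\<^sub>n\<close> grows at least linearly. The weights are chosen such that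
  the terms \<open>a\<^sub>n\<^sup>2 \<Phi>\<^sub>n\<^sup>t S\<^sub>n\<inverse> \<Phi>\<^sub>n\<close> are summable (compare with \<open>log det S\<^sub>n\<close>), so the Lyapunov function
  \<open>tr ((\<theta>\<^sub>n - \<theta>)\<^sup>t S\<^sub>n\<^sub>-\<^sub>1 (\<theta>\<^sub>n - \<theta>))\<close> stays bounded and \<open>\<Sum> \<parallel>\<pi>\<^sub>k\<parallel>\<^sup>2 = o(s\<^sub>n)\<close>. Causality bounds the energy of the inputs
  by that of the outputs, whence \<open>s\<^sub>n = O(n)\<close> and \<open>\<Sum> \<parallel>\<pi>\<^sub>k\<parallel>\<^sup>2 = o(n)\<close>. Up to an error of mean square zero,
  \<open>\<Phi>\<^sub>n\<close> is then the moving average \<open>\<Sum> G\<^sub>m \<epsilon>\<^sub>n\<^sub>-\<^sub>m\<close>, where \<open>G\<^sub>m\<close> collects a unit block and the \<open>P\<^sub>k\<close>, and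
  \<open>\<Lambda> = \<Sum> G\<^sub>m \<Gamma> G\<^sub>m\<^sup>t\<close>. If \<open>v\<^sup>t \<Lambda> v = 0\<close>, then \<open>G\<^sub>m\<^sup>t v = 0\<close> for all \<open>m\<close>; the equations with \<open>p < m \<le> p + q\<close> are
  \<open>\<Pi>\<^sup>t \<zeta> = 0\<close> for the input part \<open>\<zeta>\<close> of \<open>v\<close>, so \<open>v = 0\<close>. The lower bound on \<open>S\<^sub>n\<close> now turns the bounded
  Lyapunov function into the rate of \<open>\<theta>\<^sub>n\<close> and improves the energy of \<open>\<pi>\<close> to \<open>o((log n)\<^sup>1\<^sup>+\<^sup>\<gamma>)\<close>.\<close>

text \<open>The obstacle is a feedback loop: the regressors are built from the estimates, so nothing
  bounds \<open>s n\<close> beforehand, while the Lyapunov argument controls the prediction errors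
  only relative to \<open>s n\<close>. Error bounds therefore have the form
  \<open>C + \<eta> * ...\<close> for arbitrary \<eta>, so that a small multiple of
  \<open>s n\<close> can be moved to the other side once the regressor energy is dominated by
  \<open>n\<close> plus the prediction energy. The exponent 1 + \<gamma> comes from the comparison
  with log det: for \<open>D\<close> = 1 + log det, the increments of \<open>D\<close> divided by
  the later value of \<open>D^(1+\<gamma>)\<close> have a convergent sum, whereas with exponent 1
  the sum diverges as soon as \<open>D\<close> does. The decrease of the Lyapunov function carries
  the factor 1 minus the leverage, which may be near 0 until the Gram matrix is known to be large in
  every direction. Hence the prediction energy is estimated twice, crudely before the limit matrix
  is known and sharply afterwards. The martingale bound is applied to countably many predictable
  transforms, so one null set serves them all; the locale \<open>closed_loop\<close> collects what
  holds outside it.\<close>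

no_notation fps_nth (infixl "$" 75)

section \<open>Martingale transforms\<close>

text \<open>Kronecker's lemma in additive form, valid for bounded and unbounded \<open>b\<close>
  alike: the first \<open>N\<close> terms stay as the constant \<open>C\<close>, and only the part
  after \<open>N\<close> is small relative to \<open>b\<close>.\<close>

lemma kronecker_bound:
  fixes b x :: "nat \<Rightarrow> real"
  assumes b: "mono b" "\<And>n. 0 \<le> b n" and S: "convergent (\<lambda>n. \<Sum>k<n. x k)" and \<eta>: "0 < \<eta>"
  shows "\<exists>C. \<forall>n. \<bar>\<Sum>k<n. b k * x k\<bar> \<le> C + \<eta> * b (n - 1)"
proof -
  define S where "S n = (\<Sum>k<n. x k)" for n
  have "Cauchy S" using S by (simp add: S_def[abs_def] Cauchy_convergent_iff)
  then obtain N where N: "\<And>m n. m \<ge> N \<Longrightarrow> n \<ge> N \<Longrightarrow> dist (S m) (S n) < \<eta> / 2"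
    using \<eta> unfolding Cauchy_def by (metis half_gt_zero)
  have SN: "\<bar>S n - S N\<bar> \<le> \<eta> / 2" if "n \<ge> N" for n
    using N[of n N] that by (simp add: dist_real_def)
  \<comment> \<open>Abel summation from \<open>N\<close> on: each increment of \<open>b\<close> is
    multiplied by a partial sum of the tail, which is at most \<open>\<eta> / 2\<close>. The
    boundary term costs the other half of \<eta>.\<close>
  have step: "\<bar>(\<Sum>k=N..<Suc n. b k * x k) - b n * (S (Suc n) - S N)\<bar> \<le> (b n - b N) * (\<eta> / 2)"
    if "n \<ge> N" for n
    using that
  proof (induction n rule: dec_induct)
    case base then show ?case by (simp add: S_def)
  next
    case (step n)
    have "(\<Sum>k=N..<Suc (Suc n). b k * x k) - b (Suc n) * (S (Suc (Suc n)) - S N)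
      = ((\<Sum>k=N..<Suc n. b k * x k) - b n * (S (Suc n) - S N)) - (b (Suc n) - b n) * (S (Suc n) - S N)"
      using step.hyps by (simp add: S_def algebra_simps)
    also have "\<bar>\<dots>\<bar> \<le> (b n - b N) * (\<eta> / 2) + (b (Suc n) - b n) * (\<eta> / 2)"
    proof -
      have "b n \<le> b (Suc n)" using b(1) by (simp add: monoD)
      then have "\<bar>(b (Suc n) - b n) * (S (Suc n) - S N)\<bar> \<le> (b (Suc n) - b n) * (\<eta> / 2)"
        unfolding abs_mult using SN[of "Suc n"] step.hyps by (intro mult_mono) auto
      with step.IH show ?thesis by linarith
    qed
    also have "\<dots> = (b (Suc n) - b N) * (\<eta> / 2)" by (simp only: distrib_right[symmetric]) simp
    finally show ?case .
  qed
  have tail: "\<bar>\<Sum>k=N..<n. b k * x k\<bar> \<le> \<eta> * b (n - 1)" if "n > N" for n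
  proof -
    from that obtain m where m: "n = Suc m" "m \<ge> N" by (cases n) auto
    have "\<bar>b m * (S (Suc m) - S N)\<bar> \<le> b m * (\<eta> / 2)"
      unfolding abs_mult using SN[of "Suc m"] m b(2) by (intro mult_mono) auto
    moreover have "(b m - b N) * (\<eta> / 2) \<le> b m * (\<eta> / 2)"
      using b(2)[of N] \<eta> by (intro mult_right_mono) auto
    moreover have "n - 1 = m" "b m * (\<eta> / 2) + b m * (\<eta> / 2) = \<eta> * b m" using m(1) by simp_all
    ultimately show ?thesis using step[OF m(2)] unfolding m(1) diff_Suc_1 by linarith
  qed
  define C where "C = (\<Sum>k<N. \<bar>b k * x k\<bar>)"
  have "\<bar>\<Sum>k<n. b k * x k\<bar> \<le> C + \<eta> * b (n - 1)" for n
  proof (cases "n \<le> N")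
    case True
    have "\<bar>\<Sum>k<n. b k * x k\<bar> \<le> (\<Sum>k<n. \<bar>b k * x k\<bar>)" by simp
    also have "\<dots> \<le> C" unfolding C_def using True by (intro sum_mono2) auto
    finally show ?thesis using b(2)[of "n-1"] \<eta> by (smt (verit) mult_nonneg_nonneg)
  next
    case False
    have "(\<Sum>k<n. b k * x k) = (\<Sum>k<N. b k * x k) + (\<Sum>k=N..<n. b k * x k)"
      using False by (simp add: lessThan_atLeast0 sum.atLeastLessThan_concat)
    moreover have "\<bar>\<Sum>k<N. b k * x k\<bar> \<le> C" unfolding C_def by simp
    ultimately show ?thesis using tail[of n] False by linarith
  qed
  then show ?thesis by blast
qed

text \<open>The strong law used on each path: the transform is bounded if the energy of
  \<open>w\<close> is, and of smaller order than that energy otherwise. One inequality covers both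
  cases.\<close>

definition self_normalized :: "(nat \<Rightarrow> real) \<Rightarrow> (nat \<Rightarrow> real) \<Rightarrow> bool" where
  "self_normalized w e \<longleftrightarrow>
     (\<forall>\<eta>>0. \<exists>C. \<forall>n. \<bar>\<Sum>k<n. w k * e k\<bar> \<le> C + \<eta> * (\<Sum>k<n. (w k)\<^sup>2))"

text \<open>With \<open>Q_n\<close> equal to 1 plus the energy up to \<open>n\<close>, the term
  \<open>(w n / Q_n)^2\<close> is at most \<open>1 / Q_(n-1) - 1 / Q_n\<close>, and the sum
  telescopes. Being a sure bound, it makes the normalised transform square integrable whatever the
  size of \<open>w\<close>.\<close>

lemma sum_normalized_squares_le:
  fixes w :: "nat \<Rightarrow> real"
  shows "(\<Sum>k<n. (w k / (1 + (\<Sum>j\<le>k. (w j)\<^sup>2)))\<^sup>2) \<le> 1 - 1 / (1 + (\<Sum>k<n. (w k)\<^sup>2))"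
proof (induction n)
  case (Suc n)
  let ?Q = "\<Sum>k<n. (w k)\<^sup>2"
  have Q: "?Q \<ge> 0" by (simp add: sum_nonneg)
  have eq: "(\<Sum>j\<le>n. (w j)\<^sup>2) = ?Q + (w n)\<^sup>2" by (simp flip: lessThan_Suc_atMost)
  have "(w n / (1 + (?Q + (w n)\<^sup>2)))\<^sup>2 \<le> 1 / (1 + ?Q) - 1 / (1 + (?Q + (w n)\<^sup>2))"
  proof -
    have "1 / (1 + ?Q) - 1 / (1 + (?Q + (w n)\<^sup>2)) = (w n)\<^sup>2 / ((1 + ?Q) * (1 + (?Q + (w n)\<^sup>2)))"
    proof -
      have "1 + ?Q \<noteq> 0" "1 + (?Q + (w n)\<^sup>2) \<noteq> 0" using Q zero_le_power2[of "w n"] by linarith+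
      then show ?thesis by (simp add: field_simps)
    qed
    also have "\<dots> \<ge> (w n)\<^sup>2 / ((1 + (?Q + (w n)\<^sup>2)) * (1 + (?Q + (w n)\<^sup>2)))"
      using Q by (intro divide_left_mono mult_right_mono mult_pos_pos)
        (auto intro: add_pos_nonneg)
    finally show ?thesis by (simp add: power2_eq_square)
  qed
  then show ?case using Suc.IH by (simp add: eq)
qed simp

lemma sum_normalized_le:
  fixes w :: "nat \<Rightarrow> real"
  assumes w: "\<And>k. 0 \<le> w k"
  shows "(\<Sum>k<n. w k / (1 + (\<Sum>j\<le>k. w j))\<^sup>2) \<le> 1 - 1 / (1 + (\<Sum>k<n. w k))"
proof -
  have "(\<Sum>k<n. (sqrt (w k) / (1 + (\<Sum>j\<le>k. (sqrt (w j))\<^sup>2)))\<^sup>2)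
      = (\<Sum>k<n. w k / (1 + (\<Sum>j\<le>k. w j))\<^sup>2)"
    using w by (simp add: power_divide)
  with sum_normalized_squares_le[of "\<lambda>k. sqrt (w k)" n] show ?thesis using w by simp
qed

section \<open>Almost sure convergence of martingale transforms\<close>

locale mart_diff = prob_space M for M :: "'w measure" +
  fixes F :: "nat \<Rightarrow> 'w measure" and \<eta> :: "nat \<Rightarrow> 'w \<Rightarrow> real" and \<sigma> :: real
  assumes filt: "filtration (space M) F" and subalg: "\<And>n. subalgebra M (F n)"
    and meas: "\<And>n. \<eta> n \<in> borel_measurable (F (Suc n))"
    and cond1: "\<And>n. AE \<omega> in M. real_cond_exp M (F n) (\<eta> n) \<omega> = 0"
    and int2: "\<And>n. integrable M (\<lambda>\<omega>. (\<eta> n \<omega>)\<^sup>2)"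
    and cond2: "\<And>n. AE \<omega> in M. real_cond_exp M (F n) (\<lambda>\<omega>. (\<eta> n \<omega>)\<^sup>2) \<omega> = \<sigma>"
begin

lemma sfin: "sigma_finite_subalgebra M (F n)"
  by (intro finite_measure_subalgebra_is_sigma_finite finite_measure_subalgebra.intro
      finite_measure_subalgebra_axioms.intro subalg finite_measure_axioms)

lemma measF_mono: "f \<in> borel_measurable (F m) \<Longrightarrow> m \<le> n \<Longrightarrow> f \<in> borel_measurable (F n)"
  using filt by (intro measurable_from_subalg[of "F n" "F m"]) (auto simp: filtration_def subalgebra_def)

lemma measF: "f \<in> borel_measurable (F m) \<Longrightarrow> f \<in> borel_measurable M"
  using measurable_from_subalg[OF subalg] .

lemma orthogonal:
  assumes D: "D \<in> borel_measurable (F n)" "integrable M (\<lambda>\<omega>. (D \<omega>)\<^sup>2)"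
  shows "integrable M (\<lambda>\<omega>. D \<omega> * \<eta> n \<omega>)" "(\<integral>\<omega>. D \<omega> * \<eta> n \<omega> \<partial>M) = 0"
proof -
  note [measurable] = measF[OF D(1)] measF[OF meas]
  show i: "integrable M (\<lambda>\<omega>. D \<omega> * \<eta> n \<omega>)"
  proof (rule Bochner_Integration.integrable_bound[OF Bochner_Integration.integrable_add[OF D(2) int2[of n]]])
    show "AE \<omega> in M. norm (D \<omega> * \<eta> n \<omega>) \<le> norm ((D \<omega>)\<^sup>2 + (\<eta> n \<omega>)\<^sup>2)"
    proof (rule AE_I2)
      fix \<omega> show "norm (D \<omega> * \<eta> n \<omega>) \<le> norm ((D \<omega>)\<^sup>2 + (\<eta> n \<omega>)\<^sup>2)"
      proof -
        have "2 * \<bar>D \<omega> * \<eta> n \<omega>\<bar> \<le> (D \<omega>)\<^sup>2 + (\<eta> n \<omega>)\<^sup>2"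
          using sum_squares_bound[of "\<bar>D \<omega>\<bar>" "\<bar>\<eta> n \<omega>\<bar>"] by (simp add: abs_mult mult.assoc)
        then show ?thesis unfolding real_norm_def by linarith
      qed
    qed
  qed measurable
  have "(\<integral>\<omega>. D \<omega> * \<eta> n \<omega> \<partial>M) = (\<integral>\<omega>. D \<omega> * real_cond_exp M (F n) (\<eta> n) \<omega> \<partial>M)"
    using sigma_finite_subalgebra.real_cond_exp_intg(2)[OF sfin i D(1)] by simp
  also have "\<dots> = (\<integral>\<omega>. 0 \<partial>M)"
  proof (rule integral_cong_AE)
    show "AE \<omega> in M. D \<omega> * real_cond_exp M (F n) (\<eta> n) \<omega> = 0" using cond1[of n] by auto
  qed measurable
  finally show "(\<integral>\<omega>. D \<omega> * \<eta> n \<omega> \<partial>M) = 0" by simp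
qed

lemma weighted_square:
  assumes y: "y \<in> borel_measurable (F n)" "\<And>\<omega>. \<omega> \<in> space M \<Longrightarrow> 0 \<le> y \<omega>" "\<And>\<omega>. \<omega> \<in> space M \<Longrightarrow> y \<omega> \<le> 1"
  shows "integrable M (\<lambda>\<omega>. y \<omega> * (\<eta> n \<omega>)\<^sup>2)" 
    "(\<integral>\<omega>. y \<omega> * (\<eta> n \<omega>)\<^sup>2 \<partial>M) = \<sigma> * (\<integral>\<omega>. y \<omega> \<partial>M)"
proof -
  note [measurable] = measF[OF y(1)] measF[OF meas]
  show i: "integrable M (\<lambda>\<omega>. y \<omega> * (\<eta> n \<omega>)\<^sup>2)"
  proof (rule Bochner_Integration.integrable_bound[OF int2[of n]])
    show "AE \<omega> in M. norm (y \<omega> * (\<eta> n \<omega>)\<^sup>2) \<le> norm ((\<eta> n \<omega>)\<^sup>2)"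
    proof (rule AE_I2)
      fix \<omega> assume "\<omega> \<in> space M"
      then show "norm (y \<omega> * (\<eta> n \<omega>)\<^sup>2) \<le> norm ((\<eta> n \<omega>)\<^sup>2)"
        using mult_left_le_one_le[of "(\<eta> n \<omega>)\<^sup>2" "y \<omega>"] y(2,3) by simp
    qed
  qed measurable
  have "(\<integral>\<omega>. y \<omega> * (\<eta> n \<omega>)\<^sup>2 \<partial>M) = (\<integral>\<omega>. y \<omega> * real_cond_exp M (F n) (\<lambda>\<omega>. (\<eta> n \<omega>)\<^sup>2) \<omega> \<partial>M)"
    using sigma_finite_subalgebra.real_cond_exp_intg(2)[OF sfin i y(1)] by simp
  also have "\<dots> = (\<integral>\<omega>. \<sigma> * y \<omega> \<partial>M)"
  proof (rule integral_cong_AE)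
    show "AE \<omega> in M. y \<omega> * real_cond_exp M (F n) (\<lambda>\<omega>. (\<eta> n \<omega>)\<^sup>2) \<omega> = \<sigma> * y \<omega>" using cond2[of n] by auto
  qed measurable
  finally show "(\<integral>\<omega>. y \<omega> * (\<eta> n \<omega>)\<^sup>2 \<partial>M) = \<sigma> * (\<integral>\<omega>. y \<omega> \<partial>M)" by simp
qed

lemma sigma_nonneg: "0 \<le> \<sigma>"
proof -
  have "(\<integral>\<omega>. (\<eta> 0 \<omega>)\<^sup>2 \<partial>M) = \<sigma>"
    using weighted_square(2)[of "\<lambda>_. 1" 0] by (simp add: prob_space)
  then show ?thesis by (metis integral_nonneg_AE zero_le_power2 AE_I2)
qed

text \<open>Orthogonality of increments: the mixed term of the expanded square is
  \<open>\<eta> n\<close> times a square-integrable variable known at time \<open>n\<close>. Bounded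
  \<open>y\<close> keep every partial sum in L2.\<close>

lemma transform_second_moment:
  assumes y: "\<And>k. y k \<in> borel_measurable (F k)" "\<And>k \<omega>. \<omega> \<in> space M \<Longrightarrow> \<bar>y k \<omega>\<bar> \<le> 1"
  shows "(\<lambda>\<omega>. \<Sum>k=m..<n. y k \<omega> * \<eta> k \<omega>) \<in> borel_measurable (F n)"
    and "integrable M (\<lambda>\<omega>. (\<Sum>k=m..<n. y k \<omega> * \<eta> k \<omega>)\<^sup>2)"
    and "(\<integral>\<omega>. (\<Sum>k=m..<n. y k \<omega> * \<eta> k \<omega>)\<^sup>2 \<partial>M) = \<sigma> * (\<Sum>k=m..<n. \<integral>\<omega>. (y k \<omega>)\<^sup>2 \<partial>M)"
proof -
  let ?D = "\<lambda>n \<omega>. \<Sum>k=m..<n. y k \<omega> * \<eta> k \<omega>"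
  show meas_D: "?D n \<in> borel_measurable (F n)" for n
    by (intro borel_measurable_sum borel_measurable_times measF_mono[OF y(1)] measF_mono[OF meas]) auto
  have "integrable M (\<lambda>\<omega>. (?D n \<omega>)\<^sup>2) \<and>
      (\<integral>\<omega>. (?D n \<omega>)\<^sup>2 \<partial>M) = \<sigma> * (\<Sum>k=m..<n. \<integral>\<omega>. (y k \<omega>)\<^sup>2 \<partial>M)"
  proof (induction n)
    case (Suc n)
    show ?case
    proof (cases "m \<le> n")
      case True
      note [measurable] = measF[OF meas_D[of n]] measF[OF y(1)[of n]] measF[OF meas[of n]]
      have y2: "(\<lambda>\<omega>. (y n \<omega>)\<^sup>2) \<in> borel_measurable (F n)" using y(1)[of n] by simp
      have y2le: "(y n \<omega>)\<^sup>2 \<le> 1" if "\<omega> \<in> space M" for \<omega>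
        using y(2)[OF that] by (simp add: abs_square_le_1)
      note w = weighted_square[OF y2 _ y2le]
      have Dy: "(\<lambda>\<omega>. ?D n \<omega> * y n \<omega>) \<in> borel_measurable (F n)"
        using meas_D[of n] y(1)[of n] by simp
      have iDy: "integrable M (\<lambda>\<omega>. (?D n \<omega> * y n \<omega>)\<^sup>2)"
        by (rule Bochner_Integration.integrable_bound[OF conjunct1[OF Suc.IH]])
          (auto intro!: AE_I2 mult_right_le_one_le y2le simp: power_mult_distrib)
      note o = orthogonal[OF Dy iDy]
      have eq: "(?D (Suc n) \<omega>)\<^sup>2 = (?D n \<omega>)\<^sup>2 + 2 * ((?D n \<omega> * y n \<omega>) * \<eta> n \<omega>) + (y n \<omega>)\<^sup>2 * (\<eta> n \<omega>)\<^sup>2" for \<omega>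
        using True by (simp add: power2_sum power_mult_distrib)
      show ?thesis unfolding eq
        using Suc.IH o w True by (simp add: algebra_simps)
    qed (simp add: atLeastLessThan_empty)
  qed simp
  then show "integrable M (\<lambda>\<omega>. (?D n \<omega>)\<^sup>2)"
    "(\<integral>\<omega>. (?D n \<omega>)\<^sup>2 \<partial>M) = \<sigma> * (\<Sum>k=m..<n. \<integral>\<omega>. (y k \<omega>)\<^sup>2 \<partial>M)" by auto
qed

text \<open>Stopping the martingale at the first exceedance turns Kolmogorov's maximal inequality into
  Chebyshev's inequality for the stopped martingale.\<close>

lemma maximal_inequality:
  assumes y: "\<And>k. y k \<in> borel_measurable (F k)" "\<And>k \<omega>. \<omega> \<in> space M \<Longrightarrow> \<bar>y k \<omega>\<bar> \<le> 1" and t: "0 < t"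
  shows "measure M {\<omega> \<in> space M. \<exists>k\<in>{m..n}. t < \<bar>\<Sum>j=m..<k. y j \<omega> * \<eta> j \<omega>\<bar>}
      \<le> \<sigma> * (\<Sum>k=m..<n. \<integral>\<omega>. (y k \<omega>)\<^sup>2 \<partial>M) / t\<^sup>2"
proof -
  let ?D = "\<lambda>n \<omega>. \<Sum>k=m..<n. y k \<omega> * \<eta> k \<omega>"
  \<comment> \<open>Switching the weights off after the first exceedance keeps them predictable,
    because \<open>?D j\<close> with \<open>j \<le> k\<close> is known at time
    \<open>k\<close>.\<close>
  define y' where "y' k \<omega> = (if \<forall>j\<in>{m..k}. \<bar>?D j \<omega>\<bar> \<le> t then y k \<omega> else 0)" for k \<omega>
  let ?D' = "\<lambda>n \<omega>. \<Sum>k=m..<n. y' k \<omega> * \<eta> k \<omega>"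
  have DF: "?D j \<in> borel_measurable (F k)" if "j \<le> k" for j k
    using measF_mono[OF transform_second_moment(1)[OF y] that] .
  have y'F: "y' k \<in> borel_measurable (F k)" for k
  proof -
    have "Measurable.pred (F k) (\<lambda>\<omega>. \<forall>j\<in>{m..k}. \<bar>?D j \<omega>\<bar> \<le> t)"
    proof (rule pred_intros_finite(3), unfold Measurable.pred_def)
      fix j assume "j \<in> {m..k}"
      then have [measurable]: "?D j \<in> borel_measurable (F k)" by (intro DF) auto
      show "{\<omega> \<in> space (F k). \<bar>?D j \<omega>\<bar> \<le> t} \<in> sets (F k)" by measurable
    qed auto
    then show ?thesis unfolding y'_def[abs_def] using y(1)[of k] by (intro measurable_If) (auto simp: Measurable.pred_def)
  qed
  have y'1: "\<bar>y' k \<omega>\<bar> \<le> 1" if "\<omega> \<in> space M" for k \<omega> using y(2)[OF that] by (simp add: y'_def)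
  have D'D: "(\<forall>j\<in>{m..<n}. \<bar>?D j \<omega>\<bar> \<le> t) \<Longrightarrow> ?D' n \<omega> = ?D n \<omega>" for n \<omega>
    by (intro sum.cong refl) (auto simp: y'_def)
  \<comment> \<open>After the first exceedance no term is added, so the stopped sum still exceeds
    \<open>t\<close> at time \<open>n\<close>; a maximum over time is thus replaced by a single
    variable.\<close>
  have exceed: "t < \<bar>?D' n \<omega>\<bar>" if "\<exists>k\<in>{m..n}. t < \<bar>?D k \<omega>\<bar>" for n \<omega>
    using that
  proof (induction n)
    case 0 then show ?case using t by auto
  next
    case (Suc n)
    show ?case
    proof (cases "\<exists>k\<in>{m..n}. t < \<bar>?D k \<omega>\<bar>")
      case True
      then have "y' n \<omega> = 0" "m \<le> n" by (auto simp: y'_def not_le)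
      with Suc.IH[OF True] show ?thesis by simp
    next
      case False
      with Suc.prems have "t < \<bar>?D (Suc n) \<omega>\<bar>" by (metis atLeastAtMost_iff le_Suc_eq)
      with D'D[of "Suc n" \<omega>] False show ?thesis by (auto simp: not_less)
    qed
  qed
  note tr = transform_second_moment[OF y'F y'1, where m=m and n=n]
  note [measurable] = measF[OF tr(1)]
  have "measure M {\<omega> \<in> space M. \<exists>k\<in>{m..n}. t < \<bar>?D k \<omega>\<bar>} \<le> measure M {\<omega> \<in> space M. t\<^sup>2 \<le> (?D' n \<omega>)\<^sup>2}"
  proof (rule finite_measure_mono)
    show "{\<omega> \<in> space M. \<exists>k\<in>{m..n}. t < \<bar>?D k \<omega>\<bar>} \<subseteq> {\<omega> \<in> space M. t\<^sup>2 \<le> (?D' n \<omega>)\<^sup>2}"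
    proof safe
      fix \<omega> k assume "k \<in> {m..n}" "t < \<bar>?D k \<omega>\<bar>"
      then have "\<bar>t\<bar> \<le> \<bar>?D' n \<omega>\<bar>" using exceed[of n \<omega>] t by fastforce
      then show "t\<^sup>2 \<le> (?D' n \<omega>)\<^sup>2" by (simp only: abs_le_square_iff)
    qed
  qed measurable
  also have "\<dots> \<le> (\<integral>\<omega>. (?D' n \<omega>)\<^sup>2 \<partial>M) / t\<^sup>2"
    using t by (intro integral_Markov_inequality_measure[where A="{}"] tr(2)) auto
  also have "\<dots> \<le> \<sigma> * (\<Sum>k=m..<n. \<integral>\<omega>. (y k \<omega>)\<^sup>2 \<partial>M) / t\<^sup>2"
  proof -
    have i: "integrable M (\<lambda>\<omega>. (z \<omega>)\<^sup>2)"
      if "z \<in> borel_measurable (F k)" "\<And>\<omega>. \<omega> \<in> space M \<Longrightarrow> \<bar>z \<omega>\<bar> \<le> 1" for z :: "'w \<Rightarrow> real" and k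
      using measF[OF that(1)] that(2)
      by (intro integrable_const_bound[where B=1]) (auto simp: abs_square_le_1)
    have "(\<integral>\<omega>. (y' k \<omega>)\<^sup>2 \<partial>M) \<le> (\<integral>\<omega>. (y k \<omega>)\<^sup>2 \<partial>M)" for k
      by (rule integral_mono[OF i[OF y'F y'1] i[OF y]]) (auto simp: y'_def)
    then have "\<sigma> * (\<Sum>k=m..<n. \<integral>\<omega>. (y' k \<omega>)\<^sup>2 \<partial>M) \<le> \<sigma> * (\<Sum>k=m..<n. \<integral>\<omega>. (y k \<omega>)\<^sup>2 \<partial>M)"
      by (intro mult_left_mono sum_mono sigma_nonneg)
    then show ?thesis using tr(3) by (intro divide_right_mono) auto
  qed
  finally show ?thesis .
qed

text \<open>The sure bound \<open>sq\<close> makes the expected squared weights summable. By the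
  maximal inequality the sums move by more than \<open>t\<close> after time \<open>m\<close> with a
  probability controlled by the tail of that series, which tends to 0.\<close>

lemma transform_converges:
  assumes y: "\<And>k. y k \<in> borel_measurable (F k)" "\<And>k \<omega>. \<omega> \<in> space M \<Longrightarrow> \<bar>y k \<omega>\<bar> \<le> 1"
    and sq: "\<And>n \<omega>. \<omega> \<in> space M \<Longrightarrow> (\<Sum>k<n. (y k \<omega>)\<^sup>2) \<le> 1"
  shows "AE \<omega> in M. convergent (\<lambda>n. \<Sum>k<n. y k \<omega> * \<eta> k \<omega>)"
proof -
  let ?D = "\<lambda>m n \<omega>. \<Sum>k=m..<n. y k \<omega> * \<eta> k \<omega>"
  define e where "e k = (\<integral>\<omega>. (y k \<omega>)\<^sup>2 \<partial>M)" for k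
  have iy: "integrable M (\<lambda>\<omega>. (y k \<omega>)\<^sup>2)" for k
    using measF[OF y(1)[of k]] y(2)
    by (intro integrable_const_bound[where B=1]) (auto simp: abs_square_le_1)
  have e0: "e k \<ge> 0" for k unfolding e_def by simp
  have es: "(\<Sum>k<n. e k) \<le> 1" for n
  proof -
    have "(\<Sum>k<n. e k) = (\<integral>\<omega>. (\<Sum>k<n. (y k \<omega>)\<^sup>2) \<partial>M)"
      unfolding e_def using iy by (simp add: Bochner_Integration.integral_sum)
    also have "\<dots> \<le> (\<integral>\<omega>. 1 \<partial>M)" using iy sq by (intro integral_mono) auto
    finally show ?thesis by (simp add: prob_space)
  qed
  have "(\<Sum>k\<le>n. e k) \<le> 1" for n using es[of "Suc n"] by (simp only: lessThan_Suc_atMost)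
  then have se: "summable e" by (intro bounded_imp_summable[of e 1] e0)
  have Dm: "?D m k \<in> borel_measurable M" for m k
    using measF[OF transform_second_moment(1)[OF y]] .
  have null: "AE \<omega> in M. \<exists>m. \<forall>k\<ge>m. \<bar>?D m k \<omega>\<bar> \<le> t" if t: "t > 0" for t
  proof -
    define A where "A m n = {\<omega> \<in> space M. \<exists>k\<in>{m..n}. t < \<bar>?D m k \<omega>\<bar>}" for m n
    have Ame: "A m n \<in> sets M" for m n
      unfolding A_def using Dm by measurable
    \<comment> \<open>\<open>B m\<close> is the event that the sums ever leave the
      \<open>t\<close>-neighbourhood of their value at \<open>m\<close>. A path violating the claim
      for \<open>t\<close> lies in every \<open>B m\<close>.\<close>
    define B where "B m = (\<Union>n. A m n)" for m
    have Bme: "B m \<in> sets M" for m unfolding B_def using Ame by auto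
    have Bm: "measure M (B m) \<le> \<sigma> * (\<Sum>k. e (k + m)) / t\<^sup>2" for m
    proof (rule LIMSEQ_le_const2)
      show "(\<lambda>n. measure M (A m n)) \<longlonglongrightarrow> measure M (B m)"
        unfolding B_def using Ame
        by (intro finite_Lim_measure_incseq) (auto simp: incseq_def A_def)
      have "measure M (A m n) \<le> \<sigma> * (\<Sum>k. e (k + m)) / t\<^sup>2" for n
      proof -
        have "measure M (A m n) \<le> \<sigma> * (\<Sum>k=m..<n. e k) / t\<^sup>2"
          unfolding A_def e_def by (rule maximal_inequality[OF y t])
        also have "(\<Sum>k=m..<n. e k) = (\<Sum>k<n - m. e (k + m))"
          by (rule sum.reindex_bij_witness[of _ "\<lambda>k. k + m" "\<lambda>k. k - m"]) auto
        also have "\<dots> \<le> (\<Sum>k. e (k + m))"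
          using se e0 by (intro sum_le_suminf) (auto simp: summable_iff_shift)
        finally show ?thesis using sigma_nonneg by (simp add: divide_right_mono mult_left_mono)
      qed
      then show "\<exists>N. \<forall>n\<ge>N. measure M (A m n) \<le> \<sigma> * (\<Sum>k. e (k + m)) / t\<^sup>2" by blast
    qed
    have "(\<lambda>m. \<sigma> * (\<Sum>k. e (k + m)) / t\<^sup>2) \<longlonglongrightarrow> \<sigma> * 0 / t\<^sup>2"
      using suminf_exist_split2[OF se] by (intro tendsto_intros) (use t in auto)
    then have "(\<lambda>m. \<sigma> * (\<Sum>k. e (k + m)) / t\<^sup>2) \<longlonglongrightarrow> 0" by simp
    then have "measure M (\<Inter>m. B m) \<le> 0"
    proof (rule LIMSEQ_le_const)
      show "\<exists>N. \<forall>m\<ge>N. measure M (\<Inter>m. B m) \<le> \<sigma> * (\<Sum>k. e (k + m)) / t\<^sup>2"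
      proof (intro exI allI impI)
        fix m
        have "measure M (\<Inter>m. B m) \<le> measure M (B m)" using Bme by (intro finite_measure_mono) auto
        then show "measure M (\<Inter>m. B m) \<le> \<sigma> * (\<Sum>k. e (k + m)) / t\<^sup>2" using Bm[of m] by linarith
      qed
    qed
    then have "measure M (\<Inter>m. B m) = 0" by (simp add: measure_le_0_iff)
    then have "(\<Inter>m. B m) \<in> null_sets M" using Bme
      by (intro null_setsI) (auto simp: emeasure_eq_measure)
    then have "AE \<omega> in M. \<omega> \<notin> (\<Inter>m. B m)" by (rule AE_not_in)
    then show ?thesis
    proof (rule AE_mp, intro AE_I2 impI)
      fix \<omega> assume "\<omega> \<in> space M" "\<omega> \<notin> (\<Inter>m. B m)"
      then obtain m where "\<And>n. \<omega> \<notin> A m n" by (auto simp: B_def)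
      with \<open>\<omega> \<in> space M\<close> have "\<bar>?D m k \<omega>\<bar> \<le> t" if "k \<ge> m" for k
        using that by (force simp: A_def not_less)
      then show "\<exists>m. \<forall>k\<ge>m. \<bar>?D m k \<omega>\<bar> \<le> t" by blast
    qed
  qed
  \<comment> \<open>Countably many levels suffice for the Cauchy property, so the exceptional sets
    have a null union.\<close>
  have "AE \<omega> in M. \<forall>i. \<exists>m. \<forall>k\<ge>m. \<bar>?D m k \<omega>\<bar> \<le> 1 / real (Suc i)"
    by (subst AE_all_countable) (auto intro!: null)
  then show ?thesis
  proof (rule AE_mp, intro AE_I2 impI)
    fix \<omega> assume *: "\<forall>i. \<exists>m. \<forall>k\<ge>m. \<bar>?D m k \<omega>\<bar> \<le> 1 / real (Suc i)"
    let ?S = "\<lambda>n. \<Sum>k<n. y k \<omega> * \<eta> k \<omega>"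
    have "Cauchy ?S"
    proof (rule metric_CauchyI)
      fix r :: real assume "0 < r"
      then obtain i where i: "1 / real (Suc i) < r / 2"
        by (metis half_gt_zero nat_approx_posE inverse_eq_divide)
      from * obtain m where m: "\<And>k. k \<ge> m \<Longrightarrow> \<bar>?D m k \<omega>\<bar> \<le> 1 / real (Suc i)" by blast
      have S: "?S k = ?S m + ?D m k \<omega>" if "k \<ge> m" for k
        using that by (simp add: lessThan_atLeast0 sum.atLeastLessThan_concat)
      show "\<exists>N. \<forall>k\<ge>N. \<forall>l\<ge>N. dist (?S k) (?S l) < r"
      proof (intro exI[of _ m] allI impI)
        fix k l assume "k \<ge> m" "l \<ge> m"
        with m[of k] m[of l] S[of k] S[of l] i show "dist (?S k) (?S l) < r"
          unfolding dist_real_def by linarith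
      qed
    qed
    then show "convergent ?S" by (rule Cauchy_convergent)
  qed
qed

text \<open>Dividing \<open>w k\<close> by one plus its energy up to time \<open>k\<close> gives a
  predictable transform whose squared weights sum to at most 1, so it converges almost surely.
  Kronecker's lemma then multiplies the normalisation back in.\<close>

theorem self_normalized_AE:
  assumes w: "\<And>k. w k \<in> borel_measurable (F k)"
  shows "AE \<omega> in M. self_normalized (\<lambda>k. w k \<omega>) (\<lambda>k. \<eta> k \<omega>)"
proof -
  define b where "b k \<omega> = 1 + (\<Sum>j\<le>k. (w j \<omega>)\<^sup>2)" for k \<omega>
  define y where "y k \<omega> = w k \<omega> / b k \<omega>" for k \<omega>
  have b1: "b k \<omega> \<ge> 1" for k \<omega> by (simp add: b_def sum_nonneg)
  have yF: "y k \<in> borel_measurable (F k)" for k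
    unfolding y_def b_def by (intro borel_measurable_divide borel_measurable_add borel_measurable_const
        borel_measurable_sum borel_measurable_power measF_mono[OF w]) auto
  have ysq: "(\<Sum>k<n. (y k \<omega>)\<^sup>2) \<le> 1" for n \<omega>
  proof -
    have "0 \<le> 1 / (1 + (\<Sum>k<n. (w k \<omega>)\<^sup>2))" by (intro divide_nonneg_nonneg add_nonneg_nonneg sum_nonneg) auto
    with sum_normalized_squares_le[of "\<lambda>k. w k \<omega>" n] show ?thesis unfolding y_def b_def by linarith
  qed
  have y1: "\<bar>y k \<omega>\<bar> \<le> 1" for k \<omega>
  proof -
    have "(y k \<omega>)\<^sup>2 \<le> (\<Sum>k<Suc k. (y k \<omega>)\<^sup>2)" by (rule member_le_sum) auto
    also have "\<dots> \<le> 1" by (rule ysq)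
    finally have "(y k \<omega>)\<^sup>2 \<le> 1" .
    then show ?thesis by (simp add: abs_square_le_1)
  qed
  have "AE \<omega> in M. convergent (\<lambda>n. \<Sum>k<n. y k \<omega> * \<eta> k \<omega>)"
    by (rule transform_converges[OF yF y1 ysq])
  then show ?thesis
  proof (rule AE_mp, intro AE_I2 impI)
    fix \<omega> assume c: "convergent (\<lambda>n. \<Sum>k<n. y k \<omega> * \<eta> k \<omega>)"
    have mono: "mono (\<lambda>k. b k \<omega>)" unfolding b_def by (intro monoI add_left_mono sum_mono2) auto
    show "self_normalized (\<lambda>k. w k \<omega>) (\<lambda>k. \<eta> k \<omega>)"
      unfolding self_normalized_def
    proof (intro allI impI)
      fix r :: real assume r: "0 < r"
      have yw: "b k \<omega> * (y k \<omega> * \<eta> k \<omega>) = w k \<omega> * \<eta> k \<omega>" for k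
        using b1[of k \<omega>] by (simp add: y_def)
      obtain C where C: "\<bar>\<Sum>k<n. w k \<omega> * \<eta> k \<omega>\<bar> \<le> C + r * b (n - 1) \<omega>" for n
        using kronecker_bound[OF mono _ c r] b1 yw by (auto intro: order_trans[OF zero_le_one])
      have "\<bar>\<Sum>k<n. w k \<omega> * \<eta> k \<omega>\<bar> \<le> (\<bar>C\<bar> + r) + r * (\<Sum>k<n. (w k \<omega>)\<^sup>2)" for n
      proof (cases n)
        case 0 then show ?thesis using r by simp
      next
        case (Suc m)
        have "b (n - 1) \<omega> = 1 + (\<Sum>k<n. (w k \<omega>)\<^sup>2)" unfolding b_def Suc by (simp flip: lessThan_Suc_atMost)
        with C[of n] show ?thesis by (simp add: algebra_simps)
      qed
      then show "\<exists>C. \<forall>n. \<bar>\<Sum>k<n. w k \<omega> * \<eta> k \<omega>\<bar> \<le> C + r * (\<Sum>k<n. (w k \<omega>)\<^sup>2)" by blast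
    qed
  qed
qed

text \<open>Dividing by the square of one plus the running sum makes the expected series at most
  \<sigma>, so the normalised series converges almost surely. Where the sum of the
  \<open>w k\<close> is finite, the divisors are bounded and can be removed.\<close>

theorem weighted_squares_summable_AE:
  assumes w: "\<And>k. w k \<in> borel_measurable (F k)" "\<And>k \<omega>. \<omega> \<in> space M \<Longrightarrow> 0 \<le> w k \<omega>"
  shows "AE \<omega> in M. summable (\<lambda>k. w k \<omega>) \<longrightarrow> summable (\<lambda>k. w k \<omega> * (\<eta> k \<omega>)\<^sup>2)"
proof -
  define b where "b k \<omega> = 1 + (\<Sum>j\<le>k. w j \<omega>)" for k \<omega>
  define y where "y k \<omega> = w k \<omega> / (b k \<omega>)\<^sup>2" for k \<omega>
  have b1: "b k \<omega> \<ge> 1" if "\<omega> \<in> space M" for k \<omega> using w(2)[OF that] by (simp add: b_def sum_nonneg)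
  have yF: "y k \<in> borel_measurable (F k)" for k
    unfolding y_def b_def by (intro borel_measurable_divide borel_measurable_add borel_measurable_const
        borel_measurable_sum borel_measurable_power measF_mono[OF w(1)] ) auto
  have y0: "0 \<le> y k \<omega>" if "\<omega> \<in> space M" for k \<omega> using w(2)[OF that] by (simp add: y_def)
  have ys: "(\<Sum>k<n. y k \<omega>) \<le> 1" if "\<omega> \<in> space M" for n \<omega>
  proof -
    have "0 \<le> 1 / (1 + (\<Sum>k<n. w k \<omega>))"
      using w(2)[OF that] by (intro divide_nonneg_nonneg add_nonneg_nonneg sum_nonneg) auto
    with sum_normalized_le[of "\<lambda>k. w k \<omega>" n, OF w(2)[OF that]] show ?thesis unfolding y_def b_def by linarith
  qed
  have y1: "y k \<omega> \<le> 1" if "\<omega> \<in> space M" for k \<omega>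
  proof -
    have "y k \<omega> \<le> (\<Sum>k<Suc k. y k \<omega>)" using y0[OF that] by (intro member_le_sum) auto
    with ys[OF that, of "Suc k"] show ?thesis by linarith
  qed
  note [measurable] = measF[OF yF] measF[OF meas]
  note ws = weighted_square[OF yF y0 y1]
  have iy: "integrable M (y k)" for k
    using y0 y1 by (intro integrable_const_bound[where B=1]) auto
  have bnd: "(\<Sum>k<n. \<integral>\<^sup>+\<omega>. ennreal (y k \<omega> * (\<eta> k \<omega>)\<^sup>2) \<partial>M) \<le> ennreal \<sigma>" for n
  proof -
    have "(\<Sum>k<n. \<integral>\<^sup>+\<omega>. ennreal (y k \<omega> * (\<eta> k \<omega>)\<^sup>2) \<partial>M) = (\<Sum>k<n. ennreal (\<sigma> * (\<integral>\<omega>. y k \<omega> \<partial>M)))"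
      using ws y0 by (subst nn_integral_eq_integral) (auto simp: y0)
    also have "\<dots> = ennreal (\<Sum>k<n. \<sigma> * (\<integral>\<omega>. y k \<omega> \<partial>M))"
      using sigma_nonneg y0 by (intro sum_ennreal) (auto intro!: mult_nonneg_nonneg Bochner_Integration.integral_nonneg)
    also have "(\<Sum>k<n. \<sigma> * (\<integral>\<omega>. y k \<omega> \<partial>M)) = \<sigma> * (\<integral>\<omega>. (\<Sum>k<n. y k \<omega>) \<partial>M)"
      using iy by (simp add: sum_distrib_left)
    also have "\<dots> \<le> \<sigma> * (\<integral>\<omega>. 1 \<partial>M)"
      using iy ys sigma_nonneg by (intro mult_left_mono integral_mono) auto
    finally show ?thesis by (simp add: prob_space ennreal_leI)
  qed
  have "(\<integral>\<^sup>+\<omega>. (\<Sum>k. ennreal (y k \<omega> * (\<eta> k \<omega>)\<^sup>2)) \<partial>M) = (\<Sum>k. \<integral>\<^sup>+\<omega>. ennreal (y k \<omega> * (\<eta> k \<omega>)\<^sup>2) \<partial>M)"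
    by (rule nn_integral_suminf) measurable
  also have "\<dots> \<le> ennreal \<sigma>" by (rule suminf_le_const[OF _ bnd]) auto
  finally have "(\<integral>\<^sup>+\<omega>. (\<Sum>k. ennreal (y k \<omega> * (\<eta> k \<omega>)\<^sup>2)) \<partial>M) \<noteq> \<infinity>" by (auto simp: top_unique)
  then have "AE \<omega> in M. (\<Sum>k. ennreal (y k \<omega> * (\<eta> k \<omega>)\<^sup>2)) \<noteq> \<infinity>"
    by (intro nn_integral_PInf_AE) measurable
  then show ?thesis
  proof (rule AE_mp, intro AE_I2 impI)
    fix \<omega> assume om: "\<omega> \<in> space M" and fin: "(\<Sum>k. ennreal (y k \<omega> * (\<eta> k \<omega>)\<^sup>2)) \<noteq> \<infinity>"
      and sw: "summable (\<lambda>k. w k \<omega>)"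
    have "summable (\<lambda>k. y k \<omega> * (\<eta> k \<omega>)\<^sup>2)"
      using fin y0[OF om] by (intro summable_suminf_not_top) auto
    then have s: "summable (\<lambda>k. (1 + (\<Sum>k. w k \<omega>))\<^sup>2 * (y k \<omega> * (\<eta> k \<omega>)\<^sup>2))" by (rule summable_mult)
    show "summable (\<lambda>k. w k \<omega> * (\<eta> k \<omega>)\<^sup>2)"
    proof (rule summable_comparison_test'[OF s, of 0])
      fix k
      have "b k \<omega> \<le> 1 + (\<Sum>k. w k \<omega>)" unfolding b_def
        using sum_le_suminf[OF sw, of "{..k}"] w(2)[OF om] by auto
      then have "(b k \<omega>)\<^sup>2 * y k \<omega> \<le> (1 + (\<Sum>k. w k \<omega>))\<^sup>2 * y k \<omega>"
        using b1[OF om, of k] y0[OF om] by (intro mult_right_mono power_mono) auto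
      moreover have "(b k \<omega>)\<^sup>2 * y k \<omega> = w k \<omega>" using b1[OF om, of k] by (simp add: y_def)
      ultimately show "norm (w k \<omega> * (\<eta> k \<omega>)\<^sup>2) \<le> (1 + (\<Sum>k. w k \<omega>))\<^sup>2 * (y k \<omega> * (\<eta> k \<omega>)\<^sup>2)"
        using w(2)[OF om, of k] mult_right_mono[of "w k \<omega>" _ "(\<eta> k \<omega>)\<^sup>2"] by (simp add: mult.assoc[symmetric])
    qed
  qed
qed

end

section \<open>Weighted least squares along a path\<close>

text \<open>\<open>T\<close> is the set of rows already perturbed. Each perturbation is a multiple
  of row \<open>j\<close>, which equals \<open>u\<close>, so it leaves the determinant unchanged;
  without perturbations Cramer's rule gives \<open>u $ j\<close>.\<close>

lemma det_add_multiple_of_row: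
  fixes w u :: "real^'n"
  assumes "finite T" "j \<notin> T"
  shows "det (\<chi> i. if i = j then u else if i \<in> T then axis i 1 + w $ i *s u else axis i 1) = u $ j"
  using assms
proof (induction T)
  case empty
  have "(\<Sum>i\<in>UNIV. u $ i *s row i (mat 1 :: real^'n^'n)) = u"
    by (simp add: vec_eq_iff row_def mat_def if_distrib cong: if_cong)
  then have eq: "(\<chi> i. if i = j then u else if i \<in> {} then axis i 1 + w $ i *s u else axis i 1)
     = (\<chi> i. if i = j then (\<Sum>i\<in>UNIV. u $ i *s row i (mat 1)) else row i (mat 1 :: real^'n^'n))"
    by (auto simp: vec_eq_iff row_def mat_def axis_def)
  show ?case by (simp only: eq cramer_lemma_transpose det_I mult_1_right)
next
  case (insert k T)
  let ?c = "\<lambda>i. if i = j then u else if i \<in> T then axis i 1 + w $ i *s u else axis i 1"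
  have 1: "(\<chi> i. if i = j then u else if i \<in> insert k T then axis i 1 + w $ i *s u else axis i 1)
      = (\<chi> i. if i = k then axis k 1 + w $ k *s u else ?c i)"
    using insert by (auto simp: vec_eq_iff)
  have 2: "(\<chi> i. if i = k then axis k 1 else ?c i) = (\<chi> i. ?c i)"
    using insert by (auto simp: vec_eq_iff)
  have 3: "det (\<chi> i. if i = k then w $ k *s u else ?c i) = w $ k * det (\<chi> i. if i = k then u else ?c i)"
    by (rule det_row_mul)
  have 4: "det (\<chi> i. if i = k then u else ?c i) = 0"
    by (rule det_identical_rows[of j k]) (use insert in \<open>auto simp: row_def vec_eq_iff\<close>)
  have "det (\<chi> i. if i = k then axis k 1 + w $ k *s u else ?c i)
    = det (\<chi> i. if i = k then axis k 1 else ?c i) + det (\<chi> i. if i = k then w $ k *s u else ?c i)"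
    by (rule det_row_add)
  then show ?case unfolding 1 2 3 4 using insert by simp
qed

text \<open>Matrix determinant lemma. Row by row, multilinearity splits off the term in which row
  \<open>j\<close> is a multiple of \<open>u\<close>; in that term the multiples of \<open>u\<close>
  in the other rows have no effect, by the previous lemma.\<close>

lemma det_rank_one_update:
  fixes w u :: "real^'n"
  shows "det (mat 1 + outer w u) = 1 + w \<bullet> u"
proof -
  have "finite T \<Longrightarrow> det (\<chi> i. if i \<in> T then axis i 1 + w $ i *s u else axis i 1) = 1 + (\<Sum>i\<in>T. w $ i * u $ i)"
    for T
  proof (induction T rule: finite_induct)
    case empty
    have "(\<chi> i. axis i 1) = (mat 1 :: real^'n^'n)" by (auto simp: vec_eq_iff mat_def axis_def)
    then show ?case by simp
  next
    case (insert j T)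
    let ?c = "\<lambda>i. if i \<in> T then axis i 1 + w $ i *s u else axis i 1"
    have 1: "(\<chi> i. if i \<in> insert j T then axis i 1 + w $ i *s u else axis i 1)
        = (\<chi> i. if i = j then axis j 1 + w $ j *s u else ?c i)"
      by (auto simp: vec_eq_iff)
    have 2: "(\<chi> i. if i = j then axis j 1 else ?c i) = (\<chi> i. ?c i)"
      using insert by (auto simp: vec_eq_iff)
    have 3: "det (\<chi> i. if i = j then w $ j *s u else ?c i) = w $ j * det (\<chi> i. if i = j then u else ?c i)"
      by (rule det_row_mul)
    have 4: "det (\<chi> i. if i = j then u else ?c i) = u $ j"
      using insert by (intro det_add_multiple_of_row)
    have "det (\<chi> i. if i = j then axis j 1 + w $ j *s u else ?c i)
      = det (\<chi> i. if i = j then axis j 1 else ?c i) + det (\<chi> i. if i = j then w $ j *s u else ?c i)"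
      by (rule det_row_add)
    then show ?case unfolding 1 2 3 4 using insert by simp
  qed
  from this[of UNIV]
  have "det (\<chi> i. axis i 1 + w $ i *s u) = 1 + w \<bullet> u" by (simp add: inner_vec_def)
  also have "(\<chi> i. axis i 1 + w $ i *s u) = mat 1 + outer w u"
    by (auto simp: vec_eq_iff mat_def axis_def outer_def)
  finally show ?thesis .
qed

text \<open>Leibniz expansion. The crude constant is enough: only the logarithm of the determinant
  matters, so polynomial growth in the entries suffices.\<close>

lemma abs_det_le:
  fixes A :: "real^'n^'n"
  assumes "\<And>i j. \<bar>A $ i $ j\<bar> \<le> c"
  shows "\<bar>det A\<bar> \<le> fact CARD('n) * c ^ CARD('n)"
proof -
  have c: "0 \<le> c" using assms[of undefined undefined] by linarith
  have "\<bar>det A\<bar> \<le> (\<Sum>p | p permutes (UNIV::'n set). \<bar>of_int (sign p) * (\<Prod>i\<in>UNIV. A $ i $ p i)\<bar>)"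
    unfolding det_def by (rule sum_abs)
  also have "\<dots> \<le> (\<Sum>p | p permutes (UNIV::'n set). c ^ CARD('n))"
  proof (rule sum_mono)
    fix p
    have "\<bar>of_int (sign p) * (\<Prod>i\<in>UNIV. A $ i $ p i)\<bar> = (\<Prod>i\<in>UNIV. \<bar>A $ i $ p i\<bar>)"
      by (simp add: abs_mult abs_prod sign_def)
    also have "\<dots> \<le> (\<Prod>i\<in>(UNIV::'n set). c)" by (rule prod_mono) (auto simp: assms)
    finally show "\<bar>of_int (sign p) * (\<Prod>i\<in>UNIV. A $ i $ p i)\<bar> \<le> c ^ CARD('n)" by simp
  qed
  also have "\<dots> = fact CARD('n) * c ^ CARD('n)"
    by (simp add: card_permutations)
  finally show ?thesis .
qed

section \<open>Algebra of the recursive update: gain, leverage and determinant\<close>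

lemma outer_mult_vec: "outer u v *v x = (v \<bullet> x) *\<^sub>R (u :: real^'n)"
  by (simp add: vec_eq_iff outer_def matrix_vector_mult_def inner_vec_def sum_distrib_left sum_distrib_right mult_ac)

lemma matrix_vector_mult_sum_left: "(\<Sum>k\<in>I. A k) *v x = (\<Sum>k\<in>I. A k *v (x :: real^'n))"
  by (induction I rule: infinite_finite_induct) (auto simp: matrix_vector_mult_add_rdistrib)

lemma scaleR_matrix_vector: "(c *\<^sub>R A) *v x = c *\<^sub>R (A *v (x :: real^'n))"
  by (simp add: vec_eq_iff matrix_vector_mult_def sum_distrib_left mult.assoc)

lemma matrix_mult_matrix_inv: "invertible A \<Longrightarrow> A ** matrix_inv A = mat 1"
  unfolding invertible_def matrix_inv_def by (rule someI2_ex) auto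

text \<open>The Gram matrix before observation \<open>n\<close> is added: \<open>T 0\<close> is the
  identity, and the matrix \<open>wls_S\<close> of time \<open>n\<close> is
  \<open>T (Suc n)\<close>. With this shift the Lyapunov function starts at the initial
  estimate.\<close>

definition wls_T :: "(nat \<Rightarrow> real) \<Rightarrow> (nat \<Rightarrow> real^'k) \<Rightarrow> nat \<Rightarrow> real^'k^'k" where
  "wls_T a \<Phi> n = (\<Sum>k<n. a k *\<^sub>R outer (\<Phi> k) (\<Phi> k)) + mat 1"

definition wls_gain :: "(nat \<Rightarrow> real) \<Rightarrow> (nat \<Rightarrow> real^'k) \<Rightarrow> nat \<Rightarrow> real^'k" where
  "wls_gain a \<Phi> n = matrix_inv (wls_T a \<Phi> (Suc n)) *v \<Phi> n"

text \<open>The weighted leverage score of observation \<open>n\<close>. It measures how much this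
  observation enlarges the Gram matrix and lies between 0 and 1.\<close>

definition leverage :: "(nat \<Rightarrow> real) \<Rightarrow> (nat \<Rightarrow> real^'k) \<Rightarrow> nat \<Rightarrow> real" where
  "leverage a \<Phi> n = a n * (\<Phi> n \<bullet> wls_gain a \<Phi> n)"

locale wls =
  fixes a :: "nat \<Rightarrow> real" and \<Phi> :: "nat \<Rightarrow> real^'k"
  assumes a_nonneg: "\<And>n. 0 \<le> a n"
begin

abbreviation "T \<equiv> wls_T a \<Phi>"
abbreviation "z \<equiv> wls_gain a \<Phi>"
abbreviation "f \<equiv> leverage a \<Phi>"

lemma T_0: "T 0 = mat 1"
  by (simp add: wls_T_def)

lemma T_mult: "T n *v v = v + (\<Sum>k<n. (a k * (\<Phi> k \<bullet> v)) *\<^sub>R \<Phi> k)"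
  by (simp add: wls_T_def matrix_vector_mult_add_rdistrib matrix_vector_mult_sum_left
      scaleR_matrix_vector outer_mult_vec add.commute)

lemma T_Suc_mult: "T (Suc n) *v v = T n *v v + (a n * (\<Phi> n \<bullet> v)) *\<^sub>R \<Phi> n"
  by (simp add: T_mult)

lemma T_form: "u \<bullet> (T n *v v) = u \<bullet> v + (\<Sum>k<n. a k * (\<Phi> k \<bullet> u) * (\<Phi> k \<bullet> v))"
  by (simp add: T_mult inner_add_right inner_sum_right inner_commute mult.commute mult.left_commute)

lemma T_sym: "u \<bullet> (T n *v v) = v \<bullet> (T n *v u)"
  by (simp add: T_form inner_commute mult.commute mult.left_commute)

lemma T_ge: "v \<bullet> v \<le> v \<bullet> (T n *v v)"
proof -
  have "0 \<le> (\<Sum>k<n. a k * (\<Phi> k \<bullet> v) * (\<Phi> k \<bullet> v))"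
    by (rule sum_nonneg) (simp add: a_nonneg mult.assoc)
  then show ?thesis by (simp add: T_form)
qed

lemma T_invertible: "invertible (T n)"
proof -
  have "\<forall>v. T n *v v = 0 \<longrightarrow> v = 0"
  proof (intro allI impI)
    fix v assume "T n *v v = 0"
    with T_ge[of v n] show "v = 0" by (metis inner_eq_zero_iff inner_ge_zero inner_zero_right order_antisym)
  qed
  then show ?thesis by (simp add: invertible_left_inverse matrix_left_invertible_ker)
qed

lemma T_gain: "T (Suc n) *v z n = \<Phi> n"
proof -
  have "T (Suc n) ** matrix_inv (T (Suc n)) = mat 1"
    using T_invertible by (rule matrix_mult_matrix_inv)
  then show ?thesis
    unfolding wls_gain_def by (simp add: matrix_vector_mul_assoc)
qed

text \<open>A form of the Sherman-Morrison formula that avoids inverting \<open>T n\<close>: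
  removing the rank-one update from \<open>T (Suc n)\<close> only rescales the regressor.\<close>

lemma T_gain': "T n *v z n = (1 - f n) *\<^sub>R \<Phi> n"
proof -
  have "\<Phi> n = T n *v z n + f n *\<^sub>R \<Phi> n"
    using T_gain[of n] T_Suc_mult[of n "z n"] by (simp add: leverage_def)
  then show ?thesis by (metis add_diff_cancel_right' scaleR_left_diff_distrib scaleR_one)
qed

lemma gain_form: "a n * (z n \<bullet> (T n *v z n)) = (1 - f n) * f n"
  by (simp add: T_gain' leverage_def inner_commute)

lemma leverage_nonneg: "0 \<le> f n"
proof -
  have "0 \<le> z n \<bullet> (T (Suc n) *v z n)" using T_ge[of "z n" "Suc n"] inner_ge_zero[of "z n"] by linarith
  then show ?thesis unfolding T_gain leverage_def by (simp add: a_nonneg inner_commute)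
qed

text \<open>This is \<open>f \<le> t / (1 + t)\<close> for
  \<open>t = a n * (norm (\<Phi> n))\<^sup>2\<close>. Cauchy-Schwarz bounds the square of
  \<open>f\<close> by \<open>t\<close> times \<open>a n * (z n \<bullet> z n)\<close>. Since
  \<open>T n\<close> dominates the identity, the latter is at most \<open>(1 - f n) * f n\<close>,
  and one factor cancels.\<close>

lemma leverage_bound: "f n * (1 + a n * (norm (\<Phi> n))\<^sup>2) \<le> a n * (norm (\<Phi> n))\<^sup>2"
proof (cases "f n = 0")
  case True
  then show ?thesis by (simp add: a_nonneg)
next
  case False
  with leverage_nonneg have pos: "0 < f n" by (metis order_le_less)
  have "f n \<le> a n * (norm (\<Phi> n) * norm (z n))"
    unfolding leverage_def by (intro mult_left_mono norm_cauchy_schwarz a_nonneg)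
  then have "(f n)\<^sup>2 \<le> (a n * (norm (\<Phi> n) * norm (z n)))\<^sup>2" using pos by (intro power_mono) auto
  also have "\<dots> = a n * (norm (\<Phi> n))\<^sup>2 * (a n * (z n \<bullet> z n))"
    by (simp add: power_mult_distrib power2_eq_square dot_square_norm)
  also have "\<dots> \<le> a n * (norm (\<Phi> n))\<^sup>2 * (a n * (z n \<bullet> (T n *v z n)))"
    by (intro mult_left_mono T_ge) (auto simp: a_nonneg)
  also have "\<dots> = a n * (norm (\<Phi> n))\<^sup>2 * ((1 - f n) * f n)" by (simp only: gain_form)
  finally have "f n * f n \<le> (a n * (norm (\<Phi> n))\<^sup>2 * (1 - f n)) * f n"
    by (simp add: power2_eq_square mult.assoc)
  then have "f n \<le> a n * (norm (\<Phi> n))\<^sup>2 * (1 - f n)" using pos by simp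
  then show ?thesis by (simp add: algebra_simps)
qed

lemma one_minus_leverage: "1 / (1 + a n * (norm (\<Phi> n))\<^sup>2) \<le> 1 - f n"
proof -
  have "0 \<le> a n * (norm (\<Phi> n))\<^sup>2" by (simp add: a_nonneg)
  then show ?thesis using leverage_bound[of n] by (simp add: field_simps)
qed

lemma leverage_less_1: "f n < 1"
proof -
  have "0 \<le> a n * (norm (\<Phi> n))\<^sup>2" by (simp add: a_nonneg)
  then have "0 < 1 / (1 + a n * (norm (\<Phi> n))\<^sup>2)" by simp
  then show ?thesis using one_minus_leverage[of n] by linarith
qed

text \<open>\<open>T n\<close> is \<open>T (Suc n)\<close> times the identity minus a rank-one
  matrix, and the determinant of the second factor is one minus the leverage.\<close>

lemma det_T_Suc: "det (T n) = det (T (Suc n)) * (1 - f n)"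
proof -
  have "T n *v v = (T (Suc n) ** (mat 1 + outer (- (a n *\<^sub>R z n)) (\<Phi> n))) *v v" for v
  proof -
    have "(T (Suc n) ** (mat 1 + outer (- (a n *\<^sub>R z n)) (\<Phi> n))) *v v
        = T (Suc n) *v (v - (a n * (\<Phi> n \<bullet> v)) *\<^sub>R z n)"
      by (simp add: matrix_vector_mul_assoc[symmetric] matrix_vector_mult_add_rdistrib outer_mult_vec mult.commute)
    also have "\<dots> = T (Suc n) *v v - (a n * (\<Phi> n \<bullet> v)) *\<^sub>R \<Phi> n"
      by (simp add: matrix_vector_mult_diff_distrib matrix_vector_mult_scaleR T_gain)
    finally show ?thesis by (simp add: T_Suc_mult)
  qed
  then have "T n = T (Suc n) ** (mat 1 + outer (- (a n *\<^sub>R z n)) (\<Phi> n))"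
    by (simp add: matrix_eq)
  then have "det (T n) = det (T (Suc n)) * det (mat 1 + outer (- (a n *\<^sub>R z n)) (\<Phi> n))"
    by (simp add: det_mul)
  then show ?thesis by (simp add: det_rank_one_update leverage_def inner_commute)
qed

lemma det_T_ge_1: "1 \<le> det (T n)"
proof (induction n)
  case (Suc n)
  have "det (T (Suc n)) = det (T n) / (1 - f n)"
    using leverage_less_1[of n] by (simp add: det_T_Suc[of n])
  also have "\<dots> \<ge> 1" using Suc leverage_less_1[of n] leverage_nonneg[of n] by (simp add: field_simps)
  finally show ?case .
qed (simp add: T_0)

text \<open>Turns leverages into increments of log det, ready for the comparison of a series with an
  integral.\<close>

lemma leverage_le_ln_det: "f n \<le> ln (det (T (Suc n))) - ln (det (T n))"
proof -
  have "ln (det (T n)) = ln (det (T (Suc n))) + ln (1 - f n)"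
    using det_T_ge_1[of "Suc n"] leverage_less_1[of n] by (subst det_T_Suc) (simp add: ln_mult)
  moreover have "ln (1 - f n) \<le> - f n" using ln_le_minus_one[of "1 - f n"] leverage_less_1[of n] by simp
  ultimately show ?thesis by linarith
qed

lemma det_T_le: "det (T n) \<le> fact CARD('k) * (1 + (\<Sum>k<n. a k * (norm (\<Phi> k))\<^sup>2)) ^ CARD('k)"
proof -
  have "\<bar>T n $ i $ j\<bar> \<le> 1 + (\<Sum>k<n. a k * (norm (\<Phi> k))\<^sup>2)" for i j
  proof -
    have "T n $ i $ j = (\<Sum>k<n. a k * (\<Phi> k $ i * \<Phi> k $ j)) + (if i = j then 1 else 0)"
      by (simp add: wls_T_def outer_def mat_def)
    also have "\<bar>\<dots>\<bar> \<le> \<bar>\<Sum>k<n. a k * (\<Phi> k $ i * \<Phi> k $ j)\<bar> + 1"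
      by (auto intro: order_trans[OF abs_triangle_ineq])
    also have "\<bar>\<Sum>k<n. a k * (\<Phi> k $ i * \<Phi> k $ j)\<bar> \<le> (\<Sum>k<n. \<bar>a k * (\<Phi> k $ i * \<Phi> k $ j)\<bar>)" by (rule sum_abs)
    also have "\<dots> \<le> (\<Sum>k<n. a k * (norm (\<Phi> k))\<^sup>2)"
    proof (rule sum_mono)
      fix k
      have "\<bar>\<Phi> k $ i\<bar> * \<bar>\<Phi> k $ j\<bar> \<le> norm (\<Phi> k) * norm (\<Phi> k)"
        by (intro mult_mono component_le_norm_cart) auto
      then show "\<bar>a k * (\<Phi> k $ i * \<Phi> k $ j)\<bar> \<le> a k * (norm (\<Phi> k))\<^sup>2"
        using a_nonneg[of k] by (simp add: abs_mult power2_eq_square mult_left_mono)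
    qed
    finally show ?thesis by simp
  qed
  from abs_det_le[OF this] show ?thesis by simp
qed

text \<open>One step of the Lyapunov function for one column \<open>t\<close> of the estimation error, with prediction
  error \<open>- t \<bullet> \<Phi>\<close> and noise \<open>e\<close>.\<close>

lemma lyapunov_step:
  assumes "t' = t + (a n * (e - t \<bullet> \<Phi> n)) *\<^sub>R z n"
  shows "t' \<bullet> (T (Suc n) *v t') = t \<bullet> (T n *v t) - a n * (1 - f n) * (- (t \<bullet> \<Phi> n))\<^sup>2
     - 2 * (a n * (1 - f n) * (- (t \<bullet> \<Phi> n)) * e) + a n * f n * e\<^sup>2"
proof -
  let ?c = "a n * (e - t \<bullet> \<Phi> n)"
  have "t' \<bullet> (T (Suc n) *v t') = t \<bullet> (T (Suc n) *v t) + 2 * ?c * (t \<bullet> (T (Suc n) *v z n))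
      + ?c * ?c * (z n \<bullet> (T (Suc n) *v z n))"
    using T_sym[of "z n" "Suc n" t]
    by (simp add: assms matrix_vector_right_distrib matrix_vector_mult_scaleR inner_add_left inner_add_right algebra_simps)
  also have "z n \<bullet> (T (Suc n) *v z n) = \<Phi> n \<bullet> z n" by (simp add: T_gain inner_commute)
  also have "?c * ?c * (\<Phi> n \<bullet> z n) = a n * f n * (e - t \<bullet> \<Phi> n)\<^sup>2"
    by (simp add: leverage_def power2_eq_square)
  also have "t \<bullet> (T (Suc n) *v z n) = t \<bullet> \<Phi> n" by (simp add: T_gain)
  also have "t \<bullet> (T (Suc n) *v t) = t \<bullet> (T n *v t) + a n * (t \<bullet> \<Phi> n)\<^sup>2"
    by (simp add: T_Suc_mult inner_add_right power2_eq_square inner_commute)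
  finally show ?thesis by (simp add: power2_eq_square algebra_simps)
qed

end

text \<open>Compares one rectangle of width \<open>y - x\<close> with the integral of the decreasing
  function \<open>t powr (- (1 + \<gamma>))\<close>; the mean value theorem stands in for the
  integral.\<close>

lemma powr_telescope:
  fixes \<gamma> :: real
  assumes "0 < x" "x \<le> y" "0 < \<gamma>"
  shows "(y - x) * y powr (- (1 + \<gamma>)) \<le> (x powr (-\<gamma>) - y powr (-\<gamma>)) / \<gamma>"
proof (cases "x = y")
  case False
  with assms have xy: "x < y" by simp
  have "\<exists>\<xi>. \<xi> > x \<and> \<xi> < y \<and> y powr (-\<gamma>) - x powr (-\<gamma>) = (y - x) * (-\<gamma> * \<xi> powr (-\<gamma> - 1))"
    using xy assms(1) by (intro MVT2) (auto intro!: derivative_eq_intros)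
  then obtain \<xi> where \<xi>: "x < \<xi>" "\<xi> < y" "y powr (-\<gamma>) - x powr (-\<gamma>) = (y - x) * (-\<gamma> * \<xi> powr (-\<gamma> - 1))"
    by blast
  have "y powr (- (1 + \<gamma>)) \<le> \<xi> powr (- \<gamma> - 1)"
  proof -
    have "- (1 + \<gamma>) = - \<gamma> - 1" by simp
    then show ?thesis using \<xi>(1,2) assms by (simp only:) (intro powr_mono2', auto)
  qed
  then have "(y - x) * y powr (- (1 + \<gamma>)) \<le> (y - x) * \<xi> powr (- \<gamma> - 1)" using xy by (intro mult_left_mono) auto
  also have "\<dots> = (x powr (-\<gamma>) - y powr (-\<gamma>)) / \<gamma>" using \<xi>(3) assms by (simp add: field_simps)
  finally show ?thesis .
qed simp

lemma mono_unboundedD: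
  fixes s :: "nat \<Rightarrow> real"
  assumes "filterlim s at_top sequentially"
  obtains N where "\<And>n. n \<ge> N \<Longrightarrow> c \<le> s n"
  using assms unfolding filterlim_at_top eventually_sequentially by blast

lemma ln_powr_le_linear:
  fixes \<gamma> \<eta> :: real
  assumes "0 < \<eta>" "0 < \<gamma>"
  shows "\<exists>C\<ge>0. \<forall>s\<ge>1. (ln s) powr (1 + \<gamma>) \<le> C + \<eta> * s"
proof -
  have "eventually (\<lambda>s::real. (ln s) powr (1 + \<gamma>) \<le> \<eta> * s) at_top"
    using assms by real_asymp
  then obtain s0 where s0: "\<And>s. s \<ge> s0 \<Longrightarrow> (ln s) powr (1 + \<gamma>) \<le> \<eta> * s" by (auto simp: eventually_at_top_linorder)
  have "(ln s) powr (1 + \<gamma>) \<le> (ln (max 1 s0)) powr (1 + \<gamma>) + \<eta> * s" if "s \<ge> 1" for s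
  proof (cases "s \<ge> s0")
    case True
    then show ?thesis using s0[of s] powr_ge_zero[of "ln (max 1 s0)" "1 + \<gamma>"] by linarith
  next
    case False
    then have "(ln s) powr (1 + \<gamma>) \<le> (ln (max 1 s0)) powr (1 + \<gamma>)" using that assms
      by (intro powr_mono2) auto
    moreover have "0 \<le> \<eta> * s" using assms that by simp
    ultimately show ?thesis by linarith
  qed
  then show ?thesis using powr_ge_zero by blast
qed


lemma eventually_nonneg_bound:
  fixes g :: "nat \<Rightarrow> real"
  assumes "\<And>n. n \<ge> N \<Longrightarrow> g n \<le> h n + C" "\<And>n. 0 \<le> h n"
  shows "\<exists>C. \<forall>n. g n \<le> C + h n"
proof -
  have "g n \<le> (\<bar>C\<bar> + (\<Sum>k<N. \<bar>g k\<bar>)) + h n" for n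
  proof (cases "n \<ge> N")
    case True
    have "0 \<le> (\<Sum>k<N. \<bar>g k\<bar>)" by (rule sum_nonneg) simp
    then show ?thesis using assms(1)[OF True] by linarith
  next
    case False
    then have "\<bar>g n\<bar> \<le> (\<Sum>k<N. \<bar>g k\<bar>)" by (intro member_le_sum) auto
    then show ?thesis using assms(2)[of n] by linarith
  qed
  then show ?thesis by blast
qed

section \<open>Lyapunov bound and prediction energy on a path of diverging energy\<close>

locale wls_path = wls a \<Phi> for a and \<Phi> :: "nat \<Rightarrow> real^'k" +
  fixes \<gamma> :: real and s :: "nat \<Rightarrow> real"
  assumes s_def: "\<And>n. s n = (\<Sum>k\<le>n. (norm (\<Phi> k))\<^sup>2)"
    and weight: "\<And>n. 1 < s n \<Longrightarrow> a n = (1 / ln (s n)) powr (1 + \<gamma>)"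
    and gamma: "0 < \<gamma>"
    and s_top: "filterlim s at_top sequentially"
begin

lemma s_mono: "m \<le> n \<Longrightarrow> s m \<le> s n"
  unfolding s_def by (rule sum_mono2) auto

lemma s_nonneg: "0 \<le> s n"
  unfolding s_def by (rule sum_nonneg) auto

lemma s_ge_exp: obtains N where "\<And>n. n \<ge> N \<Longrightarrow> exp 1 \<le> s n"
  using mono_unboundedD[OF s_top, of "exp 1"] by blast

lemma weight_large:
  assumes "exp 1 \<le> s n"
  shows "1 \<le> ln (s n)" "a n = (ln (s n)) powr (- (1 + \<gamma>))" "0 < a n" "a n \<le> 1"
    "1 / a n = (ln (s n)) powr (1 + \<gamma>)"
proof -
  have s1: "1 < s n" using assms one_less_exp_iff[of "1::real"] by linarith
  show l: "1 \<le> ln (s n)" using assms s1 by (subst ln_ge_iff) auto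
  show a: "a n = (ln (s n)) powr (- (1 + \<gamma>))"
    using weight[OF s1] l powr_minus_divide[of "ln (s n)" "1 + \<gamma>"] by (simp add: powr_divide)
  show "0 < a n" unfolding a using l by simp
  show "a n \<le> 1" unfolding a using l gamma powr_mono[of "-(1+\<gamma>)" 0 "ln (s n)"] by simp
  show "1 / a n = (ln (s n)) powr (1 + \<gamma>)" unfolding a using l powr_minus_divide[of "ln (s n)" "1 + \<gamma>"] by simp
qed

lemma weights_bounded: obtains A where "1 \<le> A" "\<And>n. a n \<le> A"
proof -
  obtain N where N: "\<And>n. n \<ge> N \<Longrightarrow> exp 1 \<le> s n" using s_ge_exp by blast
  have "\<exists>C. \<forall>n. a n \<le> C + 0"
    by (rule eventually_nonneg_bound[of N _ "\<lambda>_. 0" 1]) (use weight_large(4)[OF N] in auto)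
  then obtain C where "\<And>n. a n \<le> C" by auto
  then show ?thesis using that[of "max 1 C"] by (auto simp: le_max_iff_disj)
qed

text \<open>The determinant is bounded by a polynomial in the weighted energy, which is of order
  \<open>s n\<close> because the weights are bounded. Constants are absorbed since log
  \<open>s n\<close> is at least 1 from some time on.\<close>

lemma ln_det_T_le: "\<exists>C>0. \<exists>N. \<forall>n\<ge>N. 1 + ln (det (T (Suc n))) \<le> C * ln (s n)"
proof -
  obtain N where N: "\<And>n. n \<ge> N \<Longrightarrow> exp 1 \<le> s n" using s_ge_exp by blast
  obtain A where A: "1 \<le> A" "\<And>n. a n \<le> A" using weights_bounded by blast
  define K where "K = real CARD('k)"
  define C where "C = 1 + ln (fact CARD('k)) + K * ln (1 + A) + K"
  have K: "0 \<le> K" by (simp add: K_def)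
  have f1: "1 \<le> (fact CARD('k) :: real)" by (metis fact_ge_1)
  have f: "0 \<le> ln (fact CARD('k) :: real)" using f1 by simp
  have lA: "0 \<le> ln (1 + A)" using A by simp
  have "1 + ln (det (T (Suc n))) \<le> C * ln (s n)" if "n \<ge> N" for n
  proof -
    note W = weight_large[OF N[OF that]]
    have s1: "1 \<le> s n" using N[OF that] one_less_exp_iff[of "1::real"] by linarith
    have "(\<Sum>k<Suc n. a k * (norm (\<Phi> k))\<^sup>2) \<le> (\<Sum>k\<le>n. A * (norm (\<Phi> k))\<^sup>2)"
      unfolding lessThan_Suc_atMost by (intro sum_mono mult_right_mono A) auto
    also have "\<dots> = A * s n" by (simp add: s_def sum_distrib_left)
    finally have "1 + (\<Sum>k<Suc n. a k * (norm (\<Phi> k))\<^sup>2) \<le> (1 + A) * s n" using s1 by (simp add: distrib_right)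
    moreover have "0 \<le> 1 + (\<Sum>k<Suc n. a k * (norm (\<Phi> k))\<^sup>2)"
      by (intro add_nonneg_nonneg sum_nonneg mult_nonneg_nonneg a_nonneg) auto
    ultimately have "fact CARD('k) * (1 + (\<Sum>k<Suc n. a k * (norm (\<Phi> k))\<^sup>2)) ^ CARD('k)
        \<le> fact CARD('k) * ((1 + A) * s n) ^ CARD('k)"
      by (intro mult_left_mono power_mono) auto
    with det_T_le[of "Suc n"] have "det (T (Suc n)) \<le> fact CARD('k) * ((1 + A) * s n) ^ CARD('k)" by linarith
    then have "ln (det (T (Suc n))) \<le> ln (fact CARD('k) * ((1 + A) * s n) ^ CARD('k))"
      using det_T_ge_1[of "Suc n"] by (subst ln_le_cancel_iff) auto
    also have "\<dots> = ln (fact CARD('k)) + K * (ln (1 + A) + ln (s n))"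
      using s1 A f1 by (simp add: ln_mult ln_realpow K_def)
    also have "\<dots> \<le> ln (fact CARD('k)) * ln (s n) + K * (ln (1 + A) * ln (s n) + ln (s n))"
    proof -
      have g: "c \<le> c * ln (s n)" if "0 \<le> c" for c using mult_left_mono[OF W(1) that] by simp
      show ?thesis using K g[OF f] g[OF lA] by (intro add_mono mult_left_mono) auto
    qed
    finally show ?thesis using W(1) unfolding C_def by (simp add: algebra_simps)
  qed
  moreover have "0 < C" unfolding C_def using f K lA by (intro add_pos_nonneg) auto
  ultimately show ?thesis by blast
qed

text \<open>With \<open>D n\<close> one plus log det of \<open>T n\<close>, the weight is eventually
  at most a constant times \<open>D (Suc n) powr (- (1 + \<gamma>))\<close>, while the leverage is
  at most \<open>D (Suc n) - D n\<close>. The products are dominated by a telescoping series in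
  \<open>D n powr (-\<gamma>)\<close>.\<close>

lemma leverage_summable: "summable (\<lambda>n. a n * f n)"
proof -
  obtain C N1 where C: "0 < C" "\<And>n. n \<ge> N1 \<Longrightarrow> 1 + ln (det (T (Suc n))) \<le> C * ln (s n)"
    using ln_det_T_le by blast
  obtain N2 where N2: "\<And>n. n \<ge> N2 \<Longrightarrow> exp 1 \<le> s n" using s_ge_exp by blast
  define D where "D n = 1 + ln (det (T n))" for n
  have D1: "1 \<le> D n" for n unfolding D_def using det_T_ge_1[of n] by simp
  have D_mono: "D n \<le> D (Suc n)" "f n \<le> D (Suc n) - D n" for n
    unfolding D_def using leverage_le_ln_det[of n] leverage_nonneg[of n] by linarith+
  let ?g = "\<lambda>n. (C powr (1 + \<gamma>) / \<gamma>) * (D n powr (-\<gamma>) - D (Suc n) powr (-\<gamma>))"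
  have dec: "decseq (\<lambda>n. D n powr (-\<gamma>))"
    unfolding decseq_Suc_iff
  proof
    fix n
    show "D (Suc n) powr (-\<gamma>) \<le> D n powr (-\<gamma>)"
      by (rule powr_mono2') (use D1[of n] D_mono(1)[of n] gamma in linarith)+
  qed
  obtain L where "(\<lambda>n. D n powr (-\<gamma>)) \<longlonglongrightarrow> L" "\<forall>n. L \<le> D n powr (-\<gamma>)"
    by (rule decseq_convergent[OF dec, of 0]) auto
  then have "summable (\<lambda>n. D n powr (-\<gamma>) - D (Suc n) powr (-\<gamma>))"
    by (intro telescope_summable')
  then have "summable ?g" by (rule summable_mult)
  then show ?thesis
  proof (rule summable_comparison_test'[of _ "max N1 N2"])
    fix n assume n: "max N1 N2 \<le> n"
    then have W: "1 \<le> ln (s n)" "a n = (ln (s n)) powr (- (1 + \<gamma>))" using weight_large(1,2)[OF N2[of n]] by auto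
    have "D (Suc n) / C \<le> ln (s n)" using C n unfolding D_def by (simp add: field_simps)
    then have "a n \<le> (D (Suc n) / C) powr (- (1 + \<gamma>))"
      unfolding W(2) using C(1) D1[of "Suc n"] gamma by (intro powr_mono2') auto
    also have "\<dots> = C powr (1 + \<gamma>) * D (Suc n) powr (- (1 + \<gamma>))"
      using C(1) D1[of "Suc n"] powr_minus_divide[of C "1 + \<gamma>"] by (subst powr_divide) auto
    finally have "a n * f n \<le> (C powr (1 + \<gamma>) * D (Suc n) powr (- (1 + \<gamma>))) * (D (Suc n) - D n)"
      using D_mono(2)[of n] leverage_nonneg[of n] by (intro mult_mono) auto
    also have "\<dots> = C powr (1 + \<gamma>) * ((D (Suc n) - D n) * D (Suc n) powr (- (1 + \<gamma>)))" by simp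
    also have "\<dots> \<le> C powr (1 + \<gamma>) * ((D n powr (-\<gamma>) - D (Suc n) powr (-\<gamma>)) / \<gamma>)"
      using D1[of n] D_mono(1)[of n] gamma by (intro mult_left_mono powr_telescope) auto
    finally show "norm (a n * f n) \<le> ?g n"
      using a_nonneg[of n] leverage_nonneg[of n] by simp
  qed
qed

text \<open>After summation of \<open>lyapunov_step\<close> the noise appears in a martingale
  transform, which half of the accumulated decrease absorbs, and in a nonnegative series that
  converges by \<open>sq\<close>. What remains bounds the Lyapunov function and the other half of
  the decrease at once.\<close>

lemma column_bounded:
  fixes t :: "nat \<Rightarrow> real^'k" and e :: "nat \<Rightarrow> real"
  defines "\<pi> \<equiv> \<lambda>n. - (t n \<bullet> \<Phi> n)"
  assumes rec: "\<And>n. t (Suc n) = t n + (a n * (e n - t n \<bullet> \<Phi> n)) *\<^sub>R z n"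
    and slln: "self_normalized (\<lambda>n. a n * (1 - f n) * \<pi> n) e"
    and sq: "summable (\<lambda>n. a n * f n * (e n)\<^sup>2)"
  shows "\<exists>C. \<forall>n. t n \<bullet> (T n *v t n) \<le> C" "summable (\<lambda>n. a n * (1 - f n) * (\<pi> n)\<^sup>2)"
proof -
  let ?V = "\<lambda>n. t n \<bullet> (T n *v t n)"
  let ?\<tau> = "\<lambda>n. a n * (1 - f n) * (\<pi> n)\<^sup>2"
  let ?w = "\<lambda>n. a n * (1 - f n) * \<pi> n"
  have f01: "0 \<le> 1 - f n" "1 - f n \<le> 1" for n using leverage_less_1[of n] leverage_nonneg[of n] by auto
  have \<tau>0: "0 \<le> ?\<tau> n" for n using a_nonneg[of n] f01[of n] by simp
  have V: "?V n = ?V 0 - (\<Sum>k<n. ?\<tau> k) - 2 * (\<Sum>k<n. ?w k * e k) + (\<Sum>k<n. a k * f k * (e k)\<^sup>2)" for n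
  proof (induction n)
    case (Suc n)
    then show ?case using lyapunov_step[OF rec[of n]] by (simp add: \<pi>_def)
  qed simp
  obtain A where A: "1 \<le> A" "\<And>n. a n \<le> A" using weights_bounded by blast
  \<comment> \<open>The transform enters with factor 2, and its squared weights are at most
    \<open>A\<close> times the decrease, so this choice costs exactly half of the decrease.\<close>
  have "0 < 1 / (4 * A)" using A(1) by simp
  then obtain C where C: "\<And>n. \<bar>\<Sum>k<n. ?w k * e k\<bar> \<le> C + 1 / (4 * A) * (\<Sum>k<n. (?w k)\<^sup>2)"
    using slln unfolding self_normalized_def by blast
  have wsq: "(?w k)\<^sup>2 \<le> A * ?\<tau> k" for k
  proof -
    have "(?w k)\<^sup>2 = a k * (1 - f k) * ?\<tau> k" by (simp add: power2_eq_square)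
    also have "\<dots> \<le> A * ?\<tau> k"
      using A(2)[of k] f01[of k] a_nonneg[of k] \<tau>0[of k] mult_mono[of "a k" A "1 - f k" 1] by (intro mult_right_mono) auto
    finally show ?thesis .
  qed
  define E where "E = (\<Sum>k. a k * f k * (e k)\<^sup>2)"
  have E: "(\<Sum>k<n. a k * f k * (e k)\<^sup>2) \<le> E" for n
    unfolding E_def using a_nonneg leverage_nonneg by (intro sum_le_suminf sq) auto
  have main: "?V n + (\<Sum>k<n. ?\<tau> k) / 2 \<le> ?V 0 + 2 * C + E" for n
  proof -
    have "(\<Sum>k<n. (?w k)\<^sup>2) \<le> A * (\<Sum>k<n. ?\<tau> k)" unfolding sum_distrib_left by (intro sum_mono wsq)
    then have "1 / (4 * A) * (\<Sum>k<n. (?w k)\<^sup>2) \<le> 1 / (4 * A) * (A * (\<Sum>k<n. ?\<tau> k))"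
      using A(1) by (intro mult_left_mono) auto
    also have "\<dots> = (\<Sum>k<n. ?\<tau> k) / 4" using A(1) by simp
    finally show ?thesis using V[of n] C[of n] E[of n] by linarith
  qed
  have V0: "0 \<le> ?V n" for n using T_ge[of "t n" n] inner_ge_zero[of "t n"] by linarith
  have S0: "0 \<le> (\<Sum>k<n. ?\<tau> k)" for n by (intro sum_nonneg \<tau>0)
  have "?V n \<le> ?V 0 + 2 * C + E" for n using main[of n] S0[of n] by linarith
  then show "\<exists>C. \<forall>n. ?V n \<le> C" by blast
  have "(\<Sum>k\<le>n. ?\<tau> k) \<le> 2 * (?V 0 + 2 * C + E)" for n
    using main[of "Suc n"] V0[of "Suc n"] unfolding lessThan_Suc_atMost by (simp add: field_simps)
  then show "summable ?\<tau>" by (intro bounded_imp_summable[OF \<tau>0])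
qed

text \<open>By \<open>one_minus_leverage\<close> the squared error is at most
  \<open>?\<tau> n / a n + ?\<tau> n * (norm (\<Phi> n))\<^sup>2\<close>. The first parts sum to at
  most a constant times a power of log \<open>s n\<close>; the second are small against
  \<open>s n\<close> because \<open>?\<tau>\<close> tends to 0.\<close>

lemma prediction_energy_small:
  fixes \<pi> :: "nat \<Rightarrow> real"
  assumes \<tau>: "summable (\<lambda>n. a n * (1 - f n) * (\<pi> n)\<^sup>2)" and \<eta>: "0 < \<eta>"
  shows "\<exists>C. \<forall>n. (\<Sum>k\<le>n. (\<pi> k)\<^sup>2) \<le> C + \<eta> * s n"
proof -
  let ?\<tau> = "\<lambda>n. a n * (1 - f n) * (\<pi> n)\<^sup>2"
  have f01: "0 \<le> 1 - f n" "1 - f n \<le> 1" for n using leverage_less_1[of n] leverage_nonneg[of n] by auto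
  have \<tau>0: "0 \<le> ?\<tau> n" for n using a_nonneg[of n] f01[of n] by simp
  define B where "B = (\<Sum>n. ?\<tau> n)"
  have B0: "0 \<le> B" unfolding B_def by (intro suminf_nonneg \<tau> \<tau>0)
  have "?\<tau> \<longlonglongrightarrow> 0" by (rule summable_LIMSEQ_zero[OF \<tau>])
  then have "eventually (\<lambda>n. ?\<tau> n < \<eta> / 2) sequentially" using \<eta> by (intro order_tendstoD) auto
  then obtain N1 where N1: "\<And>n. n \<ge> N1 \<Longrightarrow> ?\<tau> n < \<eta> / 2" unfolding eventually_sequentially by blast
  obtain N2 where N2: "\<And>n. n \<ge> N2 \<Longrightarrow> exp 1 \<le> s n" using s_ge_exp by blast
  \<comment> \<open>Times the total mass \<open>B\<close>, this slope stays below
    \<open>\<eta> / 2\<close>; the other half of \<eta> is spent on the terms with the regressor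
    norm.\<close>
  obtain C where C: "0 \<le> C" "\<And>x. 1 \<le> x \<Longrightarrow> (ln x) powr (1 + \<gamma>) \<le> C + \<eta> / (2 * (B + 1)) * x"
    using ln_powr_le_linear[of "\<eta> / (2 * (B + 1))" \<gamma>] \<eta> B0 gamma by auto
  define N where "N = max N1 N2"
  have pt: "(\<pi> n)\<^sup>2 \<le> ?\<tau> n * (ln (s n)) powr (1 + \<gamma>) + \<eta> / 2 * (norm (\<Phi> n))\<^sup>2" if "n \<ge> N" for n
  proof -
    have W: "0 < a n" "1 / a n = (ln (s n)) powr (1 + \<gamma>)"
      using weight_large(3,5)[OF N2[of n]] that by (auto simp: N_def)
    have pos: "0 < 1 + a n * (norm (\<Phi> n))\<^sup>2" using W(1) by (intro add_pos_nonneg) auto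
    then have "1 \<le> (1 - f n) * (1 + a n * (norm (\<Phi> n))\<^sup>2)"
      using one_minus_leverage[of n] by (simp add: field_simps)
    then have "(\<pi> n)\<^sup>2 * 1 \<le> (\<pi> n)\<^sup>2 * ((1 - f n) * (1 + a n * (norm (\<Phi> n))\<^sup>2))" by (intro mult_left_mono) auto
    also have "\<dots> = ?\<tau> n * (1 / a n) + ?\<tau> n * (norm (\<Phi> n))\<^sup>2" using W(1) by (simp add: field_simps)
    also have "\<dots> \<le> ?\<tau> n * (ln (s n)) powr (1 + \<gamma>) + \<eta> / 2 * (norm (\<Phi> n))\<^sup>2"
      unfolding W(2) using N1[of n] that by (intro add_left_mono mult_right_mono) (auto simp: N_def)
    finally show ?thesis by simp
  qed
  have "(\<Sum>k\<le>n. (\<pi> k)\<^sup>2) \<le> \<eta> * s n + ((\<Sum>k<N. (\<pi> k)\<^sup>2) + B * C)" if n: "n \<ge> N" for n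
  proof -
    have s1: "1 \<le> s n" using N2[of n] n one_less_exp_iff[of "1::real"] unfolding N_def by (smt (verit) max.bounded_iff)
    have "(\<Sum>k=N..n. (\<pi> k)\<^sup>2) \<le> (\<Sum>k=N..n. ?\<tau> k * (ln (s n)) powr (1 + \<gamma>) + \<eta> / 2 * (norm (\<Phi> k))\<^sup>2)"
    proof (rule sum_mono)
      fix k assume k: "k \<in> {N..n}"
      have sk: "1 \<le> s k" using N2[of k] k one_less_exp_iff[of "1::real"] unfolding N_def by (smt (verit) max.bounded_iff atLeastAtMost_iff)
      then have "(ln (s k)) powr (1 + \<gamma>) \<le> (ln (s n)) powr (1 + \<gamma>)"
        using s_mono[of k n] k gamma by (intro powr_mono2) auto
      then show "(\<pi> k)\<^sup>2 \<le> ?\<tau> k * (ln (s n)) powr (1 + \<gamma>) + \<eta> / 2 * (norm (\<Phi> k))\<^sup>2"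
        using pt[of k] k mult_left_mono[OF _ \<tau>0[of k]] by (smt (verit) atLeastAtMost_iff)
    qed
    also have "\<dots> = (\<Sum>k=N..n. ?\<tau> k) * (ln (s n)) powr (1 + \<gamma>) + \<eta> / 2 * (\<Sum>k=N..n. (norm (\<Phi> k))\<^sup>2)"
      by (simp add: sum.distrib sum_distrib_left sum_distrib_right)
    also have "\<dots> \<le> B * (C + \<eta> / (2 * (B + 1)) * s n) + \<eta> / 2 * s n"
    proof (intro add_mono mult_mono)
      show "(\<Sum>k=N..n. ?\<tau> k) \<le> B" unfolding B_def by (intro sum_le_suminf \<tau>) (auto simp: \<tau>0)
      show "(\<Sum>k=N..n. (norm (\<Phi> k))\<^sup>2) \<le> s n" unfolding s_def by (intro sum_mono2) auto
    qed (use C s1 \<eta> B0 in \<open>auto intro!: sum_nonneg\<close>)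
    also have "\<dots> \<le> B * C + \<eta> * s n"
    proof -
      have "B * (\<eta> / (2 * (B + 1)) * s n) = B / (B + 1) * (\<eta> / 2 * s n)" using B0 by (simp add: field_simps)
      also have "\<dots> \<le> 1 * (\<eta> / 2 * s n)" using B0 \<eta> s1 by (intro mult_right_mono) auto
      finally have "B * (\<eta> / (2 * (B + 1)) * s n) \<le> \<eta> / 2 * s n" by simp
      moreover have "B * (C + \<eta> / (2 * (B + 1)) * s n) = B * C + B * (\<eta> / (2 * (B + 1)) * s n)"
        by (simp only: distrib_left)
      moreover have "\<eta> / 2 * s n + \<eta> / 2 * s n = \<eta> * s n" by simp
      ultimately show ?thesis by linarith
    qed
    finally have "(\<Sum>k=N..n. (\<pi> k)\<^sup>2) \<le> B * C + \<eta> * s n" .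
    moreover have "(\<Sum>k\<le>n. (\<pi> k)\<^sup>2) = (\<Sum>k<N. (\<pi> k)\<^sup>2) + (\<Sum>k=N..n. (\<pi> k)\<^sup>2)"
      using n by (subst sum.union_disjoint[symmetric]) (auto intro!: sum.cong)
    ultimately show ?thesis by linarith
  qed
  then show ?thesis
    by (rule eventually_nonneg_bound) (use s_nonneg \<eta> in auto)
qed

end

section \<open>Power series of the ARX filter\<close>

lemma powser_unique:
  fixes c c' :: "nat \<Rightarrow> complex"
  assumes "0 < r" "\<And>z. norm z < r \<Longrightarrow> (\<lambda>k. z ^ Suc k * c k) sums g z"
    "\<And>z. norm z < r \<Longrightarrow> (\<lambda>k. z ^ Suc k * c' k) sums g z"
  shows "c = c'"
proof (rule ccontr)
  assume "c \<noteq> c'"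
  then obtain m where m: "c m - c' m \<noteq> 0" by (auto simp: fun_eq_iff)
  define b where "b n = (case n of 0 \<Rightarrow> 0 | Suc k \<Rightarrow> c k - c' k)" for n
  have sm: "(\<lambda>n. b n * (z - 0) ^ n) sums (\<lambda>_. 0) z" if "norm (z - 0) < r" for z
  proof -
    have "(\<lambda>k. z ^ Suc k * c k - z ^ Suc k * c' k) sums (g z - g z)"
      using that by (intro sums_diff assms) auto
    then have "(\<lambda>k. b (Suc k) * z ^ Suc k) sums 0" by (simp add: b_def algebra_simps)
    then show ?thesis by (subst (asm) sums_Suc_iff) (simp add: b_def)
  qed
  have "b (Suc m) \<noteq> 0" using m by (simp add: b_def)
  then obtain t where "0 < t" "\<And>z. z \<in> cball 0 t - {0} \<Longrightarrow> (\<lambda>_::complex. 0::complex) z \<noteq> 0"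
    using powser_0_nonzero[OF \<open>0 < r\<close> sm, of "Suc m"] by auto
  from this(2)[of "of_real t"] this(1) show False by simp
qed

lemma sums_vec: 
  assumes "\<And>i. (\<lambda>k. f k $ i) sums (s $ i)"
  shows "f sums (s :: 'a::{real_normed_vector}^'n)"
  using assms unfolding sums_def by (intro vec_tendstoI) simp

lemma sums_vec_nth: "f sums s \<Longrightarrow> (\<lambda>k. f k $ i) sums (s $ i :: 'a::{real_normed_vector})"
  unfolding sums_def using tendsto_vec_nth[of "\<lambda>n. sum f {..<n}" s] by simp

lemma norm_matrix_le_sum: "norm (M :: real^'n^'m) \<le> (\<Sum>i\<in>UNIV. \<Sum>j\<in>UNIV. \<bar>M $ i $ j\<bar>)"
proof -
  have "norm M \<le> (\<Sum>i\<in>UNIV. norm (M $ i))" unfolding norm_vec_def by (rule L2_set_le_sum) simp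
  also have "\<dots> \<le> (\<Sum>i\<in>UNIV. \<Sum>j\<in>UNIV. \<bar>M $ i $ j\<bar>)"
    by (intro sum_mono norm_le_l1_cart)
  finally show ?thesis .
qed

section \<open>Impulse response of the inverse filter and the coefficients \<open>P\<close>\<close>

locale causal_arx =
  fixes p q :: nat and A B :: "nat \<Rightarrow> real^'d^'d"
  assumes causal: "\<And>z. norm z \<le> 1 \<Longrightarrow> det (B_poly q B z) \<noteq> 0"
begin

definition Bi :: "complex \<Rightarrow> 'd \<Rightarrow> 'd \<Rightarrow> complex" where
  "Bi z i j = matrix_inv (B_poly q B z) $ i $ j"

definition S where "S = {z. det (B_poly q B z) \<noteq> 0}"

lemma B_poly_nth: "B_poly q B z $ i $ j = (if i = j then 1 else 0) + (\<Sum>k=1..q. z ^ k * of_real (B k $ i $ j))"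
  by (simp add: B_poly_def mat_def cscale_def)

lemma A_poly_nth: "(A_poly p A z - mat 1) $ i $ j = - (\<Sum>k=1..p. z ^ k * of_real (A k $ i $ j))"
  by (simp add: A_poly_def mat_def cscale_def)

lemma B_holo: "(\<lambda>z. B_poly q B z $ i $ j) holomorphic_on X"
  unfolding B_poly_nth by (intro holomorphic_intros)

lemma det_holo: 
  assumes "\<And>i j. (\<lambda>z. M z $ i $ j) holomorphic_on X"
  shows "(\<lambda>z. det (M z :: complex^'d^'d)) holomorphic_on X"
  unfolding det_def by (intro holomorphic_intros assms)

lemma S_open: "open S"
  unfolding S_def
  by (intro open_Collect_neq continuous_on_const holomorphic_on_imp_continuous_on det_holo B_holo)

text \<open>A compact disc inside the open set \<open>S\<close> has a neighbourhood there. The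
  margin beyond radius 1 is what later makes the coefficients absolutely summable.\<close>

lemma radius: obtains r where "1 < r" "ball 0 r \<subseteq> S"
proof -
  have "cball 0 1 \<subseteq> S" using causal by (auto simp: S_def)
  then obtain e where e: "0 < e" "(\<Union>x\<in>cball (0::complex) 1. ball x e) \<subseteq> S"
    using compact_subset_open_imp_ball_epsilon_subset[OF compact_cball S_open] by metis
  have "z \<in> S" if z: "norm z < 1 + e" for z
  proof (cases "norm z \<le> 1")
    case True
    then show ?thesis using \<open>cball 0 1 \<subseteq> S\<close> by auto
  next
    case False
    \<comment> \<open>Radial projection onto the unit circle moves \<open>z\<close> by less than
      \<open>e\<close>.\<close>
    let ?x = "z / of_real (norm z)"
    have z0: "z \<noteq> 0" using False by auto
    have "norm (?x - z) = norm (?x * (1 - of_real (norm z)))" using z0 by (simp add: field_simps)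
    also have "\<dots> = \<bar>1 - norm z\<bar>" using z0
      by (simp only: norm_mult norm_divide) (metis (no_types, opaque_lifting) divide_self mult_1 norm_of_real norm_eq_zero abs_norm_cancel of_real_1 of_real_diff)
    finally have "z \<in> ball ?x e" using z False by (simp add: dist_norm)
    moreover have "?x \<in> cball 0 1" using z0 by (simp add: norm_divide)
    ultimately show ?thesis using e(2) by blast
  qed
  then have "ball 0 (1 + e) \<subseteq> S" by auto
  then show ?thesis using that[of "1 + e"] e(1) by simp
qed

lemma zero_in_S: "0 \<in> S" using causal[of 0] by (simp add: S_def)

lemma Bi_right: "z \<in> S \<Longrightarrow> (\<Sum>l\<in>UNIV. B_poly q B z $ i $ l * Bi z l j) = (if i = j then 1 else 0)"
proof -
  assume "z \<in> S"
  then have "B_poly q B z ** matrix_inv (B_poly q B z) = mat 1"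
    by (intro matrix_mult_matrix_inv) (simp add: S_def invertible_det_nz)
  then have "(B_poly q B z ** matrix_inv (B_poly q B z)) $ i $ j = mat 1 $ i $ j" by simp
  then show ?thesis by (simp add: matrix_matrix_mult_def Bi_def mat_def)
qed

text \<open>Cramer's rule writes the entries of the inverse as quotients of polynomials in
  \<open>z\<close>, from which holomorphy on \<open>S\<close> can be read off.\<close>

lemma Bi_cramer:
  assumes "z \<in> S"
  shows "Bi z k j = det (\<chi> i l. if l = k then (if i = j then 1 else 0) else B_poly q B z $ i $ l) / det (B_poly q B z)"
proof -
  have "B_poly q B z *v (\<chi> l. Bi z l j) = (\<chi> i. if i = j then 1 else 0)"
    using Bi_right[OF assms] by (simp add: vec_eq_iff matrix_vector_mult_def)
  then have "(\<chi> l. Bi z l j) = (\<chi> k. det (\<chi> i l. if l = k then (\<chi> i. if i = j then 1 else 0) $ i else B_poly q B z $ i $ l) / det (B_poly q B z))"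
    using assms cramer[of "B_poly q B z"] by (simp add: S_def)
  then show ?thesis by (simp add: vec_eq_iff cong: if_cong)
qed

lemma Bi_holo: "(\<lambda>z. Bi z k j) holomorphic_on S"
proof -
  have "(\<lambda>z. det (\<chi> i l. if l = k then (if i = j then 1 else 0) else B_poly q B z $ i $ l) / det (B_poly q B z))
    holomorphic_on S"
  proof (intro holomorphic_on_divide det_holo B_holo)
    fix i l :: 'd
    show "(\<lambda>z. (\<chi> i l. if l = k then (if i = j then 1 else 0) else B_poly q B z $ i $ l) $ i $ l) holomorphic_on S"
      using B_holo by (cases "l = k") (auto intro: holomorphic_intros)
  qed (simp add: S_def)
  then show ?thesis by (rule holomorphic_transform) (simp add: Bi_cramer)
qed

definition Fc :: "'d \<Rightarrow> 'd \<Rightarrow> complex fps" where "Fc i j = fps_expansion (\<lambda>z. Bi z i j) 0"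

lemma Fc: "(\<lambda>z. Bi z i j) has_fps_expansion Fc i j"
  unfolding Fc_def by (rule has_fps_expansion_fps_expansion[OF S_open zero_in_S Bi_holo])

text \<open>Compares coefficients in the identity between \<open>B(z)\<close> times its inverse and
  the unit matrix; multiplication by \<open>z^k\<close> is the shift of the index.\<close>

lemma Fc_rec: "fps_nth (Fc i j) n = (if i = j \<and> n = 0 then 1 else 0)
   - (\<Sum>l\<in>UNIV. \<Sum>k=1..q. of_real (B k $ i $ l) * (if k \<le> n then fps_nth (Fc l j) (n - k) else 0))"
proof -
  let ?bf = "\<lambda>l. fps_const (if i = l then 1 else 0) + (\<Sum>k=1..q. fps_X ^ k * fps_const (complex_of_real (B k $ i $ l)))"
  have 1: "(\<lambda>z. \<Sum>l\<in>UNIV. B_poly q B z $ i $ l * Bi z l j) has_fps_expansion (\<Sum>l\<in>UNIV. ?bf l * Fc l j)"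
    unfolding B_poly_nth by (intro fps_expansion_intros Fc)
  have "eventually (\<lambda>z. z \<in> S) (nhds 0)" using S_open zero_in_S by (rule eventually_nhds_in_open)
  then have ev: "eventually (\<lambda>z. (\<Sum>l\<in>UNIV. B_poly q B z $ i $ l * Bi z l j) = (if i = j then 1 else 0)) (nhds 0)"
    by eventually_elim (rule Bi_right)
  have 2: "(\<lambda>z. \<Sum>l\<in>UNIV. B_poly q B z $ i $ l * Bi z l j) has_fps_expansion fps_const (if i = j then 1 else 0)"
    using has_fps_expansion_const[of "if i = j then 1 else 0"]
    by (subst has_fps_expansion_cong[OF ev refl])
  have "(\<Sum>l\<in>UNIV. ?bf l * Fc l j) = fps_const (if i = j then 1 else 0)"
    using fps_expansion_unique_complex[OF 1 2] .
  then have "fps_nth (\<Sum>l\<in>UNIV. ?bf l * Fc l j) n = (if i = j \<and> n = 0 then 1 else 0)" by simp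
  moreover have "fps_nth (\<Sum>l\<in>UNIV. ?bf l * Fc l j) n = fps_nth (Fc i j) n
     + (\<Sum>l\<in>UNIV. \<Sum>k=1..q. of_real (B k $ i $ l) * (if k \<le> n then fps_nth (Fc l j) (n - k) else 0))"
  proof -
    have "fps_nth (?bf l * Fc l j) n = (if i = l then fps_nth (Fc l j) n else 0)
       + (\<Sum>k=1..q. of_real (B k $ i $ l) * (if k \<le> n then fps_nth (Fc l j) (n - k) else 0))" for l
    proof -
      have "?bf l * Fc l j = fps_const (if i = l then 1 else 0) * Fc l j
         + (\<Sum>k=1..q. fps_X ^ k * (fps_const (complex_of_real (B k $ i $ l)) * Fc l j))"
        by (simp add: distrib_right sum_distrib_right mult.assoc)
      then show ?thesis
        by (simp add: fps_sum_nth fps_X_power_mult_nth if_distrib not_less cong: if_cong) (auto intro!: sum.cong)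
    qed
    then show ?thesis by (simp add: fps_sum_nth sum.distrib)
  qed
  ultimately show ?thesis by (simp add: algebra_simps)
qed

lemma Fc_real: "Im (fps_nth (Fc i j) n) = 0"
proof (induction n arbitrary: i j rule: less_induct)
  case (less n)
  have "Im (\<Sum>l\<in>UNIV. \<Sum>k=1..q. of_real (B k $ i $ l) * (if k \<le> n then fps_nth (Fc l j) (n - k) else 0)) = 0"
    using less by (auto simp: Im_sum intro!: sum.neutral)
  then show ?case by (subst Fc_rec) simp
qed

text \<open>The impulse response of \<open>B(z)\<^sup>-\<^sup>1\<close>. Taking real parts loses
  nothing, because \<open>Fc_rec\<close> has real coefficients.\<close>

definition E :: "nat \<Rightarrow> real^'d^'d" where "E n = (\<chi> i j. Re (fps_nth (Fc i j) n))"

lemma E_nth: "complex_of_real (E n $ i $ j) = fps_nth (Fc i j) n"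
  by (simp add: E_def complex_eq_iff Fc_real)

lemma E_rec: "E n = (if n = 0 then mat 1 else 0) - (\<Sum>k=1..q. if k \<le> n then B k ** E (n - k) else 0)"
proof -
  have "complex_of_real (E n $ i $ j) = complex_of_real (((if n = 0 then mat 1 else 0) - (\<Sum>k=1..q. if k \<le> n then B k ** E (n - k) else 0)) $ i $ j)" for i j
  proof -
    have *: "(\<Sum>k=1..q. if k \<le> n then B k ** E (n - k) else 0) $ i $ j
       = (\<Sum>k=1..q. if k \<le> n then (B k ** E (n - k)) $ i $ j else 0)"
      by (auto simp: sum_component intro!: sum.cong)
    show ?thesis
      unfolding E_nth
      by (subst Fc_rec, subst sum.swap)
        (auto simp: * mat_def matrix_matrix_mult_def E_nth[symmetric] intro!: sum.cong)
  qed
  then have "E n $ i $ j = ((if n = 0 then mat 1 else 0) - (\<Sum>k=1..q. if k \<le> n then B k ** E (n - k) else 0)) $ i $ j" for i j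
    by (rule injD[OF inj_of_real])
  then show ?thesis unfolding vec_eq_iff by blast
qed

lemma E_sums:
  assumes r: "ball 0 r \<subseteq> S" and z: "norm z < r"
  shows "(\<lambda>n. z ^ n * of_real (E n $ i $ j)) sums Bi z i j"
proof -
  have "(\<lambda>z. Bi z i j) holomorphic_on eball 0 (ereal r)"
    using holomorphic_on_subset[OF Bi_holo r] by simp
  from has_fps_expansion_imp_sums_complex[OF Fc this, of z] z
  show ?thesis by (simp add: E_nth mult.commute)
qed

text \<open>Convergence at one real point beyond 1 forces absolute convergence at 1.\<close>

lemma E_summable: "summable (\<lambda>n. norm (E n))"
proof -
  obtain r where r: "1 < r" "ball 0 r \<subseteq> S" by (rule radius)
  obtain \<rho> where \<rho>: "1 < \<rho>" "\<rho> < r" using dense[OF r(1)] by blast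
  have "summable (\<lambda>n. \<bar>E n $ i $ j\<bar>)" for i j
  proof -
    have "summable (\<lambda>n. of_real (E n $ i $ j) * (of_real \<rho> :: complex) ^ n)"
      using E_sums[OF r(2), of "of_real \<rho>" i j] \<rho> by (auto simp: sums_iff mult.commute)
    then have "summable (\<lambda>n. norm (complex_of_real (E n $ i $ j) * 1 ^ n))"
      by (rule powser_insidea) (use \<rho> in simp)
    then show ?thesis by simp
  qed
  then have "summable (\<lambda>n. \<Sum>i\<in>UNIV. \<Sum>j\<in>UNIV. \<bar>E n $ i $ j\<bar>)" by (intro summable_sum)
  then show ?thesis by (rule summable_comparison_test'[of _ 0]) (simp add: norm_matrix_le_sum)
qed

lemma E_abs_summable: "summable (\<lambda>m. \<bar>E m $ b $ c\<bar>)"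
proof (rule summable_comparison_test'[OF E_summable, of 0])
  fix n
  have "\<bar>E n $ b $ c\<bar> \<le> norm (E n $ b)" by (rule component_le_norm_cart)
  also have "\<dots> \<le> norm (E n)" by (rule Finite_Cartesian_Product.norm_nth_le)
  finally show "norm \<bar>E n $ b $ c\<bar> \<le> norm (E n)" by simp
qed

text \<open>The product of the impulse response with \<open>A(z) - I\<close>, that is
  \<open>P\<close> on natural indices. Since \<open>Pc 0\<close> vanishes, truncated subtraction
  later yields the zero coefficient wherever \<open>P\<close> would have a nonpositive
  index.\<close>

definition Pc :: "nat \<Rightarrow> real^'d^'d" where
  "Pc i = - (\<Sum>j=1..p. if j \<le> i then E (i - j) ** A j else 0)"

lemma Pc_0: "Pc 0 = 0" by (simp add: Pc_def)

text \<open>The product with the polynomial \<open>A(z) - I\<close> is a finite combination of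
  shifted copies of the series of the inverse, so convergence is inherited from
  \<open>E_sums\<close>.\<close>

lemma Pc_sums:
  assumes r: "ball 0 r \<subseteq> S" and z: "norm z < r"
  shows "(\<lambda>k. cscale (z ^ Suc k) (Pc (Suc k))) sums (matrix_inv (B_poly q B z) ** (A_poly p A z - mat 1))"
proof (intro sums_vec)
  fix a b
  have shift: "(\<lambda>i. if j \<le> i then z ^ i * of_real (E (i - j) $ a $ l) else 0) sums (z ^ j * Bi z a l)" for j l
  proof -
    have "(\<lambda>i. z ^ j * (z ^ i * of_real (E i $ a $ l))) sums (z ^ j * Bi z a l)"
      by (intro sums_mult E_sums[OF r z])
    then have "(\<lambda>i. if j \<le> i + j then z ^ (i + j) * of_real (E (i + j - j) $ a $ l) else 0) sums (z ^ j * Bi z a l)"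
      by (simp add: power_add mult_ac)
    then show ?thesis by (subst (asm) sums_zero_iff_shift) auto
  qed
  have "(\<lambda>i. - (\<Sum>j=1..p. \<Sum>l\<in>UNIV. (if j \<le> i then z ^ i * of_real (E (i - j) $ a $ l) else 0) * of_real (A j $ l $ b)))
     sums (- (\<Sum>j=1..p. \<Sum>l\<in>UNIV. z ^ j * Bi z a l * of_real (A j $ l $ b)))"
    by (intro sums_minus sums_sum sums_mult2 shift)
  also have "(- (\<Sum>j=1..p. \<Sum>l\<in>UNIV. z ^ j * Bi z a l * of_real (A j $ l $ b)))
      = (matrix_inv (B_poly q B z) ** (A_poly p A z - mat 1)) $ a $ b"
  proof -
    have "(matrix_inv (B_poly q B z) ** (A_poly p A z - mat 1)) $ a $ b
        = (\<Sum>l\<in>UNIV. Bi z a l * (A_poly p A z - mat 1) $ l $ b)"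
      by (simp only: matrix_matrix_mult_def Bi_def vec_lambda_beta)
    then show ?thesis unfolding A_poly_nth
      by (subst sum.swap) (simp add: sum_distrib_left sum_negf mult_ac)
  qed
  also have "(\<lambda>i. - (\<Sum>j=1..p. \<Sum>l\<in>UNIV. (if j \<le> i then z ^ i * of_real (E (i - j) $ a $ l) else 0) * of_real (A j $ l $ b)))
      = (\<lambda>i. z ^ i * of_real (Pc i $ a $ b))"
  proof
    fix i
    have "Pc i $ a $ b = - (\<Sum>j=1..p. \<Sum>l\<in>UNIV. (if j \<le> i then E (i - j) $ a $ l else 0) * A j $ l $ b)"
      unfolding Pc_def by (auto simp: matrix_matrix_mult_def if_distrib intro!: sum.cong cong: if_cong)
    then show "- (\<Sum>j=1..p. \<Sum>l\<in>UNIV. (if j \<le> i then z ^ i * of_real (E (i - j) $ a $ l) else 0) * of_real (A j $ l $ b))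
      = z ^ i * of_real (Pc i $ a $ b)"
      by (auto simp: sum_distrib_left mult.assoc intro!: sum.cong)
  qed
  finally have "(\<lambda>i. z ^ i * of_real (Pc i $ a $ b)) sums ((matrix_inv (B_poly q B z) ** (A_poly p A z - mat 1)) $ a $ b)" .
  then have "(\<lambda>i. z ^ Suc i * of_real (Pc (Suc i) $ a $ b)) sums ((matrix_inv (B_poly q B z) ** (A_poly p A z - mat 1)) $ a $ b)"
    by (subst sums_Suc_iff) (simp add: Pc_0)
  then show "(\<lambda>k. cscale (z ^ Suc k) (Pc (Suc k)) $ a $ b) sums ((matrix_inv (B_poly q B z) ** (A_poly p A z - mat 1)) $ a $ b)"
    by (simp add: cscale_def)
qed

text \<open>Needed to evaluate the definite description in \<open>arx_P\<close>. Two expansions are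
  compared entrywise on the smaller of their discs.\<close>

lemma arx_expansion_unique:
  assumes "arx_expansion p q A B P1" "arx_expansion p q A B P2"
  shows "P1 = P2"
proof -
  obtain r1 where r1: "1 < r1" "\<And>z. norm z < r1 \<Longrightarrow> (\<lambda>k. cscale (z ^ Suc k) (P1 (int (Suc k))))
          sums (matrix_inv (B_poly q B z) ** (A_poly p A z - mat 1))"
    using assms(1) unfolding arx_expansion_def by blast
  obtain r2 where r2: "1 < r2" "\<And>z. norm z < r2 \<Longrightarrow> (\<lambda>k. cscale (z ^ Suc k) (P2 (int (Suc k))))
          sums (matrix_inv (B_poly q B z) ** (A_poly p A z - mat 1))"
    using assms(2) unfolding arx_expansion_def by blast
  have "(\<lambda>k. complex_of_real (P1 (int (Suc k)) $ i $ j)) = (\<lambda>k. complex_of_real (P2 (int (Suc k)) $ i $ j))" for i j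
  proof (rule powser_unique[of "min r1 r2"])
    fix z :: complex assume z: "norm z < min r1 r2"
    show "(\<lambda>k. z ^ Suc k * complex_of_real (P1 (int (Suc k)) $ i $ j)) sums ((matrix_inv (B_poly q B z) ** (A_poly p A z - mat 1)) $ i $ j)"
      using sums_vec_nth[OF sums_vec_nth[OF r1(2)], of z i j] z by (simp add: cscale_def)
    show "(\<lambda>k. z ^ Suc k * complex_of_real (P2 (int (Suc k)) $ i $ j)) sums ((matrix_inv (B_poly q B z) ** (A_poly p A z - mat 1)) $ i $ j)"
      using sums_vec_nth[OF sums_vec_nth[OF r2(2)], of z i j] z by (simp add: cscale_def)
  qed (use r1 r2 in auto)
  then have eq: "P1 (int (Suc k)) = P2 (int (Suc k))" for k
    by (auto simp: vec_eq_iff fun_eq_iff)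
  show ?thesis
  proof
    fix k :: int
    show "P1 k = P2 k"
    proof (cases "k \<le> 0")
      case True then show ?thesis using assms by (simp add: arx_expansion_def)
    next
      case False
      then have "k = int (Suc (nat (k - 1)))" by simp
      then show ?thesis using eq by metis
    qed
  qed
qed

lemma arx_P_eq: "arx_P p q A B = (\<lambda>k. Pc (nat k))"
proof -
  have "arx_expansion p q A B (\<lambda>k. Pc (nat k))"
  proof -
    obtain r where "1 < r" "ball 0 r \<subseteq> S" by (rule radius)
    then show ?thesis unfolding arx_expansion_def using Pc_sums by (auto simp: Pc_0 simp del: of_nat_Suc power_Suc)
  qed
  then show ?thesis unfolding arx_P_def using arx_expansion_unique by blast
qed

text \<open>By \<open>E_rec\<close> the convolution of the impulse response with the forcing solves
  the same recursion, and a solution is determined by induction on time.\<close>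

lemma recursion_solution:
  fixes u h :: "nat \<Rightarrow> real^'d"
  assumes rec: "\<And>n. u n + (\<Sum>j=1..q. if j \<le> n then B j *v u (n - j) else 0) = h n"
  shows "u n = (\<Sum>m\<le>n. E (n - m) *v h m)"
proof -
  define v where "v n = (\<Sum>m\<le>n. E (n - m) *v h m)" for n
  have v: "v n + (\<Sum>j=1..q. if j \<le> n then B j *v v (n - j) else 0) = h n" for n
  proof -
    have "(\<Sum>j=1..q. if j \<le> n then B j *v v (n - j) else 0)
       = (\<Sum>j=1..q. \<Sum>m\<le>n. if j \<le> n - m then (B j ** E (n - m - j)) *v h m else 0)"
    proof (rule sum.cong[OF refl])
      fix j assume "j \<in> {1..q}"
      show "(if j \<le> n then B j *v v (n - j) else 0) = (\<Sum>m\<le>n. if j \<le> n - m then (B j ** E (n - m - j)) *v h m else 0)"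
      proof (cases "j \<le> n")
        case True
        have "B j *v v (n - j) = (\<Sum>m\<le>n-j. (B j ** E (n - j - m)) *v h m)"
          by (simp add: v_def matrix_vector_mul_assoc linear_sum[OF matrix_vector_mul_linear])
        also have "\<dots> = (\<Sum>m\<le>n. if j \<le> n - m then (B j ** E (n - m - j)) *v h m else 0)"
          using True by (intro sum.mono_neutral_cong_left) (auto simp: diff_commute add.commute)
        finally show ?thesis using True by simp
      next
        case False
        then have "\<not> j \<le> n - m" for m by simp
        then show ?thesis using False by simp
      qed
    qed
    also have "\<dots> = (\<Sum>m\<le>n. (\<Sum>j=1..q. if j \<le> n - m then B j ** E (n - m - j) else 0) *v h m)"
      by (subst sum.swap) (auto simp: matrix_vector_mult_sum_left intro!: sum.cong)
    also have "\<dots> = (\<Sum>m\<le>n. (if n - m = 0 then mat 1 else 0) *v h m - E (n - m) *v h m)"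
    proof (rule sum.cong[OF refl])
      fix m
      have "(\<Sum>j=1..q. if j \<le> n - m then B j ** E (n - m - j) else 0) = (if n - m = 0 then mat 1 else 0) - E (n - m)"
        using E_rec[of "n - m"] by (simp add: algebra_simps)
      then show "(\<Sum>j=1..q. if j \<le> n - m then B j ** E (n - m - j) else 0) *v h m = (if n - m = 0 then mat 1 else 0) *v h m - E (n - m) *v h m"
        by (simp add: matrix_vector_mult_diff_rdistrib)
    qed
    also have "\<dots> = h n - v n"
    proof -
      have "(\<Sum>m\<le>n. (if n - m = 0 then mat 1 else 0) *v h m) = (\<Sum>m\<le>n. if m = n then h m else 0)"
        by (intro sum.cong) auto
      then show ?thesis by (simp add: sum_subtractf v_def)
    qed
    finally show ?thesis by simp
  qed
  have "u n = v n"
  proof (induction n rule: less_induct)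
    case (less n)
    have "(\<Sum>j=1..q. if j \<le> n then B j *v u (n - j) else 0) = (\<Sum>j=1..q. if j \<le> n then B j *v v (n - j) else 0)"
      using less by (intro sum.cong) auto
    moreover have "u n = h n - (\<Sum>j=1..q. if j \<le> n then B j *v u (n - j) else 0)"
      using rec[of n] by (simp add: eq_diff_eq)
    moreover have "v n = h n - (\<Sum>j=1..q. if j \<le> n then B j *v v (n - j) else 0)"
      using v[of n] by (simp add: eq_diff_eq)
    ultimately show ?case by (simp only:)
  qed
  then show ?thesis by (simp add: v_def)
qed

end

section \<open>Time averages of moving averages and logarithmic weights\<close>

text \<open>The limiting empirical second moment of two scalar signals, without centring. It is a
  relation because the existence of the limit is part of what has to be shown.\<close>

definition acov :: "(nat \<Rightarrow> real) \<Rightarrow> (nat \<Rightarrow> real) \<Rightarrow> real \<Rightarrow> bool" where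
  "acov u v c \<longleftrightarrow> (\<lambda>n. (\<Sum>k<n. u k * v k) / real n) \<longlonglongrightarrow> c"

definition msq_bounded :: "(nat \<Rightarrow> real) \<Rightarrow> bool" where
  "msq_bounded u \<longleftrightarrow> (\<exists>C\<ge>0. \<forall>n. (\<Sum>k<n. (u k)\<^sup>2) \<le> C * real n)"

definition msq_null :: "(nat \<Rightarrow> real) \<Rightarrow> bool" where
  "msq_null u \<longleftrightarrow> (\<lambda>n. (\<Sum>k<n. (u k)\<^sup>2) / real n) \<longlonglongrightarrow> 0"

text \<open>Backward shift padded with zeros, so that it never increases the energy up to a given
  time.\<close>

definition lag :: "nat \<Rightarrow> (nat \<Rightarrow> real) \<Rightarrow> nat \<Rightarrow> real" where
  "lag m u k = (if m \<le> k then u (k - m) else 0)"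

lemma abs_sum_mult_le: "\<bar>\<Sum>k\<in>I. u k * v k\<bar> \<le> sqrt (\<Sum>k\<in>I. (u k)\<^sup>2) * sqrt (\<Sum>k\<in>I. (v k :: real)\<^sup>2)"
proof -
  have "(\<Sum>k\<in>I. u k * v k)\<^sup>2 \<le> (\<Sum>k\<in>I. (u k)\<^sup>2) * (\<Sum>k\<in>I. (v k)\<^sup>2)" by (rule Cauchy_Schwarz_ineq_sum)
  from real_sqrt_le_mono[OF this] show ?thesis by (simp add: real_sqrt_mult)
qed

lemma sum_add_power2_le: "(\<Sum>k\<in>I. (u k + v k)\<^sup>2) \<le> 2 * (\<Sum>k\<in>I. (u k)\<^sup>2) + 2 * (\<Sum>k\<in>I. (v k :: real)\<^sup>2)"
proof -
  have "(x + y)\<^sup>2 \<le> 2 * x\<^sup>2 + 2 * y\<^sup>2" for x y :: real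
    using zero_le_power2[of "x - y"] by (simp add: power2_sum power2_diff)
  then show ?thesis unfolding sum_distrib_left sum.distrib[symmetric] by (intro sum_mono)
qed

lemma sum_lag: "(\<Sum>k<n. lag m u k) = (\<Sum>k<n - m. u k)"
proof -
  have "(\<Sum>k<n. lag m u k) = (\<Sum>k\<in>{m..<n}. u (k - m))"
    unfolding lag_def by (rule sum.mono_neutral_cong_right) auto
  also have "\<dots> = (\<Sum>k<n - m. u k)"
    by (rule sum.reindex_bij_witness[of _ "\<lambda>k. k + m" "\<lambda>k. k - m"]) auto
  finally show ?thesis .
qed

lemma lag_mult: "lag m u k * lag m v k = lag m (\<lambda>k. u k * v k) k"
  by (simp add: lag_def)

lemma lag_power2: "(lag m u k)\<^sup>2 = lag m (\<lambda>k. (u k)\<^sup>2) k"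
  by (simp add: lag_def)

lemma lag_lag: "lag m (lag l u) = lag (m + l) u"
  by (auto simp: lag_def fun_eq_iff add.commute)

lemma sum_lag_power2_le: "(\<Sum>k<n. (lag m u k)\<^sup>2) \<le> (\<Sum>k<n. (u k)\<^sup>2)"
  unfolding lag_power2 sum_lag by (rule sum_mono2) auto

lemma msq_bounded_lag: "msq_bounded u \<Longrightarrow> msq_bounded (lag m u)"
  unfolding msq_bounded_def using sum_lag_power2_le order_trans by meson

lemma msq_null_squeeze:
  assumes "msq_null v" "0 \<le> K" "\<And>n. (\<Sum>k<n. (u k)\<^sup>2) \<le> K * (\<Sum>k<n. (v k)\<^sup>2)"
  shows "msq_null u"
proof -
  have "(\<lambda>n. K * ((\<Sum>k<n. (v k)\<^sup>2) / real n)) \<longlonglongrightarrow> K * 0"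
    using assms(1) unfolding msq_null_def by (intro tendsto_intros)
  then have "(\<lambda>n. K * ((\<Sum>k<n. (v k)\<^sup>2) / real n)) \<longlonglongrightarrow> 0" by simp
  then show ?thesis unfolding msq_null_def
  proof (rule Lim_null_comparison[rotated], intro always_eventually allI)
    fix n
    have "0 \<le> (\<Sum>k<n. (u k)\<^sup>2)" by (rule sum_nonneg) simp
    then show "norm ((\<Sum>k<n. (u k)\<^sup>2) / real n) \<le> K * ((\<Sum>k<n. (v k)\<^sup>2) / real n)"
      using assms(3)[of n] by (simp add: divide_right_mono)
  qed
qed

lemma msq_null_mono: "msq_null v \<Longrightarrow> (\<And>k. \<bar>u k\<bar> \<le> \<bar>v k\<bar>) \<Longrightarrow> msq_null u"
  by (rule msq_null_squeeze[of v 1]) (auto intro!: sum_mono simp: abs_le_square_iff)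

lemma msq_null_lag: "msq_null u \<Longrightarrow> msq_null (lag m u)"
  by (rule msq_null_squeeze[of u 1]) (use sum_lag_power2_le in auto)

lemma msq_null_add:
  assumes "msq_null u" "msq_null v"
  shows "msq_null (\<lambda>k. u k + v k)"
proof -
  have "(\<lambda>n. 2 * ((\<Sum>k<n. (u k)\<^sup>2) / real n) + 2 * ((\<Sum>k<n. (v k)\<^sup>2) / real n)) \<longlonglongrightarrow> 2 * 0 + 2 * 0"
    using assms unfolding msq_null_def by (intro tendsto_intros)
  then have lim: "(\<lambda>n. 2 * ((\<Sum>k<n. (u k)\<^sup>2) / real n) + 2 * ((\<Sum>k<n. (v k)\<^sup>2) / real n)) \<longlonglongrightarrow> 0" by simp
  have le: "(\<Sum>k<n. (u k + v k)\<^sup>2) \<le> 2 * (\<Sum>k<n. (u k)\<^sup>2) + 2 * (\<Sum>k<n. (v k)\<^sup>2)" for n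
    by (rule sum_add_power2_le)
  show ?thesis unfolding msq_null_def
  proof (rule Lim_null_comparison[OF always_eventually lim], intro allI)
    fix n
    have "0 \<le> (\<Sum>k<n. (u k + v k)\<^sup>2)" by (rule sum_nonneg) simp
    then show "norm ((\<Sum>k<n. (u k + v k)\<^sup>2) / real n) \<le> 2 * ((\<Sum>k<n. (u k)\<^sup>2) / real n) + 2 * ((\<Sum>k<n. (v k)\<^sup>2) / real n)"
      using divide_right_mono[OF le[of n], of "real n"] by (simp add: add_divide_distrib)
  qed
qed

lemma msq_null_sum: "finite I \<Longrightarrow> (\<And>i. i \<in> I \<Longrightarrow> msq_null (u i)) \<Longrightarrow> msq_null (\<lambda>k. \<Sum>i\<in>I. u i k)"
  by (induction I rule: finite_induct) (auto simp: msq_null_def[of "\<lambda>_. 0"] intro!: msq_null_add)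

lemma msq_null_imp_bounded:
  assumes "msq_null u" shows "msq_bounded u"
proof -
  have "Bseq (\<lambda>n. (\<Sum>k<n. (u k)\<^sup>2) / real n)"
    using assms unfolding msq_null_def by (intro convergent_imp_Bseq) (auto simp: convergent_def)
  then obtain C where C: "0 < C" "\<And>n. \<bar>(\<Sum>k<n. (u k)\<^sup>2) / real n\<bar> \<le> C" by (auto simp: Bseq_def)
  have "(\<Sum>k<n. (u k)\<^sup>2) \<le> C * real n" for n
    using C(2)[of n] by (cases "n = 0") (auto simp: field_simps abs_le_iff)
  then show ?thesis unfolding msq_bounded_def using C(1) by (intro exI[of _ C]) auto
qed

lemma msq_bounded_add:
  assumes "msq_bounded u" "msq_bounded v"
  shows "msq_bounded (\<lambda>k. u k + v k)"
proof -
  obtain C D where "0 \<le> C" "\<And>n. (\<Sum>k<n. (u k)\<^sup>2) \<le> C * real n" "0 \<le> D" "\<And>n. (\<Sum>k<n. (v k)\<^sup>2) \<le> D * real n"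
    using assms unfolding msq_bounded_def by blast
  moreover have "(\<Sum>k<n. (u k + v k)\<^sup>2) \<le> 2 * (\<Sum>k<n. (u k)\<^sup>2) + 2 * (\<Sum>k<n. (v k)\<^sup>2)" for n
    by (rule sum_add_power2_le)
  ultimately have "(\<Sum>k<n. (u k + v k)\<^sup>2) \<le> (2 * C + 2 * D) * real n" for n
    by (smt (verit) distrib_right mult.assoc)
  then show ?thesis unfolding msq_bounded_def using \<open>0 \<le> C\<close> \<open>0 \<le> D\<close> by (intro exI[of _ "2 * C + 2 * D"]) auto
qed

lemma msq_bounded_sum: "finite I \<Longrightarrow> (\<And>i. i \<in> I \<Longrightarrow> msq_bounded (u i)) \<Longrightarrow> msq_bounded (\<lambda>k. \<Sum>i\<in>I. u i k)"
  by (induction I rule: finite_induct) (auto simp: msq_bounded_def[of "\<lambda>_. 0"] intro!: msq_bounded_add)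

lemma acov_commute: "acov u v c \<Longrightarrow> acov v u c"
  by (simp add: acov_def mult.commute)

lemma acov_add: "acov u w c \<Longrightarrow> acov v w d \<Longrightarrow> acov (\<lambda>k. u k + v k) w (c + d)"
  unfolding acov_def by (simp add: distrib_right sum.distrib add_divide_distrib tendsto_add)

lemma acov_sum:
  "finite I \<Longrightarrow> (\<And>i. i \<in> I \<Longrightarrow> acov (u i) w (c i)) \<Longrightarrow> acov (\<lambda>k. \<Sum>i\<in>I. u i k) w (\<Sum>i\<in>I. c i)"
  by (induction I rule: finite_induct) (auto simp: acov_def[of "\<lambda>_. 0"] intro!: acov_add)

lemma acov_null:
  assumes "msq_null u" "msq_bounded v"
  shows "acov u v 0"
proof -
  obtain C where C: "0 \<le> C" "\<And>n. (\<Sum>k<n. (v k)\<^sup>2) \<le> C * real n" using assms(2) unfolding msq_bounded_def by blast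
  have "(\<lambda>n. sqrt ((\<Sum>k<n. (u k)\<^sup>2) / real n) * sqrt C) \<longlonglongrightarrow> sqrt 0 * sqrt C"
    using assms(1) unfolding msq_null_def by (intro tendsto_intros)
  then have lim: "(\<lambda>n. sqrt ((\<Sum>k<n. (u k)\<^sup>2) / real n) * sqrt C) \<longlonglongrightarrow> 0" by simp
  show ?thesis unfolding acov_def
  proof (rule Lim_null_comparison[OF always_eventually lim], intro allI)
    fix n
    have "\<bar>\<Sum>k<n. u k * v k\<bar> \<le> sqrt (\<Sum>k<n. (u k)\<^sup>2) * sqrt (\<Sum>k<n. (v k)\<^sup>2)" by (rule abs_sum_mult_le)
    also have "\<dots> \<le> sqrt (\<Sum>k<n. (u k)\<^sup>2) * sqrt (C * real n)" using C(2) by (intro mult_left_mono) (auto intro: sum_nonneg)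
    finally have "\<bar>\<Sum>k<n. u k * v k\<bar> / real n \<le> sqrt (\<Sum>k<n. (u k)\<^sup>2) * sqrt (C * real n) / real n" by (rule divide_right_mono) simp
    also have "\<dots> = sqrt ((\<Sum>k<n. (u k)\<^sup>2) / real n) * sqrt C"
    proof (cases "n = 0")
      case False
      then have "sqrt (real n) * sqrt (real n) = real n" "sqrt (real n) \<noteq> 0" by auto
      then show ?thesis by (simp add: real_sqrt_mult real_sqrt_divide field_simps)
    qed simp
    finally show "norm ((\<Sum>k<n. u k * v k) / real n) \<le> sqrt ((\<Sum>k<n. (u k)\<^sup>2) / real n) * sqrt C" by simp
  qed
qed

text \<open>Empirical covariances do not see mean square null perturbations: Cauchy-Schwarz against
  bounded mean squares, one argument at a time.\<close>

lemma acov_perturb: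
  assumes w: "acov w w' c" "msq_bounded w" "msq_bounded w'"
    and d: "msq_null (\<lambda>k. u k - w k)" "msq_null (\<lambda>k. u' k - w' k)"
  shows "acov u u' c"
proof -
  have "acov (\<lambda>k. u k - w k) w' 0" by (rule acov_null[OF d(1) w(3)])
  from acov_add[OF this w(1)] have 1: "acov u w' c" by simp
  have "msq_bounded u" using msq_bounded_add[OF msq_null_imp_bounded[OF d(1)] w(2)] by simp
  from acov_null[OF d(2) this] have "acov (\<lambda>k. u' k - w' k) u 0" .
  from acov_add[OF this acov_commute[OF 1]] have "acov u' u c" by simp
  then show ?thesis by (rule acov_commute)
qed

text \<open>Young's inequality for a causal convolution: an l1 kernel acts boundedly on l2,
  uniformly in the horizon \<open>n\<close>.\<close>

lemma young_l1_l2: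
  fixes g u :: "nat \<Rightarrow> real"
  assumes g: "summable (\<lambda>m. \<bar>g m\<bar>)"
  shows "(\<Sum>k<n. (\<Sum>m\<le>k. g m * u (k - m))\<^sup>2) \<le> (\<Sum>m. \<bar>g m\<bar>)\<^sup>2 * (\<Sum>k<n. (u k)\<^sup>2)"
proof -
  define G where "G = (\<Sum>m. \<bar>g m\<bar>)"
  have G0: "0 \<le> G" unfolding G_def by (intro suminf_nonneg g) auto
  have part: "(\<Sum>m\<in>I. \<bar>g m\<bar>) \<le> G" if "finite I" for I unfolding G_def using that by (intro sum_le_suminf g) auto
  have "(\<Sum>m\<le>k. g m * u (k - m))\<^sup>2 \<le> G * (\<Sum>m\<le>k. \<bar>g m\<bar> * (u (k - m))\<^sup>2)" for k
  proof -
    \<comment> \<open>Splitting the kernel evenly between the two Cauchy-Schwarz factors leaves its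
      mass in one and a weighted energy in the other.\<close>
    have "(\<Sum>m\<le>k. g m * u (k - m)) = (\<Sum>m\<le>k. (sgn (g m) * sqrt \<bar>g m\<bar>) * (sqrt \<bar>g m\<bar> * u (k - m)))"
      by (intro sum.cong refl) (simp add: mult.assoc[symmetric], simp add: mult.assoc abs_mult_sgn sgn_mult_abs)
    then have "(\<Sum>m\<le>k. g m * u (k - m))\<^sup>2 \<le> (\<Sum>m\<le>k. (sgn (g m) * sqrt \<bar>g m\<bar>)\<^sup>2) * (\<Sum>m\<le>k. (sqrt \<bar>g m\<bar> * u (k - m))\<^sup>2)"
      by (simp only: Cauchy_Schwarz_ineq_sum)
    also have "(\<Sum>m\<le>k. (sgn (g m) * sqrt \<bar>g m\<bar>)\<^sup>2) = (\<Sum>m\<le>k. \<bar>g m\<bar>)"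
      by (intro sum.cong refl) (simp add: power_mult_distrib sgn_if)
    also have "(\<Sum>m\<le>k. (sqrt \<bar>g m\<bar> * u (k - m))\<^sup>2) = (\<Sum>m\<le>k. \<bar>g m\<bar> * (u (k - m))\<^sup>2)" by (simp add: power_mult_distrib)
    also have "(\<Sum>m\<le>k. \<bar>g m\<bar>) * (\<Sum>m\<le>k. \<bar>g m\<bar> * (u (k - m))\<^sup>2) \<le> G * (\<Sum>m\<le>k. \<bar>g m\<bar> * (u (k - m))\<^sup>2)"
      by (intro mult_right_mono part sum_nonneg) auto
    finally show ?thesis .
  qed
  then have "(\<Sum>k<n. (\<Sum>m\<le>k. g m * u (k - m))\<^sup>2) \<le> (\<Sum>k<n. G * (\<Sum>m\<le>k. \<bar>g m\<bar> * (u (k - m))\<^sup>2))" by (rule sum_mono)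
  also have "\<dots> = G * (\<Sum>k<n. \<Sum>m<n. \<bar>g m\<bar> * (lag m u k)\<^sup>2)"
    unfolding sum_distrib_left[symmetric]
    by (intro arg_cong[where f="\<lambda>x. G * x"] sum.cong refl sum.mono_neutral_cong_left) (auto simp: lag_def)
  also have "\<dots> = G * (\<Sum>m<n. \<bar>g m\<bar> * (\<Sum>k<n. (lag m u k)\<^sup>2))" by (subst sum.swap) (simp add: sum_distrib_left)
  also have "\<dots> \<le> G * (\<Sum>m<n. \<bar>g m\<bar> * (\<Sum>k<n. (u k)\<^sup>2))"
    by (intro mult_left_mono sum_mono sum_lag_power2_le G0) auto
  also have "\<dots> = G * ((\<Sum>m<n. \<bar>g m\<bar>) * (\<Sum>k<n. (u k)\<^sup>2))" by (simp add: sum_distrib_right)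
  also have "\<dots> \<le> G * (G * (\<Sum>k<n. (u k)\<^sup>2))" by (intro mult_left_mono mult_right_mono part G0 sum_nonneg) auto
  finally show ?thesis by (simp add: G_def power2_eq_square mult.assoc)
qed

lemma msq_bounded_MA:
  assumes "summable (\<lambda>m. \<bar>g m\<bar>)" "msq_bounded u"
  shows "msq_bounded (\<lambda>k. \<Sum>m\<le>k. g m * u (k - m))"
proof -
  obtain C where C: "0 \<le> C" "\<And>n. (\<Sum>k<n. (u k)\<^sup>2) \<le> C * real n" using assms(2) unfolding msq_bounded_def by blast
  have "(\<Sum>k<n. (\<Sum>m\<le>k. g m * u (k - m))\<^sup>2) \<le> ((\<Sum>m. \<bar>g m\<bar>)\<^sup>2 * C) * real n" for n
    using young_l1_l2[OF assms(1), of u n] mult_left_mono[OF C(2)[of n], of "(\<Sum>m. \<bar>g m\<bar>)\<^sup>2"] by (simp add: mult.assoc)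
  then show ?thesis unfolding msq_bounded_def using C(1) by (intro exI[of _ "(\<Sum>m. \<bar>g m\<bar>)\<^sup>2 * C"]) auto
qed

text \<open>Tannery's theorem allows the limit inside the sum over lags: all lagged covariances obey
  the same Cauchy-Schwarz bound, so the kernel itself supplies a summable majorant.\<close>

lemma acov_MA:
  fixes g :: "nat \<Rightarrow> real"
  assumes g: "summable (\<lambda>m. \<bar>g m\<bar>)" and u: "msq_bounded u" and v: "msq_bounded v"
    and Q: "\<And>m. acov (lag m u) v (Q m)"
  shows "acov (\<lambda>k. \<Sum>m\<le>k. g m * u (k - m)) v (\<Sum>m. g m * Q m)"
proof -
  obtain C where C: "0 \<le> C" "\<And>n. (\<Sum>k<n. (u k)\<^sup>2) \<le> C * real n" using u unfolding msq_bounded_def by blast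
  obtain D where D: "0 \<le> D" "\<And>n. (\<Sum>k<n. (v k)\<^sup>2) \<le> D * real n" using v unfolding msq_bounded_def by blast
  define h where "h m n = g m * ((\<Sum>k<n. lag m u k * v k) / real n)" for m n
  have bound: "norm (h m n) \<le> \<bar>g m\<bar> * (sqrt C * sqrt D)" for m n
  proof -
    have "\<bar>\<Sum>k<n. lag m u k * v k\<bar> \<le> sqrt (\<Sum>k<n. (lag m u k)\<^sup>2) * sqrt (\<Sum>k<n. (v k)\<^sup>2)" by (rule abs_sum_mult_le)
    also have "\<dots> \<le> sqrt (C * real n) * sqrt (D * real n)"
      using order_trans[OF sum_lag_power2_le C(2)] D(2) by (intro mult_mono) (auto intro: sum_nonneg simp: C)
    also have "\<dots> = (sqrt C * sqrt D) * real n" by (simp add: real_sqrt_mult)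
    finally have "\<bar>(\<Sum>k<n. lag m u k * v k) / real n\<bar> \<le> sqrt C * sqrt D"
      using C(1) D(1) by (cases "n = 0") (auto simp: field_simps)
    then show ?thesis unfolding h_def real_norm_def abs_mult by (rule mult_left_mono) simp
  qed
  have "(\<lambda>n. \<Sum>m. h m n) \<longlonglongrightarrow> (\<Sum>m. g m * Q m)"
  proof (rule conjunct2[OF conjunct2[OF tannerys_theorem]])
    show "\<And>m. (\<lambda>n. h m n) \<longlonglongrightarrow> g m * Q m"
      unfolding h_def using Q unfolding acov_def by (intro tendsto_intros)
    show "\<forall>\<^sub>F (m, n) in at_top \<times>\<^sub>F sequentially. norm (h m n) \<le> \<bar>g m\<bar> * (sqrt C * sqrt D)"
      by (intro always_eventually) (simp add: bound[simplified])
    show "summable (\<lambda>m. \<bar>g m\<bar> * (sqrt C * sqrt D))" by (intro summable_mult2 g)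
  qed simp
  moreover have "(\<Sum>m. h m n) = (\<Sum>k<n. (\<Sum>m\<le>k. g m * u (k - m)) * v k) / real n" for n
  proof -
    \<comment> \<open>At a fixed horizon \<open>n\<close> only the lags below \<open>n\<close>
      contribute.\<close>
    have "(\<Sum>m. h m n) = (\<Sum>m<n. h m n)" by (rule suminf_finite) (auto simp: h_def lag_def)
    also have "\<dots> = (\<Sum>k<n. \<Sum>m<n. g m * lag m u k * v k) / real n"
      unfolding h_def by (subst sum.swap) (simp add: sum_distrib_left sum_divide_distrib mult.assoc)
    also have "(\<Sum>k<n. \<Sum>m<n. g m * lag m u k * v k) = (\<Sum>k<n. (\<Sum>m\<le>k. g m * u (k - m)) * v k)"
      unfolding sum_distrib_right by (intro sum.cong refl sum.mono_neutral_cong_right) (auto simp: lag_def)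
    finally show ?thesis .
  qed
  ultimately show ?thesis unfolding acov_def by simp
qed

lemma MA_component:
  fixes G :: "nat \<Rightarrow> real^'d^'m" and h :: "nat \<Rightarrow> real^'d"
  shows "(\<Sum>m\<le>n. G m *v h (n - m)) $ r = (\<Sum>b\<in>UNIV. \<Sum>m\<le>n. G m $ r $ b * h (n - m) $ b)"
  by (subst sum.swap) (simp add: matrix_vector_mult_def)

text \<open>\<open>acov_MA\<close> in each argument in turn: first against a single lagged noise
  component, where \<open>cov\<close> leaves one coefficient, then against the whole filtered
  signal.\<close>

lemma MA_covariance:
  fixes e :: "nat \<Rightarrow> real^'d" and G :: "nat \<Rightarrow> real^'d^'k" and \<Gamma> :: "real^'d^'d"
  assumes e: "\<And>b. msq_bounded (\<lambda>k. e k $ b)"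
    and cov: "\<And>l m b c. acov (lag l (\<lambda>k. e k $ b)) (lag m (\<lambda>k. e k $ c)) (if l = m then \<Gamma> $ b $ c else 0)"
    and G: "\<And>r b. summable (\<lambda>m. \<bar>G m $ r $ b\<bar>)"
  defines "W \<equiv> \<lambda>n. \<Sum>m\<le>n. G m *v e (n - m)"
  shows "msq_bounded (\<lambda>n. W n $ r)"
    "acov (\<lambda>n. W n $ r) (\<lambda>n. W n $ s) (\<Sum>b\<in>UNIV. \<Sum>m. G m $ r $ b * (\<Sum>c\<in>UNIV. G m $ s $ c * \<Gamma> $ c $ b))"
proof -
  have W: "W n $ r = (\<Sum>b\<in>UNIV. \<Sum>m\<le>n. G m $ r $ b * e (n - m) $ b)" for n r
    unfolding W_def by (subst sum.swap) (simp add: matrix_vector_mult_def)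
  show bd: "msq_bounded (\<lambda>n. W n $ r)" for r
    unfolding W by (intro msq_bounded_sum msq_bounded_MA G e) auto
  have 1: "acov (\<lambda>n. W n $ s) (lag m (\<lambda>k. e k $ b)) (\<Sum>c\<in>UNIV. G m $ s $ c * \<Gamma> $ c $ b)" for m b s
  proof -
    have "acov (\<lambda>n. W n $ s) (lag m (\<lambda>k. e k $ b)) (\<Sum>c\<in>UNIV. \<Sum>l. G l $ s $ c * (if l = m then \<Gamma> $ c $ b else 0))"
      unfolding W by (intro acov_sum acov_MA G e msq_bounded_lag cov) auto
    moreover have "(\<Sum>l. G l $ s $ c * (if l = m then \<Gamma> $ c $ b else 0)) = G m $ s $ c * \<Gamma> $ c $ b" for c
      by (subst suminf_finite[of "{m}"]) auto
    ultimately show ?thesis by simp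
  qed
  show "acov (\<lambda>n. W n $ r) (\<lambda>n. W n $ s) (\<Sum>b\<in>UNIV. \<Sum>m. G m $ r $ b * (\<Sum>c\<in>UNIV. G m $ s $ c * \<Gamma> $ c $ b))"
    unfolding W[of _ r] by (intro acov_sum acov_MA G e bd acov_commute[OF 1]) auto
qed

lemma mean_lag:
  fixes S :: "nat \<Rightarrow> real"
  assumes "(\<lambda>n. S n / real n) \<longlonglongrightarrow> c"
  shows "(\<lambda>n. S (n - m) / real n) \<longlonglongrightarrow> c"
proof (rule LIMSEQ_offset[of _ m])
  have "(\<lambda>n. S n / real n * (real n / real (n + m))) \<longlonglongrightarrow> c * 1"
  proof (rule tendsto_mult[OF assms])
    show "(\<lambda>n. real n / real (n + m)) \<longlonglongrightarrow> 1" by real_asymp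
  qed
  then have "(\<lambda>n. S n / real n * (real n / real (n + m))) \<longlonglongrightarrow> c" by simp
  then show "(\<lambda>n. S (n + m - m) / real (n + m)) \<longlonglongrightarrow> c"
    by (rule Lim_transform_eventually)
      (use eventually_gt_at_top[of 0] in eventually_elim, auto)
qed

lemma acov_lag: "acov u v c \<Longrightarrow> acov (lag m u) (lag m v) c"
  unfolding acov_def lag_mult sum_lag by (rule mean_lag)

text \<open>The predictable signal at time \<open>k\<close> meets the noise at time
  \<open>k + 1\<close>, hence the \<open>lag 1\<close>. Bounded mean squares turn the
  self-normalised bound into an arbitrarily small multiple of \<open>n\<close>.\<close>

lemma acov_self_normalized:
  assumes sn: "self_normalized u (\<lambda>k. e (Suc k))" and u: "msq_bounded u"
  shows "acov (lag 1 u) e 0"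
proof -
  obtain D where D: "0 \<le> D" "\<And>n. (\<Sum>k<n. (u k)\<^sup>2) \<le> D * real n" using u unfolding msq_bounded_def by blast
  have "(\<lambda>n. (\<Sum>k<n. u k * e (Suc k)) / real n) \<longlonglongrightarrow> 0"
  proof (rule LIMSEQ_I)
    fix r :: real assume r: "0 < r"
    define \<eta> where "\<eta> = r / (2 * (D + 1))"
    have \<eta>: "0 < \<eta>" "\<eta> * D \<le> r / 2" using r D(1) by (auto simp: \<eta>_def field_simps)
    obtain C where C: "\<And>n. \<bar>\<Sum>k<n. u k * e (Suc k)\<bar> \<le> C + \<eta> * (\<Sum>k<n. (u k)\<^sup>2)"
      using sn \<eta>(1) unfolding self_normalized_def by blast
    obtain N where N: "2 * C / r < real N" using reals_Archimedean2 by blast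
    have "norm ((\<Sum>k<n. u k * e (Suc k)) / real n - 0) < r" if n: "n \<ge> Suc N" for n
    proof -
      have "\<eta> * (\<Sum>k<n. (u k)\<^sup>2) \<le> \<eta> * (D * real n)" using \<eta> D(2)[of n] by (intro mult_left_mono) auto
      also have "\<dots> \<le> r / 2 * real n" using mult_right_mono[OF \<eta>(2), of "real n"] by (simp add: mult.assoc)
      finally have "\<bar>\<Sum>k<n. u k * e (Suc k)\<bar> \<le> C + r / 2 * real n" using C[of n] by linarith
      moreover have "2 * C / r < real n" using N n by linarith
      then have "C < r / 2 * real n" using r by (simp add: field_simps)
      ultimately have "\<bar>\<Sum>k<n. u k * e (Suc k)\<bar> < r * real n" by (simp add: field_simps)
      then show ?thesis using n by (simp add: field_simps abs_divide)
    qed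
    then show "\<exists>no. \<forall>n\<ge>no. norm ((\<Sum>k<n. u k * e (Suc k)) / real n - 0) < r" by blast
  qed
  from mean_lag[OF this, of 1] 
  have "(\<lambda>n. (\<Sum>k<n - 1. u k * e (Suc k)) / real n) \<longlonglongrightarrow> 0" .
  moreover have "(\<Sum>k<n - 1. u k * e (Suc k)) = (\<Sum>k<n. lag 1 u k * e k)" for n
    by (cases n) (auto simp: sum.lessThan_Suc_shift lag_def simp del: sum.lessThan_Suc)
  ultimately show ?thesis unfolding acov_def by simp
qed

lemma acov_imp_msq_bounded:
  assumes "acov u u c" shows "msq_bounded u"
proof -
  have "Bseq (\<lambda>n. (\<Sum>k<n. (u k)\<^sup>2) / real n)"
    using assms unfolding acov_def by (intro convergent_imp_Bseq) (auto simp: convergent_def power2_eq_square)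
  then obtain C where C: "0 < C" "\<And>n. \<bar>(\<Sum>k<n. (u k)\<^sup>2) / real n\<bar> \<le> C" by (auto simp: Bseq_def)
  have "(\<Sum>k<n. (u k)\<^sup>2) \<le> C * real n" for n
    using C(2)[of n] by (cases "n = 0") (auto simp: field_simps abs_le_iff)
  then show ?thesis unfolding msq_bounded_def using C(1) by (intro exI[of _ C]) auto
qed

text \<open>At equal lags the empirical covariance of the noise gives \<Gamma>. At different lags
  the earlier noise is a predictable weight for the later one, and the martingale bound gives 0. The
  value \<open>e 0 = 0\<close> lets the averages start at index 0.\<close>

lemma noise_covariance:
  fixes e :: "nat \<Rightarrow> real^'d" and \<Gamma> :: "real^'d^'d"
  assumes avg: "(\<lambda>n. avg_outer e n) \<longlonglongrightarrow> \<Gamma>" and e0: "e 0 = 0"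
    and sn: "\<And>j b c. self_normalized (lag j (\<lambda>k. e k $ b)) (\<lambda>k. e (Suc k) $ c)"
  shows "msq_bounded (\<lambda>k. e k $ b)"
    "acov (lag l (\<lambda>k. e k $ b)) (lag m (\<lambda>k. e k $ c)) (if l = m then \<Gamma> $ b $ c else 0)"
proof -
  have 0: "acov (\<lambda>k. e k $ b) (\<lambda>k. e k $ c) (\<Gamma> $ b $ c)" for b c
  proof -
    have "(\<lambda>n. avg_outer e n $ b $ c) \<longlonglongrightarrow> \<Gamma> $ b $ c"
      by (intro tendsto_intros avg)
    moreover have "avg_outer e n $ b $ c = (\<Sum>k<Suc n. e k $ b * e k $ c) / real n" for n
      by (simp add: avg_outer_def outer_def sum.lessThan_Suc_shift e0 sum.atLeast1_atMost_eq del: sum.lessThan_Suc)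
    ultimately have "(\<lambda>n. (\<Sum>k<Suc n. e k $ b * e k $ c) / real n) \<longlonglongrightarrow> \<Gamma> $ b $ c" by simp
    from mean_lag[OF this, of 1]
    have "(\<lambda>n. (\<Sum>k<Suc (n - 1). e k $ b * e k $ c) / real n) \<longlonglongrightarrow> \<Gamma> $ b $ c" .
    then show ?thesis unfolding acov_def
      by (rule Lim_transform_eventually) (use eventually_gt_at_top[of 0] in eventually_elim, auto)
  qed
  show bd: "msq_bounded (\<lambda>k. e k $ b)" for b using acov_imp_msq_bounded[OF 0] .
  have lagc: "acov (lag (Suc j) (\<lambda>k. e k $ b)) (\<lambda>k. e k $ c) 0" for j b c
    using acov_self_normalized[OF sn msq_bounded_lag[OF bd], of j b c] by (simp add: lag_lag)
  consider "l = m" | "l < m" | "m < l" by linarith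
  then show "acov (lag l (\<lambda>k. e k $ b)) (lag m (\<lambda>k. e k $ c)) (if l = m then \<Gamma> $ b $ c else 0)"
  proof cases
    case 1 then show ?thesis using acov_lag[OF 0] by simp
  next
    case 2
    then obtain j where "m = l + Suc j" using less_imp_Suc_add by auto
    then show ?thesis using acov_commute[OF acov_lag[OF lagc[of j c b], of l]] by (simp add: lag_lag)
  next
    case 3
    then obtain j where "l = m + Suc j" using less_imp_Suc_add by auto
    then show ?thesis using acov_lag[OF lagc[of j b c], of m] by (simp add: lag_lag)
  qed
qed


section \<open>Averages with logarithmic weights\<close>

definition lnp :: "real \<Rightarrow> nat \<Rightarrow> real" where "lnp \<gamma> n = ln (real n) powr (1 + \<gamma>)"

lemma lnp_pos: "2 \<le> n \<Longrightarrow> 0 < lnp \<gamma> n"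
  by (simp add: lnp_def)

lemma lnp_mono: "0 < \<gamma> \<Longrightarrow> 1 \<le> m \<Longrightarrow> m \<le> n \<Longrightarrow> lnp \<gamma> m \<le> lnp \<gamma> n"
  unfolding lnp_def by (intro powr_mono2) auto

lemma lnp_over_n: "0 < \<gamma> \<Longrightarrow> (\<lambda>n. lnp \<gamma> n / real n) \<longlonglongrightarrow> 0"
  unfolding lnp_def by real_asymp

text \<open>The increments of \<open>n / lnp \<gamma> n\<close> are asymptotic to
  \<open>1 / lnp \<gamma> n\<close>: the Stolz-Cesaro quotient for the next sum.\<close>

lemma lnp_increment: 
  "0 < \<gamma> \<Longrightarrow> (\<lambda>n. lnp \<gamma> n * (real (Suc n) / lnp \<gamma> (Suc n) - real n / lnp \<gamma> n)) \<longlonglongrightarrow> 1"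
  unfolding lnp_def by real_asymp

lemma lnp_Suc_ratio: "0 < \<gamma> \<Longrightarrow> (\<lambda>n. (lnp \<gamma> n / real n) / (lnp \<gamma> (Suc n) / real (Suc n))) \<longlonglongrightarrow> 1"
  unfolding lnp_def by real_asymp

text \<open>Stolz-Cesaro: \<open>n / lnp \<gamma> n\<close> and the partial sums of
  \<open>1 / lnp \<gamma> k\<close> have asymptotically equal increments. The sum starts at 2
  because \<open>lnp \<gamma> 1 = 0\<close>.\<close>

lemma sum_inverse_lnp:
  assumes \<gamma>: "0 < \<gamma>"
  shows "(\<lambda>n. lnp \<gamma> n / real n * (\<Sum>k=2..<n. 1 / lnp \<gamma> k)) \<longlonglongrightarrow> 1"
proof (rule LIMSEQ_I)
  fix r :: real assume r: "0 < r"
  let ?b = "lnp \<gamma>"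
  let ?D = "\<lambda>n. real n / ?b n"
  define \<sigma> where "\<sigma> n = (\<Sum>k=2..<n. 1 / ?b k)" for n
  \<comment> \<open>The bound 1/2 gives a first comparison of \<open>\<sigma> n\<close> with
    \<open>?D n\<close>; the bound \<open>r / 4\<close> then makes the relative error at most
    \<open>r / 2\<close>. The other half of \<open>r\<close> is left to the constant
    \<open>K\<close>.\<close>
  define \<eta> where "\<eta> = min (1/2) (r / 4)"
  have \<eta>: "0 < \<eta>" "\<eta> \<le> 1/2" "\<eta> \<le> r / 4" using r by (auto simp: \<eta>_def)
  from LIMSEQ_D[OF lnp_increment[OF \<gamma>] \<eta>(1)] obtain N0
    where N0: "\<And>n. n \<ge> N0 \<Longrightarrow> \<bar>?b n * (?D (Suc n) - ?D n) - 1\<bar> < \<eta>" by auto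
  define N where "N = max 2 N0"
  have inc: "\<bar>(?D (Suc n) - ?D n) - 1 / ?b n\<bar> \<le> \<eta> * (1 / ?b n)" if "n \<ge> N" for n
  proof -
    have b: "0 < ?b n" using that by (intro lnp_pos) (simp add: N_def)
    have "(?D (Suc n) - ?D n) - 1 / ?b n = (?b n * (?D (Suc n) - ?D n) - 1) * (1 / ?b n)"
      using b by (simp add: diff_divide_distrib)
    also have "\<bar>\<dots>\<bar> = \<bar>?b n * (?D (Suc n) - ?D n) - 1\<bar> * (1 / ?b n)" using b by (simp add: abs_mult)
    also have "\<dots> \<le> \<eta> * (1 / ?b n)" using N0[of n] that b by (intro mult_right_mono) (auto simp: N_def)
    finally show ?thesis .
  qed
  have tel: "\<bar>(?D n - ?D N) - (\<sigma> n - \<sigma> N)\<bar> \<le> \<eta> * (\<sigma> n - \<sigma> N)" if "n \<ge> N" for n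
    using that
  proof (induction n rule: dec_induct)
    case (step n)
    have \<sigma>: "\<sigma> (Suc n) = \<sigma> n + 1 / ?b n" using step.hyps by (simp add: \<sigma>_def N_def)
    have "\<eta> * (\<sigma> (Suc n) - \<sigma> N) = \<eta> * (\<sigma> n - \<sigma> N) + \<eta> * (1 / ?b n)"
      unfolding \<sigma> by (simp only: distrib_left[symmetric]) simp
    then show ?case using step.IH inc[OF step.hyps(1)] \<sigma> by linarith
  qed simp
  define K where "K = \<bar>?D N\<bar> + 2 * \<bar>\<sigma> N\<bar>"
  have lim: "(\<lambda>n. 2 * K * (?b n / real n)) \<longlonglongrightarrow> 2 * K * 0" by (intro tendsto_intros lnp_over_n \<gamma>)
  have "0 < r / 2" using r by simp
  from LIMSEQ_D[OF lim this] obtain N1 where N1: "\<And>n. n \<ge> N1 \<Longrightarrow> \<bar>2 * K * (?b n / real n)\<bar> < r / 2" by auto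
  have "norm (?b n / real n * \<sigma> n - 1) < r" if n: "n \<ge> max N N1" for n
  proof -
    have b: "0 < ?b n" using n by (intro lnp_pos) (simp add: N_def)
    have n0: "0 < real n" using n by (simp add: N_def)
    have D0: "0 \<le> ?D n" using b by simp
    have s0: "0 \<le> \<sigma> n" unfolding \<sigma>_def by (intro sum_nonneg) (simp add: lnp_def)
    have sN: "0 \<le> \<sigma> N" unfolding \<sigma>_def by (intro sum_nonneg) (simp add: lnp_def)
    have e1: "\<eta> * (\<sigma> n - \<sigma> N) \<le> \<eta> * \<sigma> n" using \<eta>(1) sN by (intro mult_left_mono) auto
    have e2: "\<eta> * \<sigma> n \<le> \<sigma> n / 2" using \<eta>(2) s0 mult_right_mono[of \<eta> "1/2" "\<sigma> n"] by simp
    have t: "\<bar>(?D n - ?D N) - (\<sigma> n - \<sigma> N)\<bar> \<le> \<eta> * \<sigma> n" using tel[of n] e1 n by simp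
    have "\<sigma> n \<le> 2 * ?D n + 2 * K" 
    proof -
      have gen: "\<bar>(d - d') - (s - s')\<bar> \<le> x \<Longrightarrow> x \<le> s / 2 \<Longrightarrow> s \<le> 2 * d + 2 * (\<bar>d'\<bar> + 2 * \<bar>s'\<bar>)"
        for d d' s s' x :: real by (smt (verit) field_sum_of_halves)
      show ?thesis unfolding K_def by (rule gen[OF t e2])
    qed
    then have "\<eta> * \<sigma> n \<le> \<eta> * (2 * ?D n + 2 * K)" using \<eta>(1) by (intro mult_left_mono) auto
    also have "\<dots> \<le> (r / 4) * (2 * ?D n) + 1/2 * (2 * K)"
      unfolding distrib_left using \<eta> D0 by (intro add_mono mult_right_mono) (auto simp: K_def)
    finally have "\<eta> * \<sigma> n \<le> r / 2 * ?D n + K" by simp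
    have "\<bar>\<sigma> n - ?D n\<bar> \<le> r / 2 * ?D n + 2 * K"
    proof -
      have gen: "\<bar>(d - d') - (s - s')\<bar> \<le> x \<Longrightarrow> x \<le> y + (\<bar>d'\<bar> + 2 * \<bar>s'\<bar>) \<Longrightarrow> \<bar>s - d\<bar> \<le> y + 2 * (\<bar>d'\<bar> + 2 * \<bar>s'\<bar>)"
        for d d' s s' x y :: real by (smt (verit))
      show ?thesis using \<open>\<eta> * \<sigma> n \<le> r / 2 * ?D n + K\<close> unfolding K_def by (rule gen[OF t])
    qed
    then have "\<bar>\<sigma> n - ?D n\<bar> * (?b n / real n) \<le> (r / 2 * ?D n + 2 * K) * (?b n / real n)"
      using b n0 by (intro mult_right_mono) auto
    also have "\<dots> = r / 2 + 2 * K * (?b n / real n)" using b n0 by (simp add: field_simps)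
    also have "\<dots> < r" using N1[of n] n by linarith
    also have "\<bar>\<sigma> n - ?D n\<bar> * (?b n / real n) = \<bar>(\<sigma> n - ?D n) * (?b n / real n)\<bar>" using b n0 by (simp add: abs_mult)
    also have "(\<sigma> n - ?D n) * (?b n / real n) = ?b n / real n * \<sigma> n - 1" using b n0 by (simp add: field_simps)
    finally show ?thesis by simp
  qed
  then show "\<exists>no. \<forall>n\<ge>no. norm (?b n / real n * (\<Sum>k=2..<n. 1 / ?b k) - 1) < r" unfolding \<sigma>_def by blast
qed

text \<open>Abel summation: under decreasing weights, \<open>t\<close> counts no more than the
  constant \<open>C\<close> that bounds its averages; the term \<open>real m * g m\<close> pays for
  the mass allowed before \<open>m\<close>.\<close>

lemma sum_decreasing_weights_le:
  fixes g t :: "nat \<Rightarrow> real"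
  assumes t: "\<And>k. 0 \<le> t k" and R: "\<And>n. (\<Sum>k<n. t k) \<le> C * real n"
    and g: "\<And>k. m \<le> k \<Longrightarrow> k < n \<Longrightarrow> 0 \<le> g k" "\<And>k. m \<le> k \<Longrightarrow> Suc k < n \<Longrightarrow> g (Suc k) \<le> g k" and mn: "m < n"
  shows "(\<Sum>k=m..<n. g k * t k) \<le> C * (real m * g m + (\<Sum>k=m..<n. g k))"
proof -
  define Rn where "Rn n = (\<Sum>k<n. t k)" for n
  have R0: "0 \<le> Rn k" "Rn k \<le> C * real k" "Rn (Suc k) = Rn k + t k" for k
    using R t by (auto simp: Rn_def sum_nonneg)
  \<comment> \<open>The invariant carries the unspent slack
    \<open>C * real (Suc j) - Rn (Suc j)\<close> at the current weight; since the slack is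
    nonnegative, lowering the weight only lowers its value.\<close>
  have main: "j < n \<Longrightarrow> (\<Sum>k=m..<Suc j. g k * t k) + g j * (C * real (Suc j) - Rn (Suc j)) \<le> C * (real m * g m + (\<Sum>k=m..<Suc j. g k))"
    if "m \<le> j" for j
    using that
  proof (induction j rule: dec_induct)
    case base
    have "g m * t m + g m * (C * real (Suc m) - Rn (Suc m)) = C * (real m * g m + g m) - g m * Rn m"
      by (simp add: R0 algebra_simps)
    then show ?case using g(1)[of m] mn R0(1)[of m] by simp
  next
    case (step j)
    have "g (Suc j) * (C * real (Suc j) - Rn (Suc j)) \<le> g j * (C * real (Suc j) - Rn (Suc j))"
      using g(2)[of j] step R0(2)[of "Suc j"] by (intro mult_right_mono) auto
    moreover have "g (Suc j) * t (Suc j) + g (Suc j) * (C * real (Suc (Suc j)) - Rn (Suc (Suc j)))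
        = g (Suc j) * (C * real (Suc j) - Rn (Suc j)) + C * g (Suc j)"
      by (simp add: R0(3)[of "Suc j"] algebra_simps)
    moreover have "(\<Sum>k=m..<Suc j. g k * t k) + g j * (C * real (Suc j) - Rn (Suc j)) \<le> C * (real m * g m + (\<Sum>k=m..<Suc j. g k))"
      using step by simp
    moreover have "(\<Sum>k=m..<Suc (Suc j). g k * t k) = (\<Sum>k=m..<Suc j. g k * t k) + g (Suc j) * t (Suc j)"
      "C * (real m * g m + (\<Sum>k=m..<Suc (Suc j). g k)) = C * (real m * g m + (\<Sum>k=m..<Suc j. g k)) + C * g (Suc j)"
      using step.hyps by (simp_all add: algebra_simps)
    ultimately show ?case by linarith
  qed
  obtain j where j: "n = Suc j" "m \<le> j" using mn by (cases n) auto
  have "0 \<le> g j * (C * real (Suc j) - Rn (Suc j))" using g(1)[of j] j R0(2)[of "Suc j"] by simp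
  with main[OF j(2)] j show ?thesis by simp
qed

text \<open>All weights up to \<open>n\<close> may be replaced on average by the single value
  \<open>1 / lnp \<gamma> n\<close>. The factor \<open>lnp \<gamma> n / lnp \<gamma> k - 1\<close>
  is nonnegative and decreasing in \<open>k\<close>, so Abel summation reduces \<open>t\<close> to a
  constant, where \<open>sum_inverse_lnp\<close> applies.\<close>

lemma weight_deviation:
  assumes \<gamma>: "0 < \<gamma>" and t: "\<And>k. 0 \<le> t k" and R: "\<And>n. (\<Sum>k<n. t k) \<le> C * real n"
    and a: "(\<lambda>n. a n * lnp \<gamma> n) \<longlonglongrightarrow> 1"
  shows "(\<lambda>n. (\<Sum>k<n. \<bar>a k * lnp \<gamma> n - 1\<bar> * t k) / real n) \<longlonglongrightarrow> 0"
proof -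
  let ?b = "lnp \<gamma>"
  have C0: "0 \<le> C" using R[of 1] t[of 0] by simp
  define w where "w n = (\<Sum>k=2..<n. (?b n / ?b k - 1) * t k) / real n" for n
  have w_bound: "\<bar>w n\<bar> \<le> C * (2 / ?b 2 * (?b n / real n) + (?b n / real n * (\<Sum>k=2..<n. 1 / ?b k) - 1) + 2 / real n)" if n: "n > 2" for n
  proof -
    have g0: "0 \<le> ?b n / ?b k - 1" if "2 \<le> k" "k < n" for k
      using lnp_mono[OF \<gamma>, of k n] lnp_pos[of k \<gamma>] that by simp
    have "(\<Sum>k=2..<n. (?b n / ?b k - 1) * t k) \<le> C * (real 2 * (?b n / ?b 2 - 1) + (\<Sum>k=2..<n. ?b n / ?b k - 1))"
    proof (rule sum_decreasing_weights_le[OF t R g0])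
      fix k assume "2 \<le> k" "Suc k < n"
      then show "?b n / ?b (Suc k) - 1 \<le> ?b n / ?b k - 1"
        using lnp_mono[OF \<gamma>, of k "Suc k"] lnp_pos[of k \<gamma>] lnp_pos[of n \<gamma>] by (intro diff_right_mono divide_left_mono) auto
    qed (use n in auto)
    also have "(\<Sum>k=2..<n. ?b n / ?b k - 1) = ?b n * (\<Sum>k=2..<n. 1 / ?b k) - (real n - 2)"
      using n by (simp add: sum_subtractf sum_distrib_left of_nat_diff)
    also have "C * (real 2 * (?b n / ?b 2 - 1) + (?b n * (\<Sum>k=2..<n. 1 / ?b k) - (real n - 2)))
      \<le> C * (2 * (?b n / ?b 2) + (?b n * (\<Sum>k=2..<n. 1 / ?b k) - real n + 2))"
      using C0 by (intro mult_left_mono) auto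
    finally have "w n \<le> C * (2 * (?b n / ?b 2) + (?b n * (\<Sum>k=2..<n. 1 / ?b k) - real n + 2)) / real n"
      unfolding w_def by (rule divide_right_mono) simp
    also have "\<dots> = C * (2 / ?b 2 * (?b n / real n) + (?b n / real n * (\<Sum>k=2..<n. 1 / ?b k) - 1) + 2 / real n)"
      using n by (simp add: field_simps)
    finally have "w n \<le> C * (2 / ?b 2 * (?b n / real n) + (?b n / real n * (\<Sum>k=2..<n. 1 / ?b k) - 1) + 2 / real n)" .
    moreover have "0 \<le> w n" unfolding w_def using g0 t by (intro divide_nonneg_nonneg sum_nonneg mult_nonneg_nonneg) auto
    ultimately show ?thesis by simp
  qed
  have "(\<lambda>n. C * (2 / ?b 2 * (?b n / real n) + (?b n / real n * (\<Sum>k=2..<n. 1 / ?b k) - 1) + 2 / real n)) \<longlonglongrightarrow> C * (2 / ?b 2 * 0 + (1 - 1) + 0)"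
    by (intro tendsto_intros lnp_over_n sum_inverse_lnp \<gamma> lim_const_over_n)
  then have lim0: "(\<lambda>n. C * (2 / ?b 2 * (?b n / real n) + (?b n / real n * (\<Sum>k=2..<n. 1 / ?b k) - 1) + 2 / real n)) \<longlonglongrightarrow> 0" by simp
  have w_lim: "w \<longlonglongrightarrow> 0"
    by (rule Lim_null_comparison[OF eventually_mono[OF eventually_gt_at_top[of 2]] lim0])
      (simp only: real_norm_def w_bound)
  show ?thesis
  proof (rule LIMSEQ_I)
    fix r :: real assume r: "0 < r"
    define \<eta> where "\<eta> = r / (4 * (C + 1))"
    have \<eta>: "0 < \<eta>" "\<eta> * (C + 1) = r / 4" using r C0 by (auto simp: \<eta>_def field_simps)
    from LIMSEQ_D[OF a \<eta>(1)] obtain N0 where N0: "\<And>n. n \<ge> N0 \<Longrightarrow> \<bar>a n * ?b n - 1\<bar> < \<eta>" by auto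
    define N where "N = max 2 N0"
    define K where "K = (\<Sum>k<N. \<bar>a k\<bar> * t k)"
    define L where "L = (\<Sum>k<N. t k)"
    have w0: "w n \<ge> 0" if "n > 2" for n
      unfolding w_def using lnp_mono[OF \<gamma>] lnp_pos[of _ \<gamma>] t that
      by (intro divide_nonneg_nonneg sum_nonneg mult_nonneg_nonneg) auto
    have main: "(\<Sum>k<n. \<bar>a k * ?b n - 1\<bar> * t k) / real n \<le> K * (?b n / real n) + L / real n + \<eta> * (w n + C) + w n"
      if n: "n > N" for n
    proof -
      have n2: "n > 2" using n by (simp add: N_def)
      have bn: "0 < ?b n" using n2 by (intro lnp_pos) simp
      have pt: "\<bar>a k * ?b n - 1\<bar> * t k \<le> \<eta> * ((?b n / ?b k - 1) * t k) + \<eta> * t k + (?b n / ?b k - 1) * t k" if k: "N \<le> k" "k < n" for k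
      proof -
        have bk: "0 < ?b k" "?b k \<le> ?b n" using k lnp_mono[OF \<gamma>, of k n] by (auto simp: N_def intro: lnp_pos)
        have q: "1 \<le> ?b n / ?b k" using bk by simp
        \<comment> \<open>Separates the error in the asymptotics of \<open>a k\<close> from the
          change of \<open>lnp\<close> between \<open>k\<close> and \<open>n\<close>.\<close>
        have "a k * ?b n - 1 = (a k * ?b k - 1) * (?b n / ?b k) + (?b n / ?b k - 1)" using bk by (simp add: field_simps)
        also have "\<bar>\<dots>\<bar> \<le> \<bar>a k * ?b k - 1\<bar> * (?b n / ?b k) + (?b n / ?b k - 1)"
          using q abs_triangle_ineq[of "(a k * ?b k - 1) * (?b n / ?b k)" "?b n / ?b k - 1"] by (simp only: abs_mult abs_of_nonneg diff_ge_0_iff_ge order_trans[OF zero_le_one q])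
        also have "\<dots> \<le> \<eta> * (?b n / ?b k) + (?b n / ?b k - 1)"
          using N0[of k] k q by (intro add_right_mono mult_right_mono) (auto simp: N_def)
        finally have "\<bar>a k * ?b n - 1\<bar> * t k \<le> (\<eta> * (?b n / ?b k) + (?b n / ?b k - 1)) * t k" using t by (intro mult_right_mono) auto
        also have "\<dots> = \<eta> * ((?b n / ?b k - 1) * t k) + \<eta> * t k + (?b n / ?b k - 1) * t k" by (simp add: algebra_simps)
        finally show ?thesis .
      qed
      have "(\<Sum>k<n. \<bar>a k * ?b n - 1\<bar> * t k) = (\<Sum>k<N. \<bar>a k * ?b n - 1\<bar> * t k) + (\<Sum>k=N..<n. \<bar>a k * ?b n - 1\<bar> * t k)"
        using n by (simp add: lessThan_atLeast0 sum.atLeastLessThan_concat)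
      also have "(\<Sum>k<N. \<bar>a k * ?b n - 1\<bar> * t k) \<le> (\<Sum>k<N. \<bar>a k\<bar> * t k * ?b n + t k)"
      proof (rule sum_mono)
        fix k
        have "\<bar>a k * ?b n - 1\<bar> \<le> \<bar>a k\<bar> * ?b n + 1" using bn abs_triangle_ineq4[of "a k * ?b n" 1] by (simp add: abs_mult)
        then show "\<bar>a k * ?b n - 1\<bar> * t k \<le> \<bar>a k\<bar> * t k * ?b n + t k"
          using mult_right_mono[OF _ t[of k]] by (fastforce simp: algebra_simps)
      qed
      also have "\<dots> = K * ?b n + L" by (simp add: K_def L_def sum.distrib sum_distrib_right)
      also have "(\<Sum>k=N..<n. \<bar>a k * ?b n - 1\<bar> * t k) \<le> (\<Sum>k=N..<n. \<eta> * ((?b n / ?b k - 1) * t k) + \<eta> * t k + (?b n / ?b k - 1) * t k)"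
        by (intro sum_mono pt) auto
      also have "\<dots> = \<eta> * (\<Sum>k=N..<n. (?b n / ?b k - 1) * t k) + \<eta> * (\<Sum>k=N..<n. t k) + (\<Sum>k=N..<n. (?b n / ?b k - 1) * t k)"
        by (simp add: sum.distrib sum_distrib_left)
      also have "\<dots> \<le> \<eta> * (w n * real n) + \<eta> * (C * real n) + w n * real n"
      proof -
        have 1: "(\<Sum>k=N..<n. (?b n / ?b k - 1) * t k) \<le> w n * real n"
        proof -
          have "(\<Sum>k=N..<n. (?b n / ?b k - 1) * t k) \<le> (\<Sum>k=2..<n. (?b n / ?b k - 1) * t k)"
            using lnp_mono[OF \<gamma>] lnp_pos[of _ \<gamma>] t by (intro sum_mono2) (auto simp: N_def)
          then show ?thesis using n by (simp add: w_def)
        qed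
        have 2: "(\<Sum>k=N..<n. t k) \<le> C * real n"
        proof -
          have "(\<Sum>k=N..<n. t k) \<le> (\<Sum>k<n. t k)" using t by (intro sum_mono2) auto
          then show ?thesis using R[of n] by linarith
        qed
        show ?thesis using 1 2 \<eta>(1) by (intro add_mono mult_left_mono) auto
      qed
      finally have "(\<Sum>k<n. \<bar>a k * ?b n - 1\<bar> * t k) \<le> K * ?b n + L + (\<eta> * (w n * real n) + \<eta> * (C * real n) + w n * real n)" by linarith
      then have "(\<Sum>k<n. \<bar>a k * ?b n - 1\<bar> * t k) / real n \<le> (K * ?b n + L + (\<eta> * (w n * real n) + \<eta> * (C * real n) + w n * real n)) / real n"
        by (rule divide_right_mono) simp
      also have "\<dots> = K * (?b n / real n) + L / real n + \<eta> * (w n + C) + w n" using n by (simp add: field_simps)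
      finally show ?thesis .
    qed
    have "(\<lambda>n. K * (?b n / real n) + L / real n + \<eta> * (w n + C) + w n) \<longlonglongrightarrow> K * 0 + 0 + \<eta> * (0 + C) + 0"
      by (intro tendsto_intros lnp_over_n \<gamma> w_lim lim_const_over_n)
    moreover have "K * 0 + 0 + \<eta> * (0 + C) + 0 < r" using \<eta> r by (simp add: algebra_simps)
    ultimately have "eventually (\<lambda>n. K * (?b n / real n) + L / real n + \<eta> * (w n + C) + w n < r) sequentially"
      by (rule order_tendstoD(2))
    then have "eventually (\<lambda>n. norm ((\<Sum>k<n. \<bar>a k * ?b n - 1\<bar> * t k) / real n - 0) < r) sequentially"
      using eventually_gt_at_top[of N]
    proof eventually_elim
      case (elim n)
      have "0 \<le> (\<Sum>k<n. \<bar>a k * ?b n - 1\<bar> * t k) / real n" using t by (intro divide_nonneg_nonneg sum_nonneg mult_nonneg_nonneg) auto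
      then show ?case using main[OF elim(2)] elim(1) by simp
    qed
    then show "\<exists>no. \<forall>n\<ge>no. norm ((\<Sum>k<n. \<bar>a k * ?b n - 1\<bar> * t k) / real n - 0) < r"
      by (simp add: eventually_sequentially)
  qed
qed

lemma weighted_mean:
  assumes \<gamma>: "0 < \<gamma>" and y: "\<And>k. \<bar>y k\<bar> \<le> t k" and R: "\<And>n. (\<Sum>k<n. t k) \<le> C * real n"
    and a: "(\<lambda>n. a n * lnp \<gamma> n) \<longlonglongrightarrow> 1" and lim: "(\<lambda>n. (\<Sum>k<n. y k) / real n) \<longlonglongrightarrow> c"
  shows "(\<lambda>n. lnp \<gamma> n / real n * (\<Sum>k<Suc n. a k * y k)) \<longlonglongrightarrow> c"
proof -
  have t: "0 \<le> t k" for k using y[of k] by linarith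
  have "(\<lambda>n. (\<Sum>k<n. (a k * lnp \<gamma> n - 1) * y k) / real n) \<longlonglongrightarrow> 0"
  proof (rule Lim_null_comparison[OF always_eventually weight_deviation[OF \<gamma> t R a]], intro allI)
    fix n
    have "\<bar>\<Sum>k<n. (a k * lnp \<gamma> n - 1) * y k\<bar> \<le> (\<Sum>k<n. \<bar>a k * lnp \<gamma> n - 1\<bar> * t k)"
      by (rule order_trans[OF sum_abs]) (auto intro!: sum_mono mult_left_mono y simp: abs_mult)
    then show "norm ((\<Sum>k<n. (a k * lnp \<gamma> n - 1) * y k) / real n) \<le> (\<Sum>k<n. \<bar>a k * lnp \<gamma> n - 1\<bar> * t k) / real n"
      by (simp add: divide_right_mono)
  qed
  from tendsto_add[OF this lim]
  have "(\<lambda>n. (\<Sum>k<n. (a k * lnp \<gamma> n - 1) * y k) / real n + (\<Sum>k<n. y k) / real n) \<longlonglongrightarrow> c" by simp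
  moreover have "(\<Sum>k<n. (a k * lnp \<gamma> n - 1) * y k) / real n + (\<Sum>k<n. y k) / real n
      = lnp \<gamma> n / real n * (\<Sum>k<n. a k * y k)" for n
  proof -
    have "(\<Sum>k<n. (a k * lnp \<gamma> n - 1) * y k) + (\<Sum>k<n. y k) = lnp \<gamma> n * (\<Sum>k<n. a k * y k)"
      by (simp add: sum.distrib[symmetric] sum_distrib_left algebra_simps)
    then show ?thesis by (simp add: add_divide_distrib[symmetric])
  qed
  ultimately have "(\<lambda>n. lnp \<gamma> n / real n * (\<Sum>k<n. a k * y k)) \<longlonglongrightarrow> c" by simp
  \<comment> \<open>The Gram matrix at time \<open>n\<close> has \<open>Suc n\<close> terms but is
    normalised at \<open>n\<close>; the ratio of the two normalisations tends to 1.\<close>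
  from LIMSEQ_Suc[OF this]
  have 1: "(\<lambda>n. lnp \<gamma> (Suc n) / real (Suc n) * (\<Sum>k<Suc n. a k * y k)) \<longlonglongrightarrow> c" .
  from tendsto_mult[OF lnp_Suc_ratio[OF \<gamma>] 1]
  have "(\<lambda>n. (lnp \<gamma> n / real n) / (lnp \<gamma> (Suc n) / real (Suc n)) * (lnp \<gamma> (Suc n) / real (Suc n) * (\<Sum>k<Suc n. a k * y k))) \<longlonglongrightarrow> c" by simp
  then show ?thesis
  proof (rule Lim_transform_eventually)
    show "\<forall>\<^sub>F n in sequentially. (lnp \<gamma> n / real n) / (lnp \<gamma> (Suc n) / real (Suc n)) * (lnp \<gamma> (Suc n) / real (Suc n) * (\<Sum>k<Suc n. a k * y k))
      = lnp \<gamma> n / real n * (\<Sum>k<Suc n. a k * y k)"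
      using eventually_gt_at_top[of 2]
    proof eventually_elim
      case (elim n)
      then have "lnp \<gamma> (Suc n) / real (Suc n) \<noteq> 0" using lnp_pos[of "Suc n" \<gamma>] by simp
      moreover have "x / y' * (y' * z) = x * z" if "y' \<noteq> 0" for x y' z :: real using that by simp
      ultimately show ?case by blast
    qed
  qed
qed

section \<open>Energy of signals and block indices\<close>

lemma pos_bij: "bij_betw (pos :: 'a::{finite,linorder} \<Rightarrow> nat) UNIV {1..CARD('a)}"
proof -
  have strict: "pos i < pos j" if "i < j" for i j :: 'a
    unfolding pos_def using that by (intro psubset_card_mono) auto
  have inj: "inj (pos :: 'a \<Rightarrow> nat)"
  proof (rule injI)
    fix i j :: 'a assume "pos i = pos j"
    then show "i = j" using strict[of i j] strict[of j i] by (metis less_irrefl neq_iff)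
  qed
  have "range (pos :: 'a \<Rightarrow> nat) \<subseteq> {1..CARD('a)}"
  proof
    fix n assume "n \<in> range (pos :: 'a \<Rightarrow> nat)"
    then obtain i :: 'a where i: "n = pos i" by blast
    have "0 < pos i" unfolding pos_def by (subst card_gt_0_iff) auto
    moreover have "pos i \<le> CARD('a)" unfolding pos_def by (intro card_mono) auto
    ultimately show "n \<in> {1..CARD('a)}" using i by simp
  qed
  moreover have "card (range (pos :: 'a \<Rightarrow> nat)) = card {1..CARD('a)}" using card_image[OF inj] by simp
  ultimately have "range (pos :: 'a \<Rightarrow> nat) = {1..CARD('a)}" by (intro card_subset_eq) auto
  with inj show ?thesis by (simp add: bij_betw_def)
qed

lemma pos_ge_1: "1 \<le> pos (i :: 'a::{finite,linorder})" and pos_le: "pos i \<le> CARD('a)"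
  using bij_betwE[OF pos_bij, rule_format, of i] by auto

lemma pos_inject: "pos (i :: 'a::{finite,linorder}) = pos j \<longleftrightarrow> i = j"
  using bij_betw_imp_inj_on[OF pos_bij] by (auto dest: injD)

lemma pos_obtain: assumes "1 \<le> n" "n \<le> CARD('a)" obtains i :: "'a::{finite,linorder}" where "pos i = n"
proof -
  have "range (pos :: 'a \<Rightarrow> nat) = {1..CARD('a)}" by (rule bij_betw_imp_surj_on[OF pos_bij])
  then have "n \<in> range (pos :: 'a \<Rightarrow> nat)" using assms by simp
  then show ?thesis using that by blast
qed

lemma sum_pos: "(\<Sum>i\<in>(UNIV :: 'a::{finite,linorder} set). f (pos i)) = (\<Sum>j=1..CARD('a). f j)"
  by (rule sum.reindex_bij_betw[OF pos_bij])

lemma sum_block: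
  "(\<Sum>r\<in>(UNIV :: (('p::finite \<times> 'd::finite) + ('q::finite \<times> 'd)) set). g r)
   = (\<Sum>i\<in>UNIV. \<Sum>b\<in>UNIV. g (Inl (i, b))) + (\<Sum>i\<in>UNIV. \<Sum>b\<in>UNIV. g (Inr (i, b)))"
proof -
  have "(\<Sum>r\<in>(UNIV :: (('p \<times> 'd) + ('q \<times> 'd)) set). g r) = (\<Sum>r\<in>UNIV. g (Inl r)) + (\<Sum>r\<in>UNIV. g (Inr r))"
    unfolding UNIV_Plus_UNIV[symmetric] by (subst sum.Plus) auto
  then show ?thesis by (simp add: sum.cartesian_product)
qed

text \<open>The reference \<open>R\<close> is left open: it will be time plus prediction energy, and
  also a copy of this delayed by one step. The \<open>1 +\<close> absorbs initial values.\<close>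

definition energy_dom :: "(nat \<Rightarrow> real) \<Rightarrow> (nat \<Rightarrow> real) \<Rightarrow> bool" where
  "energy_dom R u \<longleftrightarrow> (\<exists>C\<ge>0. \<forall>n. (\<Sum>k<n. (u k)\<^sup>2) \<le> C * (1 + R n))"

lemma energy_domI: "0 \<le> C \<Longrightarrow> (\<And>n. (\<Sum>k<n. (u k)\<^sup>2) \<le> C * (1 + R n)) \<Longrightarrow> energy_dom R u"
  unfolding energy_dom_def by blast

lemma energy_dom_add:
  assumes "energy_dom R u" "energy_dom R v"
  shows "energy_dom R (\<lambda>k. u k + v k)"
proof -
  obtain C D where CD: "0 \<le> C" "\<And>n. (\<Sum>k<n. (u k)\<^sup>2) \<le> C * (1 + R n)" "0 \<le> D" "\<And>n. (\<Sum>k<n. (v k)\<^sup>2) \<le> D * (1 + R n)"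
    using assms unfolding energy_dom_def by blast
  show ?thesis
  proof (rule energy_domI[of "2 * C + 2 * D"])
    fix n
    have "(\<Sum>k<n. (u k + v k)\<^sup>2) \<le> 2 * (\<Sum>k<n. (u k)\<^sup>2) + 2 * (\<Sum>k<n. (v k)\<^sup>2)"
      by (rule sum_add_power2_le)
    also have "\<dots> \<le> 2 * (C * (1 + R n)) + 2 * (D * (1 + R n))" by (intro add_mono mult_left_mono CD) auto
    finally show "(\<Sum>k<n. (u k + v k)\<^sup>2) \<le> (2 * C + 2 * D) * (1 + R n)" by (simp add: algebra_simps)
  qed (use CD in auto)
qed

lemma energy_dom_zero: "(\<And>n. 0 \<le> R n) \<Longrightarrow> energy_dom R (\<lambda>_. 0)"
  by (rule energy_domI[of 0]) auto

lemma energy_dom_sum: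
  "finite I \<Longrightarrow> (\<And>n. 0 \<le> R n) \<Longrightarrow> (\<And>i. i \<in> I \<Longrightarrow> energy_dom R (u i)) \<Longrightarrow> energy_dom R (\<lambda>k. \<Sum>i\<in>I. u i k)"
  by (induction I rule: finite_induct) (auto intro!: energy_dom_add energy_dom_zero)

lemma energy_dom_le:
  assumes "energy_dom R v" "0 \<le> K" "\<And>n. (\<Sum>k<n. (u k)\<^sup>2) \<le> K * (\<Sum>k<n. (v k)\<^sup>2)"
  shows "energy_dom R u"
proof -
  obtain C where C: "0 \<le> C" "\<And>n. (\<Sum>k<n. (v k)\<^sup>2) \<le> C * (1 + R n)" using assms(1) unfolding energy_dom_def by blast
  show ?thesis
  proof (rule energy_domI[of "K * C"])
    fix n
    show "(\<Sum>k<n. (u k)\<^sup>2) \<le> K * C * (1 + R n)"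
      using order_trans[OF assms(3) mult_left_mono[OF C(2) assms(2)], of n] by (simp add: mult.assoc)
  qed (use C assms in auto)
qed

lemma energy_dom_cmult: "energy_dom R u \<Longrightarrow> energy_dom R (\<lambda>k. c * u k)"
  by (rule energy_dom_le[of R u "c\<^sup>2"]) (auto simp: power_mult_distrib sum_distrib_left)

lemma energy_dom_lag: "energy_dom R u \<Longrightarrow> energy_dom R (lag m u)"
  by (rule energy_dom_le[of R u 1]) (use sum_lag_power2_le in auto)

lemma energy_dom_MA:
  "summable (\<lambda>m. \<bar>g m\<bar>) \<Longrightarrow> energy_dom R u \<Longrightarrow> energy_dom R (\<lambda>k. \<Sum>m\<le>k. g m * u (k - m))"
  by (rule energy_dom_le[of R u "(\<Sum>m. \<bar>g m\<bar>)\<^sup>2"]) (use young_l1_l2 in auto)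

lemma finite_support_energy:
  fixes u :: "nat \<Rightarrow> real"
  assumes "\<And>k. N \<le> k \<Longrightarrow> u k = 0"
  shows "(\<Sum>k<n. (u k)\<^sup>2) \<le> (\<Sum>k<N. (u k)\<^sup>2)"
proof -
  have "(\<Sum>k<n. (u k)\<^sup>2) = (\<Sum>k<min n N. (u k)\<^sup>2)" by (rule sum.mono_neutral_right) (auto simp: assms)
  also have "\<dots> \<le> (\<Sum>k<N. (u k)\<^sup>2)" by (rule sum_mono2) auto
  finally show ?thesis .
qed

lemma energy_dom_finite_support:
  assumes "\<And>k. N \<le> k \<Longrightarrow> u k = 0" "\<And>n. 0 \<le> R n"
  shows "energy_dom R u"
proof (rule energy_domI)
  show "0 \<le> (\<Sum>k<N. (u k)\<^sup>2)" by (rule sum_nonneg) simp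
  then have R: "(\<Sum>k<N. (u k)\<^sup>2) * 1 \<le> (\<Sum>k<N. (u k)\<^sup>2) * (1 + R n)" for n
    by (intro mult_left_mono) (use assms(2) in auto)
  fix n
  have "(\<Sum>k<n. (u k)\<^sup>2) \<le> (\<Sum>k<N. (u k)\<^sup>2)" by (rule finite_support_energy) (rule assms(1))
  then show "(\<Sum>k<n. (u k)\<^sup>2) \<le> (\<Sum>k<N. (u k)\<^sup>2) * (1 + R n)" using R[of n] by simp
qed

lemma msq_null_finite_support:
  assumes "\<And>k. N \<le> k \<Longrightarrow> u k = 0"
  shows "msq_null u"
  unfolding msq_null_def
proof (rule Lim_null_comparison[OF always_eventually])
  show "\<forall>n. norm ((\<Sum>k<n. (u k)\<^sup>2) / real n) \<le> (\<Sum>k<N. (u k)\<^sup>2) / real n"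
    using finite_support_energy[OF assms] by (auto intro!: divide_right_mono simp: sum_nonneg)
qed (rule lim_const_over_n)

lemma msq_null_cmult: "msq_null u \<Longrightarrow> msq_null (\<lambda>k. c * u k)"
  by (rule msq_null_squeeze[of u "c\<^sup>2"]) (auto simp: power_mult_distrib sum_distrib_left)

lemma msq_null_MA:
  "summable (\<lambda>m. \<bar>g m\<bar>) \<Longrightarrow> msq_null u \<Longrightarrow> msq_null (\<lambda>k. \<Sum>m\<le>k. g m * u (k - m))"
  by (rule msq_null_squeeze[of u "(\<Sum>m. \<bar>g m\<bar>)\<^sup>2"]) (use young_l1_l2 in auto)

text \<open>A shift along integer time differs from the zero-padded \<open>lag\<close> only at the
  first \<open>j\<close> instants, where initial values enter with finite energy.\<close>

lemma int_lag_split: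
  fixes f :: "int \<Rightarrow> real"
  shows "f (int k - int j) = lag j (\<lambda>k. f (int k)) k + (if k < j then f (int k - int j) else 0)"
  by (auto simp: lag_def of_nat_diff)

lemma energy_dom_int_lag:
  fixes f :: "int \<Rightarrow> real"
  assumes "energy_dom R (\<lambda>k. f (int k))" "\<And>n. 0 \<le> R n"
  shows "energy_dom R (\<lambda>k. f (int k - int j))"
  by (subst int_lag_split) (intro energy_dom_add energy_dom_lag assms energy_dom_finite_support[of j], auto)

lemma msq_null_int_lag:
  fixes f :: "int \<Rightarrow> real"
  assumes "msq_null (\<lambda>k. f (int k))"
  shows "msq_null (\<lambda>k. f (int k - int j))"
  by (subst int_lag_split) (intro msq_null_add msq_null_lag assms msq_null_finite_support[of j], auto)

lemma msq_null_bound: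
  assumes "\<And>\<eta>. 0 < \<eta> \<Longrightarrow> \<exists>C. \<forall>n. (\<Sum>k<n. (u k)\<^sup>2) \<le> C + \<eta> * real n"
  shows "msq_null u"
  unfolding msq_null_def
proof (rule LIMSEQ_I)
  fix r :: real assume r: "0 < r"
  obtain C where C: "\<And>n. (\<Sum>k<n. (u k)\<^sup>2) \<le> C + r / 2 * real n" using assms[of "r / 2"] r by auto
  obtain N where N: "2 * C / r < real N" using reals_Archimedean2 by blast
  have "norm ((\<Sum>k<n. (u k)\<^sup>2) / real n - 0) < r" if n: "n \<ge> Suc N" for n
  proof -
    have "2 * C / r < real n" using N n by linarith
    then have "C < r / 2 * real n" using r by (simp add: field_simps)
    then have "(\<Sum>k<n. (u k)\<^sup>2) < r * real n" using C[of n] by (simp add: field_simps)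
    moreover have "0 \<le> (\<Sum>k<n. (u k)\<^sup>2)" by (rule sum_nonneg) simp
    ultimately show ?thesis using n by (simp add: field_simps)
  qed
  then show "\<exists>no. \<forall>n\<ge>no. norm ((\<Sum>k<n. (u k)\<^sup>2) / real n - 0) < r" by blast
qed

lemma norm_power2_vec: "(norm v)\<^sup>2 = (\<Sum>c\<in>UNIV. (v $ c)\<^sup>2)" for v :: "real^'n"
  unfolding power2_norm_eq_inner inner_vec_def by (simp add: power2_eq_square)

lemma component_power2_le: "(v $ c)\<^sup>2 \<le> (norm v)\<^sup>2" for v :: "real^'n"
  using power_mono[OF component_le_norm_cart[of v c] abs_ge_zero, of 2] by simp

lemma transpose_diff: "transpose (M - N) = transpose M - transpose N"
  by (simp add: transpose_def vec_eq_iff)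

lemma norm_matrix_vector_le: "norm (M *v x) \<le> norm M * norm (x :: real^'n)" for M :: "real^'n^'m"
proof -
  have "norm (M *v x) \<le> L2_set (\<lambda>i. norm (M $ i) * norm x) UNIV"
    unfolding norm_vec_def[of "M *v x"]
    by (intro L2_set_mono) (auto simp: matrix_vector_mul_component intro: Cauchy_Schwarz_ineq2)
  also have "\<dots> = norm M * norm x" by (simp add: norm_vec_def[of M] L2_set_left_distrib)
  finally show ?thesis .
qed

text \<open>The quadratic form attains a positive minimum on the compact unit sphere; homogeneity
  extends the bound.\<close>

lemma pos_definite_lower_bound:
  fixes M :: "real^'n^'n"
  assumes "\<And>v. v \<noteq> 0 \<Longrightarrow> 0 < v \<bullet> (M *v v)"
  shows "\<exists>l>0. \<forall>v. l * (norm v)\<^sup>2 \<le> v \<bullet> (M *v v)"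
proof -
  have "continuous_on (sphere 0 1) (\<lambda>v. v \<bullet> (M *v v))"
    by (intro continuous_intros matrix_vector_mult_linear_continuous_on)
  moreover have "compact (sphere (0 :: real^'n) 1)" "sphere (0 :: real^'n) 1 \<noteq> {}" by auto
  ultimately obtain w where w: "w \<in> sphere 0 1" "\<And>v. v \<in> sphere 0 1 \<Longrightarrow> w \<bullet> (M *v w) \<le> v \<bullet> (M *v v)"
    using continuous_attains_inf[of "sphere 0 1" "\<lambda>v. v \<bullet> (M *v v)"] by blast
  define l where "l = w \<bullet> (M *v w)"
  have "0 < l" unfolding l_def using w(1) by (intro assms) auto
  moreover have "l * (norm v)\<^sup>2 \<le> v \<bullet> (M *v v)" for v
  proof (cases "v = 0")
    case False
    define u where "u = (1 / norm v) *\<^sub>R v"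
    have "u \<in> sphere 0 1" using False by (simp add: u_def)
    then have "l \<le> u \<bullet> (M *v u)" unfolding l_def by (rule w(2))
    also have "u \<bullet> (M *v u) = (v \<bullet> (M *v v)) / (norm v)\<^sup>2"
      by (simp add: u_def matrix_vector_mult_scaleR power2_eq_square)
    finally show ?thesis using False by (simp add: field_simps)
  qed simp
  ultimately show ?thesis by blast
qed

lemma arx_param_mult:
  fixes \<Phi> :: "real^(('p::{finite,linorder} \<times> 'd::finite) + ('q::{finite,linorder} \<times> 'd))" and A B :: "nat \<Rightarrow> real^'d^'d"
  assumes "\<And>i b. \<Phi> $ Inl (i, b) = X (int (pos i)) $ b" "\<And>i b. \<Phi> $ Inr (i, b) = U (int (pos i)) $ b"
  shows "transpose (arx_param A B) *v \<Phi> = (\<Sum>j=1..CARD('p). A j *v X (int j)) + (\<Sum>j=1..CARD('q). B j *v U (int j))"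
proof -
  have "(transpose (arx_param A B) *v \<Phi>) $ c
      = ((\<Sum>j=1..CARD('p). A j *v X (int j)) + (\<Sum>j=1..CARD('q). B j *v U (int j))) $ c" for c
  proof -
    have "(transpose (arx_param A B) *v \<Phi>) $ c
       = (\<Sum>i\<in>(UNIV::'p set). \<Sum>b\<in>UNIV. A (pos i) $ c $ b * X (int (pos i)) $ b)
       + (\<Sum>i\<in>(UNIV::'q set). \<Sum>b\<in>UNIV. B (pos i) $ c $ b * U (int (pos i)) $ b)"
      by (simp add: matrix_vector_mult_def arx_param_def transpose_def sum_block assms)
    also have "(\<Sum>i\<in>(UNIV::'p set). \<Sum>b\<in>UNIV. A (pos i) $ c $ b * X (int (pos i)) $ b) = (\<Sum>j=1..CARD('p). (A j *v X (int j)) $ c)"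
      using sum_pos[where 'a='p and f="\<lambda>j. (A j *v X (int j)) $ c"] by (simp add: matrix_vector_mult_def)
    also have "(\<Sum>i\<in>(UNIV::'q set). \<Sum>b\<in>UNIV. B (pos i) $ c $ b * U (int (pos i)) $ b) = (\<Sum>j=1..CARD('q). (B j *v U (int j)) $ c)"
      using sum_pos[where 'a='q and f="\<lambda>j. (B j *v U (int j)) $ c"] by (simp add: matrix_vector_mult_def)
    finally show ?thesis by simp
  qed
  then show ?thesis by (simp add: vec_eq_iff)
qed

section \<open>The closed loop\<close>

text \<open>One path outside the exceptional null set. \<open>e\<close> is the noise with its value
  at time 0 reset, since the assumptions on the noise begin at time 1. \<open>sq_noise\<close> is an
  implication because summability of the weights is itself derived path by path.\<close>

locale closed_loop = causal_arx p q A B for p q :: nat and A B :: "nat \<Rightarrow> real^'d^'d" +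
  fixes X U :: "int \<Rightarrow> real^'d" and \<epsilon> x :: "nat \<Rightarrow> real^'d" and \<Gamma> :: "real^'d^'d" and \<gamma> :: real
    and \<theta> :: "real^'d^(('p::{finite,linorder} \<times> 'd) + ('q::{finite,linorder} \<times> 'd))"
    and th :: "nat \<Rightarrow> real^'d^(('p \<times> 'd) + ('q \<times> 'd))"
    and \<Phi> :: "nat \<Rightarrow> real^(('p \<times> 'd) + ('q \<times> 'd))"
    and a :: "nat \<Rightarrow> real"
    and \<pi> :: "nat \<Rightarrow> real^'d" and e :: "nat \<Rightarrow> real^'d" and s :: "nat \<Rightarrow> real"
  assumes p_def: "p = CARD('p)" and q_def: "q = CARD('q)"
    and \<theta>_def: "\<theta> = arx_param A B"
    and \<Phi>_Inl: "\<And>n i b. \<Phi> n $ Inl (i, b) = X (int n - int (pos i) + 1) $ b"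
    and \<Phi>_Inr: "\<And>n i b. \<Phi> n $ Inr (i, b) = U (int n - int (pos i)) $ b"
    and \<pi>_def: "\<And>n. \<pi> n = transpose (\<theta> - th n) *v \<Phi> n"
    and e_def: "\<And>n. e n = (if n = 0 then 0 else \<epsilon> n)"
    and s_def: "\<And>n. s n = (\<Sum>k\<le>n. (norm (\<Phi> k))\<^sup>2)"
    and model: "\<And>n. X (int (Suc n)) = transpose \<theta> *v \<Phi> n + U (int n) + \<epsilon> (Suc n)"
    and th_step: "\<And>n. th (Suc n) = th n + a n *\<^sub>R
        outer (wls_gain a \<Phi> n) (X (int (Suc n)) - U (int n) - transpose (th n) *v \<Phi> n)"
    and control: "\<And>n. U (int n) = x (Suc n) - transpose (th n) *v \<Phi> n"
    and a_nonneg: "\<And>n. 0 \<le> a n"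
    and weight: "\<And>n. 1 < s n \<Longrightarrow> a n = (1 / ln (s n)) powr (1 + \<gamma>)"
    and gamma: "0 < \<gamma>"
    and Gamma_pd: "pos_definite \<Gamma>"
    and Gamma_n: "(\<lambda>n. avg_outer \<epsilon> n) \<longlonglongrightarrow> \<Gamma>"
    and x_small: "(\<lambda>n. \<Sum>k=1..n. (norm (x k))\<^sup>2) \<in> o(\<lambda>n. real n)"
    and sn_output: "\<And>c. self_normalized (\<lambda>k. x (Suc k) $ c + \<pi> k $ c) (\<lambda>k. \<epsilon> (Suc k) $ c)"
    and sn_lyapunov: "\<And>c. self_normalized (\<lambda>k. a k * (1 - leverage a \<Phi> k) * \<pi> k $ c) (\<lambda>k. \<epsilon> (Suc k) $ c)"
    and sn_noise: "\<And>j b c. self_normalized (lag j (\<lambda>k. e k $ b)) (\<lambda>k. \<epsilon> (Suc k) $ c)"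
    and sn_prediction: "\<And>b c. self_normalized (\<lambda>k. \<pi> k $ b) (\<lambda>k. \<epsilon> (Suc k) $ c)"
    and sq_noise: "\<And>c. summable (\<lambda>k. a k * leverage a \<Phi> k) \<Longrightarrow>
       summable (\<lambda>k. a k * leverage a \<Phi> k * (\<epsilon> (Suc k) $ c)\<^sup>2)"
begin

section \<open>Output equation and linear growth of the regressor energy\<close>

lemma output_eq: "X (int (Suc n)) = x (Suc n) + \<pi> n + \<epsilon> (Suc n)"
  unfolding model \<pi>_def transpose_diff matrix_vector_mult_diff_rdistrib control by simp

lemma innovation: "X (int (Suc n)) - U (int n) - transpose (th n) *v \<Phi> n = \<pi> n + \<epsilon> (Suc n)"
  unfolding output_eq control by simp

lemma e_Suc: "e (Suc k) = \<epsilon> (Suc k)" and e_0: "e 0 = 0"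
  by (auto simp: e_def)

lemma avg_e: "avg_outer e n = avg_outer \<epsilon> n"
  unfolding avg_outer_def by (simp add: e_def)

lemma Gamma_sym: "\<Gamma> $ b $ c = \<Gamma> $ c $ b"
  using Gamma_pd unfolding pos_definite_def by (metis transpose_def vec_lambda_beta)

lemma sn_noise': "self_normalized (lag j (\<lambda>k. e k $ b)) (\<lambda>k. e (Suc k) $ c)"
  using sn_noise by (simp add: e_Suc)

lemma e_bounded: "msq_bounded (\<lambda>k. e k $ b)"
  using noise_covariance(1)[OF _ e_0 sn_noise'] Gamma_n by (simp add: avg_e)

lemma e_cov: "acov (lag l (\<lambda>k. e k $ b)) (lag m (\<lambda>k. e k $ c)) (if l = m then \<Gamma> $ b $ c else 0)"
  using noise_covariance(2)[OF _ e_0 sn_noise'] Gamma_n by (simp add: avg_e)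

lemma x_null: "msq_null (\<lambda>k. x (Suc k) $ c)"
proof -
  have "(\<lambda>n. (\<Sum>k=1..n. (norm (x k))\<^sup>2) / real n) \<longlonglongrightarrow> 0"
    using smalloD_tendsto[OF x_small] .
  then have lim: "(\<lambda>n. (\<Sum>k<n. (norm (x (Suc k)))\<^sup>2) / real n) \<longlonglongrightarrow> 0"
    by (simp add: sum.atLeast1_atMost_eq)
  then have "msq_null (\<lambda>k. norm (x (Suc k)))" unfolding msq_null_def .
  then show ?thesis by (rule msq_null_mono) (simp add: component_le_norm_cart)
qed

text \<open>One output coordinate is enough. Its predictable part cannot cancel the noise, because
  the cross term is small against the energy of that part; so the output keeps at least the energy
  of the noise up to a constant.\<close>

lemma s_lower: "\<exists>c>0. \<exists>N. \<forall>n\<ge>N. c * real n \<le> s n"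
proof -
  fix c :: 'd
  let ?e = "\<lambda>k. \<epsilon> (Suc k) $ c" and ?w = "\<lambda>k. x (Suc k) $ c + \<pi> k $ c"
  have "0 < axis c 1 \<bullet> (\<Gamma> *v axis c 1)"
    using Gamma_pd unfolding pos_definite_def by (auto simp: axis_eq_0_iff)
  then have g: "0 < \<Gamma> $ c $ c"
    by (simp add: inner_axis' matrix_vector_mul_component inner_axis)
  \<comment> \<open>The cross term enters doubled, so the value 1/4 costs only half of the energy of
    \<open>?w\<close>.\<close>
  have "(0 :: real) < 1 / 4" by simp
  then obtain C where C: "\<And>n. \<bar>\<Sum>k<n. ?w k * ?e k\<bar> \<le> C + 1 / 4 * (\<Sum>k<n. (?w k)\<^sup>2)"
    using sn_output[of c] unfolding self_normalized_def by blast
  have "(\<lambda>n. avg_outer \<epsilon> n $ c $ c) \<longlonglongrightarrow> \<Gamma> $ c $ c" by (intro tendsto_intros Gamma_n)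
  then have "(\<lambda>n. (\<Sum>k<n. (?e k)\<^sup>2) / real n) \<longlonglongrightarrow> \<Gamma> $ c $ c"
    by (simp add: avg_outer_def outer_def sum.atLeast1_atMost_eq power2_eq_square)
  then have "(\<lambda>n. (\<Sum>k<n. (?e k)\<^sup>2) / real n - 2 * C / real n) \<longlonglongrightarrow> \<Gamma> $ c $ c - 0"
    by (intro tendsto_diff lim_const_over_n)
  then have "eventually (\<lambda>n. \<Gamma> $ c $ c / 2 < (\<Sum>k<n. (?e k)\<^sup>2) / real n - 2 * C / real n) sequentially"
    using g by (intro order_tendstoD) auto
  then obtain N where N: "\<And>n. n \<ge> N \<Longrightarrow> \<Gamma> $ c $ c / 2 < (\<Sum>k<n. (?e k)\<^sup>2) / real n - 2 * C / real n"
    unfolding eventually_sequentially by blast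
  \<comment> \<open>The first block of the regressor is the most recent output.\<close>
  obtain i :: 'p where i: "pos i = 1" by (rule pos_obtain[of 1]) (auto simp: Suc_le_eq)
  have "\<Gamma> $ c $ c / 2 * real n \<le> s n" if n: "n \<ge> Suc N" for n
  proof -
    have "\<Gamma> $ c $ c / 2 * real n \<le> (\<Sum>k<n. (?e k)\<^sup>2) - 2 * C"
    proof -
      have "\<Gamma> $ c $ c / 2 \<le> ((\<Sum>k<n. (?e k)\<^sup>2) - 2 * C) / real n"
        using N[of n] n by (simp add: diff_divide_distrib)
      then show ?thesis using n by (simp add: pos_le_divide_eq)
    qed
    also have "\<dots> \<le> (\<Sum>k<n. (?w k)\<^sup>2) + 2 * (\<Sum>k<n. ?w k * ?e k) + (\<Sum>k<n. (?e k)\<^sup>2)"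
    proof -
      have "0 \<le> (\<Sum>k<n. (?w k)\<^sup>2)" by (rule sum_nonneg) simp
      then show ?thesis using C[of n] by linarith
    qed
    also have "\<dots> = (\<Sum>k<n. (X (int (Suc k)) $ c)\<^sup>2)"
      unfolding output_eq by (simp add: power2_sum sum.distrib sum_distrib_left mult.assoc algebra_simps power2_eq_square)
    also have "\<dots> \<le> (\<Sum>k<n. (norm (\<Phi> (Suc k)))\<^sup>2)"
    proof (rule sum_mono)
      fix k
      have "X (int (Suc k)) $ c = \<Phi> (Suc k) $ Inl (i, c)" by (simp add: \<Phi>_Inl i add.commute)
      then show "(X (int (Suc k)) $ c)\<^sup>2 \<le> (norm (\<Phi> (Suc k)))\<^sup>2" using component_power2_le by metis
    qed
    also have "\<dots> \<le> s n" unfolding s_def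
      by (subst sum.atMost_shift) (simp add: lessThan_Suc_atMost)
    finally show ?thesis .
  qed
  then show ?thesis using g by (intro exI[of _ "\<Gamma> $ c $ c / 2"]) auto
qed

lemma s_top: "filterlim s at_top sequentially"
proof -
  obtain c N where c: "0 < c" "\<And>n. n \<ge> N \<Longrightarrow> c * real n \<le> s n" using s_lower by blast
  have "filterlim (\<lambda>n. c * real n) at_top sequentially" using c(1) by real_asymp
  then show ?thesis
    by (rule filterlim_at_top_mono) (use c(2) in \<open>auto simp: eventually_sequentially\<close>)
qed

section \<open>Prediction energy and the upper bound on the regressor energy\<close>

sublocale W: wls_path a \<Phi> \<gamma> s
  by unfold_locales (use a_nonneg s_def weight gamma s_top in auto)

text \<open>A column of the estimation error, so that the noise is handled one scalar component at a
  time. With the sign \<open>th - \<theta>\<close>, the prediction error is minus the inner product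
  with the regressor.\<close>

definition col :: "nat \<Rightarrow> 'd \<Rightarrow> real^(('p \<times> 'd) + ('q \<times> 'd))" where
  "col n c = (\<chi> r. (th n - \<theta>) $ r $ c)"

lemma col_inner: "- (col n c \<bullet> \<Phi> n) = \<pi> n $ c"
  by (simp add: col_def \<pi>_def inner_vec_def matrix_vector_mult_def transpose_def sum_negf[symmetric] algebra_simps
      sum_subtractf)

lemma col_step: "col (Suc n) c = col n c + (a n * (\<epsilon> (Suc n) $ c - col n c \<bullet> \<Phi> n)) *\<^sub>R wls_gain a \<Phi> n"
proof -
  have "\<epsilon> (Suc n) $ c - col n c \<bullet> \<Phi> n = (\<pi> n + \<epsilon> (Suc n)) $ c" using col_inner[of n c] by simp
  moreover have "th (Suc n) = th n + a n *\<^sub>R outer (wls_gain a \<Phi> n) (\<pi> n + \<epsilon> (Suc n))"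
    unfolding th_step innovation ..
  ultimately show ?thesis by (simp add: vec_eq_iff col_def outer_def)
qed

lemma lyapunov_bounded: "\<exists>C. \<forall>n. col n c \<bullet> (wls_T a \<Phi> n *v col n c) \<le> C"
  and discounted_prediction: "summable (\<lambda>n. a n * (1 - leverage a \<Phi> n) * (\<pi> n $ c)\<^sup>2)"
  using W.column_bounded[of "\<lambda>n. col n c" "\<lambda>n. \<epsilon> (Suc n) $ c", OF col_step] sn_lyapunov[of c]
    sq_noise[OF W.leverage_summable, of c] by (simp_all add: col_inner)

lemma prediction_energy:
  assumes "0 < \<eta>"
  shows "\<exists>C. \<forall>n. (\<Sum>k\<le>n. (norm (\<pi> k))\<^sup>2) \<le> C + \<eta> * s n"
proof -
  define \<eta>' where "\<eta>' = \<eta> / real CARD('d)"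
  have \<eta>': "0 < \<eta>'" "real CARD('d) * \<eta>' = \<eta>" using assms by (auto simp: \<eta>'_def)
  have "\<forall>c. \<exists>C. \<forall>n. (\<Sum>k\<le>n. (\<pi> k $ c)\<^sup>2) \<le> C + \<eta>' * s n"
    using W.prediction_energy_small[OF discounted_prediction \<eta>'(1)] by blast
  then obtain C where C: "\<And>c n. (\<Sum>k\<le>n. (\<pi> k $ c)\<^sup>2) \<le> C c + \<eta>' * s n" by metis
  have "(\<Sum>k\<le>n. (norm (\<pi> k))\<^sup>2) \<le> (\<Sum>c\<in>UNIV. C c) + \<eta> * s n" for n
  proof -
    have "(\<Sum>k\<le>n. (norm (\<pi> k))\<^sup>2) = (\<Sum>c\<in>UNIV. \<Sum>k\<le>n. (\<pi> k $ c)\<^sup>2)"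
      by (subst sum.swap) (simp add: norm_power2_vec)
    also have "\<dots> \<le> (\<Sum>c\<in>UNIV. C c + \<eta>' * s n)" by (intro sum_mono C)
    also have "\<dots> = (\<Sum>c\<in>UNIV. C c) + \<eta> * s n" using \<eta>'(2) by (simp add: sum.distrib mult.assoc[symmetric])
    finally show ?thesis .
  qed
  then show ?thesis by blast
qed

text \<open>Reference energy for all signals while the growth of \<open>s\<close> is unknown:
  \<open>real n\<close> covers noise and reference trajectory, the sum covers the prediction
  errors.\<close>

definition R :: "nat \<Rightarrow> real" where "R n = real n + (\<Sum>k<n. (norm (\<pi> k))\<^sup>2)"

lemma R_nonneg: "0 \<le> R n" by (simp add: R_def sum_nonneg)

lemma dom_msq:
  assumes "msq_bounded u" shows "energy_dom R u"
proof -
  obtain C where C: "0 \<le> C" "\<And>n. (\<Sum>k<n. (u k)\<^sup>2) \<le> C * real n" using assms unfolding msq_bounded_def by blast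
  show ?thesis
  proof (rule energy_domI[OF C(1)])
    fix n
    have "C * real n \<le> C * (1 + R n)" using C(1) by (intro mult_left_mono) (auto simp: R_def sum_nonneg add_nonneg_nonneg intro: order_trans[of _ "1 + real n"])
    then show "(\<Sum>k<n. (u k)\<^sup>2) \<le> C * (1 + R n)" using C(2)[of n] by linarith
  qed
qed

lemma dom_\<pi>: "energy_dom R (\<lambda>k. \<pi> k $ c)"
proof (rule energy_domI[of 1])
  fix n
  have "(\<Sum>k<n. (\<pi> k $ c)\<^sup>2) \<le> (\<Sum>k<n. (norm (\<pi> k))\<^sup>2)"
    by (intro sum_mono component_power2_le)
  then show "(\<Sum>k<n. (\<pi> k $ c)\<^sup>2) \<le> 1 * (1 + R n)" by (simp add: R_def)
qed simp

lemma \<epsilon>_bounded: "msq_bounded (\<lambda>k. \<epsilon> (Suc k) $ c)"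
proof -
  have "(\<lambda>n. avg_outer \<epsilon> n $ c $ c) \<longlonglongrightarrow> \<Gamma> $ c $ c" by (intro tendsto_intros Gamma_n)
  then have "acov (\<lambda>k. \<epsilon> (Suc k) $ c) (\<lambda>k. \<epsilon> (Suc k) $ c) (\<Gamma> $ c $ c)"
    unfolding acov_def by (simp add: avg_outer_def outer_def sum.atLeast1_atMost_eq)
  then show ?thesis by (rule acov_imp_msq_bounded)
qed

lemma dom_X_Suc: "energy_dom R (\<lambda>k. X (int (Suc k)) $ c)"
  unfolding output_eq vector_add_component
  by (intro energy_dom_add dom_\<pi> dom_msq \<epsilon>_bounded msq_null_imp_bounded x_null)

text \<open>The input is the image of the forcing under the stable filter \<open>B(R)\<inverse>\<close>; the forcing \<open>forcing\<close> also carries the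
  initial inputs.\<close>

definition forcing :: "nat \<Rightarrow> real^'d" where
  "forcing n = X (int (Suc n)) - \<epsilon> (Suc n) - (\<Sum>j=1..p. A j *v X (int n - int j + 1))
     - (\<Sum>j=1..q. if j \<le> n then 0 else B j *v U (int n - int j))"

lemma input_recursion:
  "U (int n) + (\<Sum>j=1..q. if j \<le> n then B j *v U (int (n - j)) else 0) = forcing n"
proof -
  have "transpose \<theta> *v \<Phi> n = (\<Sum>j=1..p. A j *v X (int n - int j + 1)) + (\<Sum>j=1..q. B j *v U (int n - int j))"
    unfolding \<theta>_def p_def q_def
    using arx_param_mult[of "\<Phi> n" "\<lambda>k. X (int n - k + 1)" "\<lambda>k. U (int n - k)" A B] by (simp add: \<Phi>_Inl \<Phi>_Inr)
  moreover have "(\<Sum>j=1..q. B j *v U (int n - int j))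
      = (\<Sum>j=1..q. if j \<le> n then B j *v U (int (n - j)) else 0) + (\<Sum>j=1..q. if j \<le> n then 0 else B j *v U (int n - int j))"
    unfolding sum.distrib[symmetric] by (intro sum.cong refl) (auto simp: of_nat_diff)
  ultimately show ?thesis using model[of n] unfolding forcing_def by (simp del: of_nat_Suc)
qed

lemma input_solution: "U (int n) = (\<Sum>m\<le>n. E m *v forcing (n - m))"
proof -
  have "U (int n) = (\<Sum>m\<le>n. E (n - m) *v forcing m)"
    by (rule recursion_solution[of "\<lambda>n. U (int n)"]) (rule input_recursion)
  also have "\<dots> = (\<Sum>m\<le>n. E m *v forcing (n - m))"
    by (rule sum.reindex_bij_witness[of _ "\<lambda>m. n - m" "\<lambda>m. n - m"]) auto
  finally show ?thesis .
qed

lemma dom_X: "energy_dom R (\<lambda>k. X (int k) $ c)"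
proof -
  have "(\<lambda>k. X (int k) $ c) = (\<lambda>k. lag 1 (\<lambda>k. X (int (Suc k)) $ c) k + (if k = 0 then X 0 $ c else 0))"
    by (auto simp: lag_def fun_eq_iff)
  then show ?thesis
    by (simp only:) (intro energy_dom_add energy_dom_lag dom_X_Suc energy_dom_finite_support[of 1] R_nonneg, auto)
qed

text \<open>The forcing is built from outputs, noise and initial values, all dominated by
  \<open>R\<close>, and convolution with the summable impulse response preserves domination.\<close>

lemma dom_U: "energy_dom R (\<lambda>k. U (int k) $ c)"
proof -
  have X: "energy_dom R (\<lambda>n. X (int n - int j + 1) $ b)" if "1 \<le> j" for j b
  proof -
    have eq: "int n - int j + 1 = int n - int (j - 1)" for n using that by simp
    show ?thesis unfolding eq by (rule energy_dom_int_lag[of R "\<lambda>k. X k $ b", OF dom_X R_nonneg])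
  qed
  have AX: "energy_dom R (\<lambda>n. (\<Sum>j=1..p. A j *v X (int n - int j + 1)) $ b)" for b
    unfolding sum_component matrix_vector_mult_def vec_lambda_beta
    by (intro energy_dom_sum R_nonneg energy_dom_cmult X) auto
  have BU: "energy_dom R (\<lambda>n. (\<Sum>j=1..q. if j \<le> n then 0 else B j *v U (int n - int j)) $ b)" for b
    by (rule energy_dom_finite_support[of q, OF _ R_nonneg]) (auto simp: sum_component intro!: sum.neutral)
  have neg: "energy_dom R (\<lambda>n. - u n)" if "energy_dom R u" for u using energy_dom_cmult[OF that, of "-1"] by simp
  have eq: "forcing n $ b = X (int (Suc n)) $ b + - (\<epsilon> (Suc n) $ b) + - ((\<Sum>j=1..p. A j *v X (int n - int j + 1)) $ b)
     + - ((\<Sum>j=1..q. if j \<le> n then 0 else B j *v U (int n - int j)) $ b)" for n b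
    unfolding forcing_def vector_minus_component by simp
  have "energy_dom R (\<lambda>n. forcing n $ b)" for b
    unfolding eq
    by (intro energy_dom_add neg AX BU dom_X_Suc dom_msq \<epsilon>_bounded)
  then show ?thesis
    unfolding input_solution MA_component
    by (intro energy_dom_sum R_nonneg energy_dom_MA E_abs_summable) auto
qed

lemma s_le_R: "\<exists>C\<ge>0. \<forall>n. s n \<le> C * (1 + R n)"
proof -
  \<comment> \<open>The delay matters: the regressor at \<open>n\<close> contains outputs up to
    \<open>n\<close> and inputs up to \<open>n - 1\<close>, hence prediction errors only up to
    \<open>n - 1\<close>. So \<open>s n\<close>, a sum of \<open>n + 1\<close> terms, is bounded
    through \<open>R n\<close>.\<close>
  let ?R' = "\<lambda>n. R (n - 1)"
  have lag1: "energy_dom ?R' (lag 1 u)" if "energy_dom R u" for u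
  proof -
    from that obtain C where C: "0 \<le> C" "\<And>n. (\<Sum>k<n. (u k)\<^sup>2) \<le> C * (1 + R n)" unfolding energy_dom_def by blast
    have "(\<Sum>k<n. (lag 1 u k)\<^sup>2) = (\<Sum>k<n - 1. (u k)\<^sup>2)" for n
      unfolding sum_lag[of 1 "\<lambda>k. (u k)\<^sup>2" n, symmetric] by (rule sum.cong[OF refl]) (rule lag_power2)
    then have "(\<Sum>k<n. (lag 1 u k)\<^sup>2) \<le> C * (1 + R (n - 1))" for n
      using C(2)[of "n - 1"] by (simp only:)
    then show ?thesis using C(1) unfolding energy_dom_def by blast
  qed
  have R'0: "0 \<le> ?R' n" for n by (rule R_nonneg)
  have "energy_dom ?R' (\<lambda>k. \<Phi> k $ r)" for r
  proof (cases r)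
    case (Inl ib)
    obtain i b where ib: "ib = (i, b)" by fastforce
    have "(\<lambda>k. X (int k) $ b) = (\<lambda>k. lag 1 (\<lambda>k. X (int (Suc k)) $ b) k + (if k = 0 then X 0 $ b else 0))"
      by (auto simp: lag_def fun_eq_iff)
    then have 1: "energy_dom ?R' (\<lambda>k. X (int k) $ b)"
      by (simp only:) (intro energy_dom_add lag1 dom_X_Suc energy_dom_finite_support[of 1] R'0, auto)
    have eq: "int k - int (pos i) + 1 = int k - int (pos i - 1)" for k using pos_ge_1[of i] by simp
    show ?thesis unfolding Inl ib \<Phi>_Inl eq
      by (rule energy_dom_int_lag[of ?R' "\<lambda>k. X k $ b", OF 1 R'0])
  next
    case (Inr ib)
    obtain i b where ib: "ib = (i, b)" by fastforce
    have "(\<lambda>k. U (int k - 1) $ b) = (\<lambda>k. lag 1 (\<lambda>k. U (int k) $ b) k + (if k = 0 then U (- 1) $ b else 0))"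
      by (auto simp: lag_def fun_eq_iff of_nat_diff)
    then have 1: "energy_dom ?R' (\<lambda>k. U (int k - 1) $ b)"
      by (simp only:) (intro energy_dom_add lag1 dom_U energy_dom_finite_support[of 1] R'0, auto)
    have eq: "int k - int (pos i) = int k - int (pos i - 1) - 1" for k using pos_ge_1[of i] by simp
    show ?thesis unfolding Inr ib \<Phi>_Inr eq
      by (rule energy_dom_int_lag[of ?R' "\<lambda>k. U (k - 1) $ b", OF 1 R'0])
  qed
  then have "\<forall>r. \<exists>C\<ge>0. \<forall>n. (\<Sum>k<n. (\<Phi> k $ r)\<^sup>2) \<le> C * (1 + ?R' n)" unfolding energy_dom_def by blast
  then obtain C where C: "\<And>r. 0 \<le> C r" "\<And>r n. (\<Sum>k<n. (\<Phi> k $ r)\<^sup>2) \<le> C r * (1 + ?R' n)" by metis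
  have "s n \<le> (\<Sum>r\<in>UNIV. C r) * (1 + R n)" for n
  proof -
    have "s n = (\<Sum>r\<in>UNIV. \<Sum>k<Suc n. (\<Phi> k $ r)\<^sup>2)" unfolding s_def lessThan_Suc_atMost
      by (subst sum.swap) (simp add: norm_power2_vec)
    also have "\<dots> \<le> (\<Sum>r\<in>UNIV. C r * (1 + ?R' (Suc n)))" by (intro sum_mono C)
    finally show ?thesis by (simp add: sum_distrib_right)
  qed
  then show ?thesis using C(1) by (intro exI[of _ "\<Sum>r\<in>UNIV. C r"]) (auto intro: sum_nonneg)
qed

lemma s_upper: "\<exists>K\<ge>0. \<forall>n. s n \<le> K * (1 + real n)"
proof -
  obtain C where C: "0 \<le> C" "\<And>n. s n \<le> C * (1 + R n)" using s_le_R by blast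
  \<comment> \<open>With \<open>C * \<eta> \<le> 1 / 2\<close> the prediction energy contributes at
    most half of \<open>s n\<close>, which moves to the left-hand side. This closes the feedback
    loop.\<close>
  define \<eta> where "\<eta> = 1 / (2 * (C + 1))"
  have \<eta>: "0 < \<eta>" "C * \<eta> \<le> 1 / 2" using C(1) by (auto simp: \<eta>_def field_simps)
  obtain D where D: "\<And>n. (\<Sum>k\<le>n. (norm (\<pi> k))\<^sup>2) \<le> D + \<eta> * s n" using prediction_energy[OF \<eta>(1)] by blast
  have "s n \<le> 2 * C * (1 + \<bar>D\<bar>) * (1 + real n)" for n
  proof -
    have "(\<Sum>k<n. (norm (\<pi> k))\<^sup>2) \<le> (\<Sum>k\<le>n. (norm (\<pi> k))\<^sup>2)" by (rule sum_mono2) auto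
    then have "1 + R n \<le> (1 + \<bar>D\<bar>) * (1 + real n) + \<eta> * s n"
    proof -
      have "0 \<le> \<bar>D\<bar> * real n" by simp
      then have "1 + real n + \<bar>D\<bar> \<le> (1 + \<bar>D\<bar>) * (1 + real n)" by (simp add: algebra_simps)
      with D[of n] \<open>(\<Sum>k<n. (norm (\<pi> k))\<^sup>2) \<le> _\<close> show ?thesis unfolding R_def by linarith
    qed
    then have "s n \<le> C * ((1 + \<bar>D\<bar>) * (1 + real n) + \<eta> * s n)" using C mult_left_mono order_trans by meson
    also have "\<dots> = C * (1 + \<bar>D\<bar>) * (1 + real n) + (C * \<eta>) * s n" by (simp add: algebra_simps)
    also have "\<dots> \<le> C * (1 + \<bar>D\<bar>) * (1 + real n) + 1 / 2 * s n"
      using \<eta>(2) W.s_nonneg by (intro add_left_mono mult_right_mono)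
    finally show ?thesis by simp
  qed
  then show ?thesis using C(1) by (intro exI[of _ "2 * C * (1 + \<bar>D\<bar>)"]) auto
qed

text \<open>Smallness relative to \<open>s\<close> becomes smallness relative to \<open>n\<close>,
  now that \<open>s\<close> grows at most linearly.\<close>

lemma \<pi>_null: "msq_null (\<lambda>k. \<pi> k $ c)"
proof (rule msq_null_bound)
  fix \<eta> :: real assume \<eta>: "0 < \<eta>"
  obtain K where K: "0 \<le> K" "\<And>n. s n \<le> K * (1 + real n)" using s_upper by blast
  define \<eta>' where "\<eta>' = \<eta> / (K + 1)"
  have \<eta>': "0 < \<eta>'" "\<eta>' * K \<le> \<eta>" using \<eta> K(1) by (auto simp: \<eta>'_def field_simps)
  obtain D where D: "\<And>n. (\<Sum>k\<le>n. (norm (\<pi> k))\<^sup>2) \<le> D + \<eta>' * s n" using prediction_energy[OF \<eta>'(1)] by blast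
  have "(\<Sum>k<n. (\<pi> k $ c)\<^sup>2) \<le> (D + \<eta>) + \<eta> * real n" for n
  proof -
    have "(\<Sum>k<n. (\<pi> k $ c)\<^sup>2) \<le> (\<Sum>k<n. (norm (\<pi> k))\<^sup>2)"
      by (intro sum_mono component_power2_le)
    also have "\<dots> \<le> (\<Sum>k\<le>n. (norm (\<pi> k))\<^sup>2)" by (rule sum_mono2) auto
    also have "\<dots> \<le> D + \<eta>' * (K * (1 + real n))" using D[of n] K(2)[of n] \<eta>'(1) by (smt (verit) mult_left_mono)
    also have "\<dots> \<le> D + \<eta> * (1 + real n)" using \<eta>'(2) by (simp add: mult.assoc[symmetric] mult_right_mono)
    finally show ?thesis by (simp add: algebra_simps)
  qed
  then show "\<exists>C. \<forall>n. (\<Sum>k<n. (\<pi> k $ c)\<^sup>2) \<le> C + \<eta> * real n" by blast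
qed

end

section \<open>The limit matrix\<close>

context causal_arx begin

lemma Pc_abs_summable: "summable (\<lambda>m. \<bar>Pc m $ b $ c\<bar>)"
proof -
  have s: "summable (\<lambda>i. (if j \<le> i then \<bar>E (i - j) $ b $ l\<bar> else 0) * \<bar>A j $ l $ c\<bar>)" for j l
  proof -
    have "summable (\<lambda>i. if j \<le> i + j then \<bar>E (i + j - j) $ b $ l\<bar> else 0)" using E_abs_summable by simp
    then show ?thesis by (intro summable_mult2) (subst (asm) summable_iff_shift)
  qed
  have "summable (\<lambda>i. \<Sum>j=1..p. \<Sum>l\<in>UNIV. (if j \<le> i then \<bar>E (i - j) $ b $ l\<bar> else 0) * \<bar>A j $ l $ c\<bar>)"
    by (intro summable_sum s)
  then show ?thesis
  proof (rule summable_comparison_test'[of _ 0])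
    fix i
    have "Pc i $ b $ c = - (\<Sum>j=1..p. \<Sum>l\<in>UNIV. (if j \<le> i then E (i - j) $ b $ l else 0) * A j $ l $ c)"
      unfolding Pc_def by (auto simp: matrix_matrix_mult_def if_distrib intro!: sum.cong cong: if_cong)
    also have "\<bar>\<dots>\<bar> \<le> (\<Sum>j=1..p. \<Sum>l\<in>UNIV. \<bar>(if j \<le> i then E (i - j) $ b $ l else 0) * A j $ l $ c\<bar>)"
      unfolding abs_minus_cancel by (rule order_trans[OF sum_abs]) (intro sum_mono sum_abs)
    also have "\<dots> = (\<Sum>j=1..p. \<Sum>l\<in>UNIV. (if j \<le> i then \<bar>E (i - j) $ b $ l\<bar> else 0) * \<bar>A j $ l $ c\<bar>)"
      by (intro sum.cong refl) (simp add: abs_mult)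
    finally show "norm \<bar>Pc i $ b $ c\<bar> \<le> (\<Sum>j=1..p. \<Sum>l\<in>UNIV. (if j \<le> i then \<bar>E (i - j) $ b $ l\<bar> else 0) * \<bar>A j $ l $ c\<bar>)" by simp
  qed
qed

text \<open>The left side filters the forcing with every output replaced by noise. The lags of
  \<open>A\<close> combine with \<open>E\<close> into the coefficients \<open>Pc\<close>, advanced
  by one step; truncated subtraction is harmless since \<open>e 0 = 0\<close>.\<close>

lemma filtered_noise:
  assumes e0: "e 0 = 0"
  shows "(\<Sum>m\<le>k. E m *v (- (\<Sum>j=1..p. A j *v e (Suc (k - m) - j)))) = (\<Sum>m\<le>k. Pc (Suc m) *v e (k - m))"
proof -
  have "(\<Sum>m\<le>k. Pc (Suc m) *v e (k - m)) = (\<Sum>i\<le>Suc k. Pc i *v e (Suc k - i))"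
    by (subst sum.atMost_Suc_shift) (simp add: Pc_0)
  also have "\<dots> = - (\<Sum>j=1..p. \<Sum>i\<le>Suc k. if j \<le> i then (E (i - j) ** A j) *v e (Suc k - i) else 0)"
  proof -
    have "Pc i *v y = - (\<Sum>j=1..p. if j \<le> i then (E (i - j) ** A j) *v y else 0)" for i y
    proof -
      have "Pc i *v y = - ((\<Sum>j=1..p. if j \<le> i then E (i - j) ** A j else 0) *v y)"
        unfolding Pc_def by (simp add: vec_eq_iff matrix_vector_mult_def sum_negf)
      also have "(\<Sum>j=1..p. if j \<le> i then E (i - j) ** A j else 0) *v y = (\<Sum>j=1..p. if j \<le> i then (E (i - j) ** A j) *v y else 0)"
        unfolding matrix_vector_mult_sum_left by (intro sum.cong) auto
      finally show ?thesis .
    qed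
    then have f1: "(\<Sum>i\<le>Suc k. Pc i *v e (Suc k - i)) = - (\<Sum>i\<le>Suc k. \<Sum>j=1..p. if j \<le> i then (E (i - j) ** A j) *v e (Suc k - i) else 0)"
      by (simp only: sum_negf)
    show ?thesis unfolding f1 by (subst sum.swap) (rule refl)
  qed
  also have "\<dots> = - (\<Sum>j=1..p. \<Sum>m\<le>k. (E m ** A j) *v e (Suc (k - m) - j))"
  proof (rule arg_cong[where f=uminus], rule sum.cong[OF refl])
    fix j assume j: "j \<in> {1..p}"
    have "(\<Sum>i\<le>Suc k. if j \<le> i then (E (i - j) ** A j) *v e (Suc k - i) else 0)
        = (\<Sum>i\<in>{j..<Suc k}. (E (i - j) ** A j) *v e (Suc k - i))"
      by (rule sum.mono_neutral_cong_right) (auto simp: e0 le_less)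
    also have "\<dots> = (\<Sum>m\<in>{..<Suc k - j}. (E m ** A j) *v e (Suc k - j - m))"
      by (rule sum.reindex_bij_witness[of _ "\<lambda>m. m + j" "\<lambda>i. i - j"]) auto
    also have "\<dots> = (\<Sum>m\<le>k. (E m ** A j) *v e (Suc (k - m) - j))"
    proof (rule sum.mono_neutral_cong_left)
      show "{..<Suc k - j} \<subseteq> {..k}" using j by auto
      show "\<forall>m\<in>{..k} - {..<Suc k - j}. (E m ** A j) *v e (Suc (k - m) - j) = 0"
      proof
        fix m assume "m \<in> {..k} - {..<Suc k - j}"
        then have "Suc (k - m) - j = 0" using j by auto
        then show "(E m ** A j) *v e (Suc (k - m) - j) = 0" by (simp only: e0) simp
      qed
      fix m assume "m \<in> {..<Suc k - j}"
      then have "Suc (k - m) - j = Suc k - j - m" using j by auto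
      then show "(E m ** A j) *v e (Suc k - j - m) = (E m ** A j) *v e (Suc (k - m) - j)" by (simp only:)
    qed simp
    finally show "(\<Sum>i\<le>Suc k. if j \<le> i then (E (i - j) ** A j) *v e (Suc k - i) else 0)
      = (\<Sum>m\<le>k. (E m ** A j) *v e (Suc (k - m) - j))" .
  qed
  also have "\<dots> = (\<Sum>m\<le>k. E m *v (- (\<Sum>j=1..p. A j *v e (Suc (k - m) - j))))"
    by (subst sum.swap) (simp add: linear_neg[OF matrix_vector_mul_linear] linear_sum[OF matrix_vector_mul_linear] matrix_vector_mul_assoc sum_negf)
  finally show ?thesis by simp
qed

end

section \<open>Approximation of the regressor by a moving average of the noise\<close>

context closed_loop begin

text \<open>Impulse response from noise to regressor. Output block \<open>i\<close> is nearly the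
  noise delayed by \<open>pos i - 1\<close>; input block \<open>i\<close> is nearly the moving
  average \<open>V\<close> delayed by \<open>pos i\<close>, and \<open>Pc 0 = 0\<close> cuts it off
  before that delay.\<close>

definition G :: "nat \<Rightarrow> real^'d^(('p \<times> 'd) + ('q \<times> 'd))" where
  "G m = (\<chi> r b. case r of Inl (i, c) \<Rightarrow> if c = b \<and> pos i = Suc m then 1 else 0
      | Inr (i, c) \<Rightarrow> Pc (Suc m - pos i) $ c $ b)"

lemma G_Inl: "G m $ Inl (i, c) $ b = (if c = b \<and> pos i = Suc m then 1 else 0)"
  by (simp add: G_def)

lemma G_Inr: "G m $ Inr (i, c) $ b = Pc (Suc m - pos i) $ c $ b"
  by (simp add: G_def)

lemma G_summable: "summable (\<lambda>m. \<bar>G m $ r $ b\<bar>)"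
proof (cases r)
  case (Inl ic)
  then obtain i c where r: "r = Inl (i, c)" by (cases ic) auto
  show ?thesis unfolding r by (rule summable_finite[of "{pos i - 1}"]) (auto simp: G_Inl)
next
  case (Inr ic)
  then obtain i c where r: "r = Inr (i, c)" by (cases ic) auto
  have "summable (\<lambda>m. \<bar>Pc (Suc m) $ c $ b\<bar>)" using Pc_abs_summable by (subst summable_Suc_iff)
  then have "summable (\<lambda>m. \<bar>G (m + pos i) $ r $ b\<bar>)" unfolding r G_Inr by (simp add: Suc_diff_le)
  then show ?thesis by (subst (asm) summable_iff_shift)
qed

definition Wm :: "nat \<Rightarrow> real^(('p \<times> 'd) + ('q \<times> 'd))" where
  "Wm n = (\<Sum>m\<le>n. G m *v e (n - m))"

lemma e_nat: "e (nat (int k - int j)) $ b = lag j (\<lambda>k. e k $ b) k"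
  by (simp add: lag_def nat_diff_distrib' e_0)

lemma X_error: "msq_null (\<lambda>k. X (int k - int j) $ c - e (nat (int k - int j)) $ c)"
proof (rule msq_null_int_lag[of "\<lambda>l. X l $ c - e (nat l) $ c"])
  have "X (int (Suc k)) $ c - e (nat (int (Suc k))) $ c = x (Suc k) $ c + \<pi> k $ c" for k
    unfolding output_eq by (simp add: e_def nat_int del: of_nat_Suc)
  then have "(\<lambda>k. X (int k) $ c - e (nat (int k)) $ c)
    = (\<lambda>k. lag 1 (\<lambda>k. x (Suc k) $ c + \<pi> k $ c) k + (if k = 0 then X 0 $ c - e 0 $ c else 0))"
    by (auto simp: lag_def fun_eq_iff gr0_conv_Suc simp del: of_nat_Suc)
  then show "msq_null (\<lambda>k. X (int k) $ c - e (nat (int k)) $ c)"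
    by (simp only:) (intro msq_null_add msq_null_lag x_null \<pi>_null msq_null_finite_support[of 1], auto)
qed

text \<open>With outputs replaced by noise, the model reads \<open>B U_n = (A - I) e_(n+1)\<close>
  in terms of the shift operator; the inverse filter gives this moving average.\<close>

definition V :: "nat \<Rightarrow> real^'d" where "V n = (\<Sum>m\<le>n. Pc (Suc m) *v e (n - m))"

lemma U_error: "msq_null (\<lambda>k. U (int k) $ c - V k $ c)"
proof -
  define g where "g n = - (\<Sum>j=1..p. A j *v e (Suc n - j))" for n
  have nat_eq: "nat (int n - int (j - 1)) = Suc n - j" if "1 \<le> j" for n j using that by linarith
  \<comment> \<open>\<open>g\<close> is the forcing driven by pure noise. The difference consists of
    output errors and of initial inputs, which vanish from time \<open>q\<close> on; both are mean
    square null and stay so after filtering by \<open>E\<close>.\<close>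
  have fg: "forcing n $ b - g n $ b = (X (int (Suc n) - int 0) $ b - e (nat (int (Suc n) - int 0)) $ b)
     + (\<Sum>j=1..p. \<Sum>l\<in>UNIV. - A j $ b $ l * (X (int n - int (j - 1)) $ l - e (nat (int n - int (j - 1))) $ l))
     + - ((\<Sum>j=1..q. if j \<le> n then 0 else B j *v U (int n - int j)) $ b)" for n b
  proof -
    have "(\<Sum>j=1..p. \<Sum>l\<in>UNIV. - A j $ b $ l * (X (int n - int (j - 1)) $ l - e (nat (int n - int (j - 1))) $ l))
      = - ((\<Sum>j=1..p. A j *v X (int n - int j + 1)) $ b) + (\<Sum>j=1..p. A j *v e (Suc n - j)) $ b"
    proof -
      have "(\<Sum>l\<in>UNIV. - A j $ b $ l * (X (int n - int (j - 1)) $ l - e (nat (int n - int (j - 1))) $ l))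
        = - ((A j *v X (int n - int j + 1)) $ b) + (A j *v e (Suc n - j)) $ b" if "j \<in> {1..p}" for j
      proof -
        have "1 \<le> j" using that by simp
        then have eq: "int n - int (j - 1) = int n - int j + 1" by simp
        show ?thesis unfolding nat_eq[OF \<open>1 \<le> j\<close>] unfolding eq
          by (simp add: matrix_vector_mult_def right_diff_distrib sum_subtractf sum_negf)
      qed
      then show ?thesis by (simp add: sum.distrib sum_negf sum_subtractf)
    qed
    then show ?thesis unfolding forcing_def g_def by (simp add: e_Suc[symmetric] nat_add_distrib)
  qed
  have X1: "msq_null (\<lambda>n. X (int (Suc n) - int 0) $ b - e (nat (int (Suc n) - int 0)) $ b)" for b
  proof -
    have "X (int (Suc n) - int 0) $ b - e (nat (int (Suc n) - int 0)) $ b = x (Suc n) $ b + \<pi> n $ b" for n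
      unfolding of_nat_0 diff_0_right output_eq by (simp add: e_def nat_int del: of_nat_Suc)
    then show ?thesis by (simp only:) (intro msq_null_add x_null \<pi>_null)
  qed
  have BU: "msq_null (\<lambda>n. - ((\<Sum>j=1..q. if j \<le> n then 0 else B j *v U (int n - int j)) $ b))" for b
    by (rule msq_null_finite_support[of q]) (auto simp: sum_component intro!: sum.neutral)
  have rho: "msq_null (\<lambda>n. (forcing n - g n) $ b)" for b
    unfolding vector_minus_component fg
    by (intro msq_null_add X1 BU msq_null_sum msq_null_cmult X_error) auto
  have "U (int k) - V k = (\<Sum>m\<le>k. E m *v (forcing (k - m) - g (k - m)))" for k
    unfolding input_solution V_def filtered_noise[of e, OF e_0, symmetric] g_def
    by (simp only: matrix_vector_mult_diff_distrib sum_subtractf)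
  then have "U (int k) $ c - V k $ c = (\<Sum>b\<in>UNIV. \<Sum>m\<le>k. E m $ c $ b * (forcing (k - m) - g (k - m)) $ b)" for k
    using MA_component[of E "\<lambda>k. forcing k - g k" k c] by (simp flip: vector_minus_component)
  then show ?thesis
    by (simp only:) (intro msq_null_sum msq_null_MA E_abs_summable rho, auto)
qed

lemma \<Phi>_error: "msq_null (\<lambda>k. \<Phi> k $ r - Wm k $ r)"
proof (cases r)
  case (Inl ic)
  then obtain i c where r: "r = Inl (i, c)" by (cases ic) auto
  have eq: "int k - int (pos i) + 1 = int k - int (pos i - 1)" for k using pos_ge_1[of i] by simp
  have "Wm k $ r = e (nat (int k - int (pos i - 1))) $ c" for k
  proof -
    have "Wm k $ r = (\<Sum>b\<in>UNIV. \<Sum>m\<le>k. G m $ r $ b * e (k - m) $ b)" unfolding Wm_def by (rule MA_component)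
    also have "\<dots> = (\<Sum>m\<le>k. (if pos i = Suc m then 1 else 0) * e (k - m) $ c)"
      by (subst sum.swap) (auto simp: r G_Inl if_distrib[of "\<lambda>x. x * _"] intro!: sum.cong cong: if_cong)
    also have "\<dots> = (\<Sum>m\<le>k. if m = pos i - 1 then e (k - m) $ c else 0)"
      using pos_ge_1[of i] by (intro sum.cong) auto
    also have "\<dots> = lag (pos i - 1) (\<lambda>k. e k $ c) k" by (simp add: lag_def)
    finally show ?thesis by (simp only: e_nat)
  qed
  then show ?thesis using X_error[of "pos i - 1" c] unfolding r \<Phi>_Inl eq by simp
next
  case (Inr ic)
  then obtain i c where r: "r = Inr (i, c)" by (cases ic) auto
  have "Wm k $ r = (if int k - int (pos i) < 0 then 0 else V (nat (int k - int (pos i))) $ c)" for k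
  proof -
    have "Wm k $ r = (\<Sum>b\<in>UNIV. \<Sum>m\<le>k. Pc (Suc m - pos i) $ c $ b * e (k - m) $ b)"
      unfolding Wm_def r MA_component G_Inr ..
    also have "\<dots> = (\<Sum>b\<in>UNIV. if pos i \<le> k then \<Sum>m\<le>k - pos i. Pc (Suc m) $ c $ b * e (k - pos i - m) $ b else 0)"
    proof (rule sum.cong[OF refl])
      fix b
      have "(\<Sum>m\<le>k. Pc (Suc m - pos i) $ c $ b * e (k - m) $ b) = (\<Sum>m\<in>{pos i..k}. Pc (Suc m - pos i) $ c $ b * e (k - m) $ b)"
        by (rule sum.mono_neutral_right) (auto simp: Pc_0)
      also have "\<dots> = (if pos i \<le> k then \<Sum>m\<le>k - pos i. Pc (Suc m) $ c $ b * e (k - pos i - m) $ b else 0)"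
      proof (cases "pos i \<le> k")
        case True
        have "(\<Sum>m\<in>{pos i..k}. Pc (Suc m - pos i) $ c $ b * e (k - m) $ b) = (\<Sum>m\<le>k - pos i. Pc (Suc m) $ c $ b * e (k - pos i - m) $ b)"
          by (rule sum.reindex_bij_witness[of _ "\<lambda>m. m + pos i" "\<lambda>m. m - pos i"]) (use True in \<open>auto simp: Suc_diff_le\<close>)
        then show ?thesis using True by simp
      qed simp
      finally show "(\<Sum>m\<le>k. Pc (Suc m - pos i) $ c $ b * e (k - m) $ b)
        = (if pos i \<le> k then \<Sum>m\<le>k - pos i. Pc (Suc m) $ c $ b * e (k - pos i - m) $ b else 0)" .
    qed
    also have "\<dots> = (if pos i \<le> k then V (k - pos i) $ c else 0)"
      using MA_component[of "\<lambda>m. Pc (Suc m)" e "k - pos i" c] by (simp add: V_def)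
    finally show ?thesis by (simp add: nat_diff_distrib')
  qed
  then show ?thesis
    using msq_null_int_lag[of "\<lambda>l. U l $ c - (if l < 0 then 0 else V (nat l) $ c)" "pos i"] U_error[of c]
    unfolding r \<Phi>_Inr by simp
qed

section \<open>Identification of the limiting covariance and its positivity\<close>

definition Lam :: "(('p \<times> 'd) + ('q \<times> 'd)) \<Rightarrow> (('p \<times> 'd) + ('q \<times> 'd)) \<Rightarrow> real" where
  "Lam r u = (\<Sum>b\<in>UNIV. \<Sum>m. G m $ r $ b * (\<Sum>c\<in>UNIV. G m $ u $ c * \<Gamma> $ c $ b))"

lemma Wm_cov: "msq_bounded (\<lambda>n. Wm n $ r)" "acov (\<lambda>n. Wm n $ r) (\<lambda>n. Wm n $ u) (Lam r u)"
  unfolding Wm_def Lam_def using MA_covariance[OF e_bounded e_cov G_summable] by auto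

lemma \<Phi>_cov: "acov (\<lambda>n. \<Phi> n $ r) (\<lambda>n. \<Phi> n $ u) (Lam r u)"
  by (rule acov_perturb[OF Wm_cov(2) Wm_cov(1) Wm_cov(1) \<Phi>_error \<Phi>_error])

text \<open>Read off from the symmetry of the empirical averages by uniqueness of limits.\<close>

lemma Lam_sym: "Lam r u = Lam u r"
  using LIMSEQ_unique \<Phi>_cov[of r u] acov_commute[OF \<Phi>_cov[of u r]] unfolding acov_def by blast

lemma Lam_sums: "(\<lambda>m. \<Sum>b\<in>UNIV. G m $ r $ b * (\<Sum>c\<in>UNIV. G m $ u $ c * \<Gamma> $ c $ b)) sums Lam r u"
  unfolding Lam_def
proof (intro sums_sum summable_sums)
  fix b
  have bd: "\<exists>K. \<forall>m. \<bar>G m $ u $ c\<bar> \<le> K" for c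
    using Bseq_def[of "\<lambda>m. \<bar>G m $ u $ c\<bar>"] summable_imp_Bseq[OF G_summable[of u c]] by (auto simp: Bseq_def)
  then obtain K where K: "\<And>c m. \<bar>G m $ u $ c\<bar> \<le> K c" by metis
  have "summable (\<lambda>m. \<bar>G m $ r $ b\<bar> * (\<Sum>c\<in>UNIV. K c * \<bar>\<Gamma> $ c $ b\<bar>))" by (intro summable_mult2 G_summable)
  then show "summable (\<lambda>m. G m $ r $ b * (\<Sum>c\<in>UNIV. G m $ u $ c * \<Gamma> $ c $ b))"
  proof (rule summable_comparison_test'[of _ 0])
    fix m
    have "\<bar>\<Sum>c\<in>UNIV. G m $ u $ c * \<Gamma> $ c $ b\<bar> \<le> (\<Sum>c\<in>UNIV. K c * \<bar>\<Gamma> $ c $ b\<bar>)"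
      by (rule order_trans[OF sum_abs]) (auto intro!: sum_mono mult_right_mono K simp: abs_mult)
    then show "norm (G m $ r $ b * (\<Sum>c\<in>UNIV. G m $ u $ c * \<Gamma> $ c $ b)) \<le> \<bar>G m $ r $ b\<bar> * (\<Sum>c\<in>UNIV. K c * \<bar>\<Gamma> $ c $ b\<bar>)"
      by (simp add: abs_mult mult_left_mono)
  qed
qed

text \<open>An output block responds to the noise at the single lag \<open>pos i - 1\<close>, so one
  term of the series remains.\<close>

lemma Lam_Inl: "Lam (Inl (i, b)) u = (\<Sum>c\<in>UNIV. G (pos i - 1) $ u $ c * \<Gamma> $ c $ b)"
proof -
  have "(\<lambda>m. \<Sum>b'\<in>UNIV. G m $ Inl (i, b) $ b' * (\<Sum>c\<in>UNIV. G m $ u $ c * \<Gamma> $ c $ b'))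
     = (\<lambda>m. if m = pos i - 1 then (\<Sum>c\<in>UNIV. G m $ u $ c * \<Gamma> $ c $ b) else 0)"
  proof
    fix m
    have "pos i = Suc m \<longleftrightarrow> m = pos i - 1" using pos_ge_1[of i] by auto
    then show "(\<Sum>b'\<in>UNIV. G m $ Inl (i, b) $ b' * (\<Sum>c\<in>UNIV. G m $ u $ c * \<Gamma> $ c $ b'))
      = (if m = pos i - 1 then (\<Sum>c\<in>UNIV. G m $ u $ c * \<Gamma> $ c $ b) else 0)"
      by (auto simp: G_Inl if_distrib[of "\<lambda>x. x * _"] cong: if_cong)
  qed
  then have "(\<lambda>m. if m = pos i - 1 then (\<Sum>c\<in>UNIV. G m $ u $ c * \<Gamma> $ c $ b) else 0) sums Lam (Inl (i, b)) u"
    using Lam_sums[of "Inl (i, b)" u] by simp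
  then show ?thesis using sums_unique2 sums_single[of "pos i - 1" "\<lambda>m. \<Sum>c\<in>UNIV. G m $ u $ c * \<Gamma> $ c $ b"] by blast
qed

text \<open>Lags below \<open>pos j\<close> vanish because \<open>Pc 0 = 0\<close>; shifting the
  series by \<open>pos j\<close> gives the one that defines \<open>H_block\<close>.\<close>

lemma Lam_Inr_Inr:
  assumes "pos i \<le> pos j"
  shows "Lam (Inr (i, b)) (Inr (j, c)) = H_block (\<lambda>k. Pc (nat k)) \<Gamma> (pos j - pos i + 1) $ b $ c"
proof -
  let ?M = "\<lambda>l. Pc (pos j - pos i + 1 + l) ** \<Gamma> ** transpose (Pc (l + 1))"
  have entry: "(\<lambda>l. ?M l $ b $ c) sums Lam (Inr (i, b)) (Inr (j, c))" for b c
  proof -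
    let ?t = "\<lambda>m. \<Sum>b'\<in>UNIV. G m $ Inr (i, b) $ b' * (\<Sum>c'\<in>UNIV. G m $ Inr (j, c) $ c' * \<Gamma> $ c' $ b')"
    have "?t m = 0" if "m < pos j" for m
    proof -
      have "Suc m - pos j = 0" using that by simp
      then show ?thesis unfolding G_Inr by (simp only: Pc_0) simp
    qed
    then have "(\<lambda>l. ?t (l + pos j)) sums Lam (Inr (i, b)) (Inr (j, c))"
      using sums_zero_iff_shift[of "pos j" ?t] Lam_sums by blast
    moreover have "?t (l + pos j) = ?M l $ b $ c" for l
    proof -
      have "Suc (l + pos j) - pos i = pos j - pos i + 1 + l" "Suc (l + pos j) - pos j = l + 1" using assms by simp_all
      then have "?t (l + pos j) = (\<Sum>b'\<in>UNIV. \<Sum>c'\<in>UNIV. Pc (pos j - pos i + 1 + l) $ b $ b' * \<Gamma> $ b' $ c' * Pc (l + 1) $ c $ c')"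
        unfolding G_Inr by (simp only: sum_distrib_left) (intro sum.cong refl, simp add: Gamma_sym[of _ b'] Gamma_sym mult_ac)
      also have "\<dots> = ?M l $ b $ c"
        by (subst sum.swap) (simp add: matrix_matrix_mult_def transpose_def sum_distrib_right)
      finally show ?thesis .
    qed
    ultimately show ?thesis by simp
  qed
  have "?M sums (\<chi> b c. Lam (Inr (i, b)) (Inr (j, c)))"
    by (intro sums_vec) (simp add: entry del: One_nat_def)
  then have "suminf ?M = (\<chi> b c. Lam (Inr (i, b)) (Inr (j, c)))" by (simp add: sums_iff)
  then show ?thesis unfolding H_block_def nat_int by simp
qed

lemma Lam_eq: "Lam r u = Lambda_mat (arx_P p q A B) \<Gamma> $ r $ u"
proof -
  have LR: "Lam (Inl (i, b)) (Inr (j, c)) = K_mat (\<lambda>k. Pc (nat k)) \<Gamma> $ (j, c) $ (i, b)" for i j b c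
  proof -
    have "Suc (pos i - 1) - pos j = pos i - pos j" using pos_ge_1[of i] by simp
    then have "Lam (Inl (i, b)) (Inr (j, c)) = (Pc (pos i - pos j) ** \<Gamma>) $ c $ b"
      unfolding Lam_Inl G_Inr by (simp add: matrix_matrix_mult_def)
    moreover have "nat (int (pos i) - int (pos j)) = pos i - pos j" by linarith
    ultimately show ?thesis by (auto simp: K_mat_def Pc_0)
  qed
  have RR: "Lam (Inr (i, b)) (Inr (j, c)) = H_mat (\<lambda>k. Pc (nat k)) \<Gamma> $ (i, b) $ (j, c)" for i j b c
  proof (cases "pos i \<le> pos j")
    case True
    then show ?thesis using Lam_Inr_Inr[OF True] by (simp add: H_mat_def)
  next
    case False
    then show ?thesis using Lam_Inr_Inr[of j i c b] Lam_sym[of "Inr (i, b)" "Inr (j, c)"] by (simp add: H_mat_def transpose_def)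
  qed
  have LL: "Lam (Inl (i, b)) (Inl (j, c)) = L_mat \<Gamma> $ (i, b) $ (j, c)" for i j b c
  proof -
    have "Suc (pos i - 1) = pos i" using pos_ge_1[of i] by simp
    then show ?thesis
      unfolding Lam_Inl G_Inl by (auto simp: L_mat_def pos_inject Gamma_sym if_distrib[of "\<lambda>x. x * _"] cong: if_cong)
  qed
  have RL: "Lam (Inr (i, b)) (Inl (j, c)) = K_mat (\<lambda>k. Pc (nat k)) \<Gamma> $ (i, b) $ (j, c)" for i j b c
    using LR[of j c i b] Lam_sym by simp
  show ?thesis unfolding arx_P_eq Lambda_mat_def block_mat_def
    by (cases r; cases u) (auto simp: LL LR RL RR transpose_def)
qed

lemma Lambda_pos:
  fixes v :: "real^(('p \<times> 'd) + ('q \<times> 'd))"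
  assumes Pi: "det (Pi_mat p (arx_P p q A B) :: real^('q \<times> 'd)^('q \<times> 'd)) \<noteq> 0" and v: "v \<noteq> 0"
  shows "0 < v \<bullet> (Lambda_mat (arx_P p q A B) \<Gamma> *v v)"
proof -
  \<comment> \<open>\<open>h m\<close> is the transpose of \<open>G m\<close> applied to
    \<open>v\<close>, so the quadratic form is the sum of the forms of \<Gamma> at the
    \<open>h m\<close>.\<close>
  define h where "h m = (\<chi> b. \<Sum>r\<in>UNIV. v $ r * G m $ r $ b)" for m
  have sums: "(\<lambda>m. h m \<bullet> (\<Gamma> *v h m)) sums (v \<bullet> (Lambda_mat (arx_P p q A B) \<Gamma> *v v))"
  proof -
    have "(\<lambda>m. \<Sum>r\<in>UNIV. \<Sum>u\<in>UNIV. v $ r * ((\<Sum>b\<in>UNIV. G m $ r $ b * (\<Sum>c\<in>UNIV. G m $ u $ c * \<Gamma> $ c $ b)) * v $ u))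
       sums (\<Sum>r\<in>UNIV. \<Sum>u\<in>UNIV. v $ r * (Lam r u * v $ u))"
      by (intro sums_sum sums_mult sums_mult2 Lam_sums)
    moreover have "(\<Sum>r\<in>UNIV. \<Sum>u\<in>UNIV. v $ r * (Lam r u * v $ u)) = v \<bullet> (Lambda_mat (arx_P p q A B) \<Gamma> *v v)"
      by (simp add: inner_vec_def matrix_vector_mult_def Lam_eq sum_distrib_left)
    moreover have "(\<Sum>r\<in>UNIV. \<Sum>u\<in>UNIV. v $ r * ((\<Sum>b\<in>UNIV. G m $ r $ b * (\<Sum>c\<in>UNIV. G m $ u $ c * \<Gamma> $ c $ b)) * v $ u))
        = h m \<bullet> (\<Gamma> *v h m)" for m
    proof -
      have "h m \<bullet> (\<Gamma> *v h m) = (\<Sum>b\<in>UNIV. (\<Sum>r\<in>UNIV. v $ r * G m $ r $ b) * (\<Sum>c\<in>UNIV. \<Gamma> $ b $ c * (\<Sum>u\<in>UNIV. v $ u * G m $ u $ c)))"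
        by (simp add: inner_vec_def matrix_vector_mult_def h_def)
      also have "\<dots> = (\<Sum>b\<in>UNIV. \<Sum>r\<in>UNIV. \<Sum>c\<in>UNIV. \<Sum>u\<in>UNIV. v $ r * G m $ r $ b * (\<Gamma> $ c $ b * (v $ u * G m $ u $ c)))"
        by (simp only: sum_distrib_right, simp only: sum_distrib_left, intro sum.cong refl, simp add: Gamma_sym)
      also have "\<dots> = (\<Sum>r\<in>UNIV. \<Sum>b\<in>UNIV. \<Sum>u\<in>UNIV. \<Sum>c\<in>UNIV. v $ r * G m $ r $ b * (\<Gamma> $ c $ b * (v $ u * G m $ u $ c)))"
        by (subst sum.swap) (intro sum.cong refl sum.swap)
      also have "\<dots> = (\<Sum>r\<in>UNIV. \<Sum>u\<in>UNIV. \<Sum>b\<in>UNIV. \<Sum>c\<in>UNIV. v $ r * G m $ r $ b * (\<Gamma> $ c $ b * (v $ u * G m $ u $ c)))"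
        by (intro sum.cong refl sum.swap)
      also have "\<dots> = (\<Sum>r\<in>UNIV. \<Sum>u\<in>UNIV. v $ r * ((\<Sum>b\<in>UNIV. G m $ r $ b * (\<Sum>c\<in>UNIV. G m $ u $ c * \<Gamma> $ c $ b)) * v $ u))"
        by (simp add: sum_distrib_left sum_distrib_right mult_ac)
      finally show ?thesis by simp
    qed
    ultimately show ?thesis by simp
  qed
  have psd: "0 \<le> w \<bullet> (\<Gamma> *v w)" "w \<noteq> 0 \<Longrightarrow> 0 < w \<bullet> (\<Gamma> *v w)" for w
    using Gamma_pd unfolding pos_definite_def by (cases "w = 0"; force)+
  have summ: "summable (\<lambda>m. h m \<bullet> (\<Gamma> *v h m))" and eq: "v \<bullet> (Lambda_mat (arx_P p q A B) \<Gamma> *v v) = (\<Sum>m. h m \<bullet> (\<Gamma> *v h m))"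
    using sums by (auto simp: sums_iff)
  have "\<exists>m. h m \<noteq> 0"
  proof (rule ccontr)
    assume "\<nexists>m. h m \<noteq> 0"
    then have h0: "(\<Sum>i\<in>UNIV. \<Sum>c\<in>UNIV. v $ Inl (i, c) * (if c = b \<and> pos i = Suc m then 1 else 0))
       + (\<Sum>i\<in>UNIV. \<Sum>c\<in>UNIV. v $ Inr (i, c) * Pc (Suc m - pos i) $ c $ b) = 0" for m b
      using sum_block[of "\<lambda>r. v $ r * G m $ r $ b"] by (simp add: h_def vec_eq_iff G_Inl G_Inr)
    define \<zeta> where "\<zeta> = (\<chi> ic. v $ Inr ic)"
    let ?Pi = "Pi_mat p (arx_P p q A B) :: real^('q \<times> 'd)^('q \<times> 'd)"
    have "(transpose ?Pi *v \<zeta>) $ (j, b) = 0" for j b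
    proof -
      \<comment> \<open>At lag \<open>p + pos j - 1\<close> the output blocks no longer respond, so
        only the input part of \<open>v\<close> enters, paired with column block \<open>j\<close> of
        \<open>Pi_mat\<close>.\<close>
      have "(\<Sum>i\<in>UNIV. \<Sum>c\<in>UNIV. v $ Inl (i, c) * (if c = b \<and> pos i = Suc (p + pos j - 1) then 1 else 0)) = 0"
      proof (intro sum.neutral ballI)
        fix i :: 'p and c
        have "pos i \<noteq> Suc (p + pos j - 1)" using pos_le[of i] pos_ge_1[of j] p_def by simp
        then show "v $ Inl (i, c) * (if c = b \<and> pos i = Suc (p + pos j - 1) then 1 else 0) = 0" by simp
      qed
      with h0[of b "p + pos j - 1"] have "(\<Sum>i\<in>UNIV. \<Sum>c\<in>UNIV. v $ Inr (i, c) * Pc (p + pos j - pos i) $ c $ b) = 0"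
        using pos_ge_1[of j] by simp
      moreover have "nat (int p + int (pos j) - int (pos i)) = p + pos j - pos i" for i :: 'q by linarith
      ultimately show ?thesis
        by (simp add: matrix_vector_mult_def transpose_def Pi_mat_def arx_P_eq \<zeta>_def sum.cartesian_product
            case_prod_unfold mult.commute UNIV_Times_UNIV[symmetric] del: UNIV_Times_UNIV)
    qed
    then have "transpose ?Pi *v \<zeta> = 0" by (simp add: vec_eq_iff split_paired_all)
    moreover have "invertible (transpose ?Pi)" using Pi by (simp add: invertible_det_nz)
    ultimately have "\<zeta> = 0" by (metis invertible_left_inverse matrix_left_invertible_ker)
    then have z: "v $ Inr ic = 0" for ic by (cases ic) (simp add: \<zeta>_def vec_eq_iff)
    have "v $ Inl (i, b) = 0" for i b
    proof -
      \<comment> \<open>With the input part gone, lag \<open>pos i - 1\<close> isolates output block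
        \<open>i\<close>.\<close>
      have eq: "(pos i' = Suc (pos i - 1)) = (i' = i)" for i' :: 'p using pos_ge_1[of i] pos_inject[of i' i] by auto
      have "(\<Sum>i'\<in>UNIV. \<Sum>c\<in>UNIV. v $ Inl (i', c) * (if c = b \<and> i' = i then 1 else 0)) = 0"
        using h0[of b "pos i - 1"] unfolding eq z by simp
      moreover have "(\<Sum>c\<in>UNIV. v $ Inl (i', c) * (if c = b \<and> i' = i then 1 else 0)) = (if i' = i then v $ Inl (i, b) else 0)" for i'
        by (auto simp: if_distrib[of "\<lambda>x. _ * x"] cong: if_cong)
      ultimately show ?thesis by simp
    qed
    then have "v = 0" using z unfolding vec_eq_iff by (metis old.sum.exhaust surj_pair zero_index)
    with v show False by simp
  qed
  then obtain m where "h m \<noteq> 0" by blast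
  then show ?thesis unfolding eq using psd by (intro suminf_pos2[OF summ]) auto
qed

end

section \<open>Rates\<close>

lemma lnp_top: "0 < \<gamma> \<Longrightarrow> filterlim (lnp \<gamma>) at_top sequentially"
  unfolding lnp_def by real_asymp

lemma small_o_lnp:
  fixes g :: "nat \<Rightarrow> real"
  assumes \<gamma>: "0 < \<gamma>" and g: "\<And>\<eta>. 0 < \<eta> \<Longrightarrow> \<exists>C. \<forall>n. real n * g n \<le> C + \<eta> * lnp \<gamma> n" "\<And>n. 0 \<le> g n"
  shows "g \<in> o(\<lambda>n. ln (real n) powr (1 + \<gamma>) / real n)"
proof (rule landau_o.smallI)
  fix c :: real assume c: "0 < c"
  obtain C where C: "\<And>n. real n * g n \<le> C + c / 2 * lnp \<gamma> n" using g(1)[of "c / 2"] c by auto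
  have "eventually (\<lambda>n. 2 * C / c \<le> lnp \<gamma> n) sequentially"
    using lnp_top[OF \<gamma>] unfolding filterlim_at_top by blast
  then show "\<forall>\<^sub>F n in sequentially. norm (g n) \<le> c * norm (ln (real n) powr (1 + \<gamma>) / real n)"
    using eventually_gt_at_top[of 0]
  proof eventually_elim
    case (elim n)
    then have "C \<le> c / 2 * lnp \<gamma> n" using c by (simp add: field_simps)
    with C[of n] have "real n * g n \<le> c * lnp \<gamma> n" by (simp add: field_simps)
    then show ?case using elim g(2)[of n] by (simp add: lnp_def field_simps)
  qed
qed

section \<open>Convergence of the normalised Gram matrix\<close>

context closed_loop begin

text \<open>Linear bounds from both sides make log \<open>s n\<close> asymptotic to log
  \<open>n\<close>, and a fixed power preserves this.\<close>

lemma weight_asymp: "(\<lambda>n. a n * lnp \<gamma> n) \<longlonglongrightarrow> 1"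
proof -
  obtain c N where c: "0 < c" "\<And>n. n \<ge> N \<Longrightarrow> c * real n \<le> s n" using s_lower by blast
  obtain K where K: "0 \<le> K" "\<And>n. s n \<le> K * (1 + real n)" using s_upper by blast
  obtain N2 where N2: "\<And>n. n \<ge> N2 \<Longrightarrow> exp 1 \<le> s n" using W.s_ge_exp by blast
  have s1: "1 < s n" if "n \<ge> N2" for n using N2[OF that] one_less_exp_iff[of "1::real"] by linarith
  have Kpos: "0 < K"
  proof (rule ccontr)
    assume "\<not> 0 < K"
    then have "K = 0" using K(1) by simp
    then show False using K(2)[of N2] s1[of N2] by simp
  qed
  have ratio: "(\<lambda>n. ln (s n) / ln (real n)) \<longlonglongrightarrow> 1"
  proof (rule tendsto_sandwich)
    show "(\<lambda>n. ln (c * real n) / ln (real n)) \<longlonglongrightarrow> 1" using c(1) by real_asymp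
    show "(\<lambda>n. ln (K * (1 + real n)) / ln (real n)) \<longlonglongrightarrow> 1" using Kpos by real_asymp
    show "\<forall>\<^sub>F n in sequentially. ln (c * real n) / ln (real n) \<le> ln (s n) / ln (real n)"
      using eventually_ge_at_top[of "max 2 (max N N2)"]
    proof eventually_elim
      case (elim n)
      then show ?case using c(1) c(2)[of n] s1[of n] by (intro divide_right_mono) auto
    qed
    show "\<forall>\<^sub>F n in sequentially. ln (s n) / ln (real n) \<le> ln (K * (1 + real n)) / ln (real n)"
      using eventually_ge_at_top[of "max 2 (max N N2)"]
    proof eventually_elim
      case (elim n)
      have "0 < s n" using s1[of n] elim by simp
      moreover have "0 < K * (1 + real n)" using Kpos by simp
      ultimately have "ln (s n) \<le> ln (K * (1 + real n))" using K(2)[of n] by simp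
      then show ?case using elim by (intro divide_right_mono) auto
    qed
  qed
  have "(\<lambda>n. (1 / (ln (s n) / ln (real n))) powr (1 + \<gamma>)) \<longlonglongrightarrow> (1 / 1) powr (1 + \<gamma>)"
    by (intro tendsto_intros ratio) auto
  then have "(\<lambda>n. (1 / (ln (s n) / ln (real n))) powr (1 + \<gamma>)) \<longlonglongrightarrow> 1" by simp
  then show ?thesis
  proof (rule Lim_transform_eventually)
    show "\<forall>\<^sub>F n in sequentially. (1 / (ln (s n) / ln (real n))) powr (1 + \<gamma>) = a n * lnp \<gamma> n"
      using eventually_ge_at_top[of "max 2 N2"]
    proof eventually_elim
      case (elim n)
      have s1': "1 < s n" using s1[of n] elim by simp
      have eq: "1 / (ln (s n) / ln (real n)) = (1 / ln (s n)) * ln (real n)" by simp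
      show ?case unfolding eq weight[OF s1'] lnp_def using s1' elim by (subst powr_mult) auto
    qed
  qed
qed

lemma norm_\<Phi>_sum_le: "\<exists>K. \<forall>n. (\<Sum>k<n. (norm (\<Phi> k))\<^sup>2) \<le> K * real n"
proof -
  obtain K where K: "\<And>n. s n \<le> K * (1 + real n)" using s_upper by blast
  have "(\<Sum>k<n. (norm (\<Phi> k))\<^sup>2) \<le> K * real n" for n
  proof (cases n)
    case (Suc m)
    then show ?thesis using K[of m] by (simp add: s_def lessThan_Suc_atMost)
  qed simp
  then show ?thesis by blast
qed

abbreviation "\<Lambda> \<equiv> (Lambda_mat (arx_P p q A B) \<Gamma> :: real^(('p \<times> 'd) + ('q \<times> 'd))^(('p \<times> 'd) + ('q \<times> 'd)))"

text \<open>Products of components are dominated by the squared regressor norm, whose sums grow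
  linearly, so \<open>weighted_mean\<close> applies entrywise; the identity in \<open>wls_T\<close>
  vanishes after normalisation.\<close>

lemma gram_limit: "(\<lambda>n. (lnp \<gamma> n / real n) *\<^sub>R wls_T a \<Phi> (Suc n)) \<longlonglongrightarrow> \<Lambda>"
proof (intro vec_tendstoI)
  fix r u
  obtain K where K: "\<And>n. (\<Sum>k<n. (norm (\<Phi> k))\<^sup>2) \<le> K * real n" using norm_\<Phi>_sum_le by blast
  have "(\<lambda>n. lnp \<gamma> n / real n * (\<Sum>k<Suc n. a k * (\<Phi> k $ r * \<Phi> k $ u))) \<longlonglongrightarrow> Lam r u"
  proof (rule weighted_mean[OF gamma _ K weight_asymp])
    fix k
    have "\<bar>\<Phi> k $ r\<bar> * \<bar>\<Phi> k $ u\<bar> \<le> norm (\<Phi> k) * norm (\<Phi> k)" by (intro mult_mono component_le_norm_cart) auto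
    then show "\<bar>\<Phi> k $ r * \<Phi> k $ u\<bar> \<le> (norm (\<Phi> k))\<^sup>2" by (simp add: abs_mult power2_eq_square)
  qed (use \<Phi>_cov in \<open>simp add: acov_def\<close>)
  moreover have "(\<lambda>n. lnp \<gamma> n / real n * (mat 1 :: real^(('p \<times> 'd) + ('q \<times> 'd))^(('p \<times> 'd) + ('q \<times> 'd))) $ r $ u) \<longlonglongrightarrow> 0 * mat 1 $ r $ u"
    by (intro tendsto_intros lnp_over_n gamma)
  ultimately have "(\<lambda>n. lnp \<gamma> n / real n * (\<Sum>k<Suc n. a k * (\<Phi> k $ r * \<Phi> k $ u)) + lnp \<gamma> n / real n * (mat 1 :: real^(('p \<times> 'd) + ('q \<times> 'd))^(('p \<times> 'd) + ('q \<times> 'd))) $ r $ u)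
     \<longlonglongrightarrow> Lam r u + 0 * mat 1 $ r $ u" by (rule tendsto_add)
  then show "(\<lambda>n. ((lnp \<gamma> n / real n) *\<^sub>R wls_T a \<Phi> (Suc n)) $ r $ u) \<longlonglongrightarrow> \<Lambda> $ r $ u"
    unfolding Lam_eq[symmetric] by (simp add: wls_T_def outer_def distrib_left del: sum.lessThan_Suc)
qed

text \<open>The last term of a convergent average is a difference of two averages with the same
  limit.\<close>

lemma energy_small_at_n: "(\<lambda>n. (norm (\<Phi> n))\<^sup>2 / real (Suc n)) \<longlonglongrightarrow> 0"
proof -
  let ?S = "\<lambda>n. \<Sum>k<n. (norm (\<Phi> k))\<^sup>2"
  have "(\<lambda>n. \<Sum>r\<in>UNIV. (\<Sum>k<n. \<Phi> k $ r * \<Phi> k $ r) / real n) \<longlonglongrightarrow> (\<Sum>r\<in>UNIV. Lam r r)"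
    using \<Phi>_cov unfolding acov_def by (intro tendsto_sum)
  moreover have "(\<Sum>r\<in>UNIV. (\<Sum>k<n. \<Phi> k $ r * \<Phi> k $ r) / real n) = ?S n / real n" for n
    unfolding sum_divide_distrib[symmetric] by (subst sum.swap) (simp add: norm_power2_vec power2_eq_square[symmetric])
  ultimately have lim: "(\<lambda>n. ?S n / real n) \<longlonglongrightarrow> (\<Sum>r\<in>UNIV. Lam r r)" by simp
  from tendsto_diff[OF LIMSEQ_Suc[OF lim] LIMSEQ_Suc[OF mean_lag[OF lim, of 1]]]
  show ?thesis by (simp add: diff_divide_distrib[symmetric])
qed

section \<open>Rates of prediction, tracking and estimation\<close>

context
  assumes Pi: "det (Pi_mat p (arx_P p q A B) :: real^('q \<times> 'd)^('q \<times> 'd)) \<noteq> 0"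
begin

text \<open>Half of the lower bound of the limit matrix survives a perturbation of norm below
  \<open>l / 2\<close>.\<close>

lemma gram_lower_bound:
  "\<exists>l>0. \<exists>N\<ge>2. \<forall>n\<ge>N. \<forall>v. l * (norm v)\<^sup>2 * (real n / lnp \<gamma> n) \<le> v \<bullet> (wls_T a \<Phi> (Suc n) *v v)"
proof -
  have "\<exists>l>0. \<forall>v. l * (norm v)\<^sup>2 \<le> v \<bullet> (\<Lambda> *v v)"
    by (rule pos_definite_lower_bound) (rule Lambda_pos[OF Pi])
  then obtain l where "0 < l \<and> (\<forall>v. l * (norm v)\<^sup>2 \<le> v \<bullet> (\<Lambda> *v v))" ..
  then have l: "0 < l" "\<And>v. l * (norm v)\<^sup>2 \<le> v \<bullet> (\<Lambda> *v v)" by auto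
  let ?M = "\<lambda>n. (lnp \<gamma> n / real n) *\<^sub>R wls_T a \<Phi> (Suc n)"
  have "eventually (\<lambda>n. dist (?M n) \<Lambda> < l / 2) sequentially" using gram_limit l(1) by (intro tendstoD) auto
  then obtain N where N: "\<And>n. n \<ge> N \<Longrightarrow> norm (?M n - \<Lambda>) < l / 2"
    unfolding eventually_sequentially dist_norm by blast
  have "l / 2 * (norm v)\<^sup>2 * (real n / lnp \<gamma> n) \<le> v \<bullet> (wls_T a \<Phi> (Suc n) *v v)" if n: "n \<ge> max 2 N" for n v
  proof -
    have b: "0 < lnp \<gamma> n" using n by (intro lnp_pos) auto
    have "\<bar>v \<bullet> ((?M n - \<Lambda>) *v v)\<bar> \<le> norm v * (norm (?M n - \<Lambda>) * norm v)"
      by (rule order_trans[OF Cauchy_Schwarz_ineq2]) (intro mult_left_mono norm_matrix_vector_le norm_ge_zero)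
    also have "\<dots> \<le> norm v * (l / 2 * norm v)"
      using N[of n] n by (intro mult_left_mono mult_right_mono) auto
    also have "\<dots> = l / 2 * (norm v)\<^sup>2" by (simp add: power2_eq_square)
    finally have "- (l / 2 * (norm v)\<^sup>2) \<le> v \<bullet> ((?M n - \<Lambda>) *v v)" by linarith
    moreover have "v \<bullet> (?M n *v v) = v \<bullet> (\<Lambda> *v v) + v \<bullet> ((?M n - \<Lambda>) *v v)"
      by (simp add: matrix_vector_mult_diff_rdistrib inner_diff_right)
    ultimately have "l / 2 * (norm v)\<^sup>2 \<le> v \<bullet> (?M n *v v)" using l(2)[of v] by simp
    also have "\<dots> = (lnp \<gamma> n / real n) * (v \<bullet> (wls_T a \<Phi> (Suc n) *v v))"
      by (simp add: scaleR_matrix_vector)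
    finally have "l / 2 * (norm v)\<^sup>2 * (real n / lnp \<gamma> n) \<le> (lnp \<gamma> n / real n) * (v \<bullet> (wls_T a \<Phi> (Suc n) *v v)) * (real n / lnp \<gamma> n)"
      using b by (intro mult_right_mono) auto
    also have "\<dots> = v \<bullet> (wls_T a \<Phi> (Suc n) *v v)" using b n by simp
    finally show ?thesis .
  qed
  then show ?thesis using l(1) by (intro exI[of _ "l / 2"] conjI exI[of _ "max 2 N"]) auto
qed

text \<open>Tested on the gain vector, the lower bound on the Gram matrix makes the leverage of
  order \<open>(norm (\<Phi> n))\<^sup>2 / n\<close>, which tends to 0. This frees the summable
  series of prediction errors from the factor \<open>1 - leverage\<close>.\<close>

lemma leverage_eventually: "eventually (\<lambda>n. leverage a \<Phi> n \<le> 1 / 2) sequentially"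
proof -
  obtain l N where l: "0 < l" "2 \<le> N"
    "\<And>n v. n \<ge> N \<Longrightarrow> l * (norm v)\<^sup>2 * (real n / lnp \<gamma> n) \<le> v \<bullet> (wls_T a \<Phi> (Suc n) *v v)"
    using gram_lower_bound by blast
  let ?h = "\<lambda>n. (a n * lnp \<gamma> n) * ((norm (\<Phi> n))\<^sup>2 / real (Suc n)) * (real (Suc n) / real n) / l"
  have "(\<lambda>n. real (Suc n) / real n) \<longlonglongrightarrow> 1" by real_asymp
  then have "?h \<longlonglongrightarrow> 1 * 0 * 1 / l" using l(1) by (intro tendsto_intros weight_asymp energy_small_at_n) auto
  then have "eventually (\<lambda>n. ?h n < 1 / 2) sequentially" by (intro order_tendstoD) auto
  then show ?thesis using eventually_ge_at_top[of N]
  proof eventually_elim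
    case (elim n)
    have b: "0 < lnp \<gamma> n" "0 < real n" using elim l(2) by (auto intro: lnp_pos)
    let ?z = "wls_gain a \<Phi> n"
    have "l * (norm ?z)\<^sup>2 * (real n / lnp \<gamma> n) \<le> ?z \<bullet> \<Phi> n" using l(3)[OF elim(2), of ?z] by (simp add: W.T_gain)
    also have "\<dots> \<le> norm ?z * norm (\<Phi> n)" by (rule norm_cauchy_schwarz)
    finally have 1: "norm ?z * (l * norm ?z * (real n / lnp \<gamma> n)) \<le> norm ?z * norm (\<Phi> n)" by (simp add: power2_eq_square mult_ac)
    have "l * norm ?z * (real n / lnp \<gamma> n) \<le> norm (\<Phi> n)"
    proof (cases "?z = 0")
      case False
      then show ?thesis by (intro mult_left_le_imp_le[OF 1]) simp
    qed simp
    then have zb: "norm ?z \<le> norm (\<Phi> n) * (lnp \<gamma> n / (l * real n))" using b l(1) by (simp add: field_simps)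
    have "leverage a \<Phi> n \<le> a n * (norm (\<Phi> n) * norm ?z)"
      unfolding leverage_def by (intro mult_left_mono norm_cauchy_schwarz a_nonneg)
    also have "\<dots> \<le> a n * (norm (\<Phi> n) * (norm (\<Phi> n) * (lnp \<gamma> n / (l * real n))))"
      by (intro mult_left_mono zb a_nonneg norm_ge_zero)
    also have "\<dots> = ?h n" using b l(1) by (simp add: power2_eq_square field_simps del: of_nat_Suc)
    finally show ?case using elim(1) by linarith
  qed
qed

lemma weighted_prediction: "summable (\<lambda>n. a n * (\<pi> n $ c)\<^sup>2)"
proof -
  obtain N where N: "\<And>n. n \<ge> N \<Longrightarrow> leverage a \<Phi> n \<le> 1 / 2" using leverage_eventually unfolding eventually_sequentially by blast
  have "summable (\<lambda>n. 2 * (a n * (1 - leverage a \<Phi> n) * (\<pi> n $ c)\<^sup>2))" by (intro summable_mult discounted_prediction)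
  then show ?thesis
  proof (rule summable_comparison_test'[of _ N])
    fix n assume "N \<le> n"
    then have "1 \<le> 2 * (1 - leverage a \<Phi> n)" using N[of n] by simp
    then have "a n * (\<pi> n $ c)\<^sup>2 * 1 \<le> a n * (\<pi> n $ c)\<^sup>2 * (2 * (1 - leverage a \<Phi> n))"
      using a_nonneg[of n] by (intro mult_left_mono) auto
    then show "norm (a n * (\<pi> n $ c)\<^sup>2) \<le> 2 * (a n * (1 - leverage a \<Phi> n) * (\<pi> n $ c)\<^sup>2)"
      using a_nonneg[of n] by (simp add: algebra_simps)
  qed
qed

text \<open>A Kronecker argument: for large \<open>k < n\<close> the value \<open>1 / a k\<close> is
  at most \<open>2 * lnp \<gamma> n\<close>, and the tail of the series in
  \<open>weighted_prediction\<close> is below \<open>\<eta> / 2\<close>.\<close>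

lemma prediction_rate:
  assumes \<eta>: "0 < \<eta>"
  shows "\<exists>C. \<forall>n. (\<Sum>k<n. (\<pi> k $ c)\<^sup>2) \<le> C + \<eta> * lnp \<gamma> n"
proof -
  have "eventually (\<lambda>n. 1 / 2 < a n * lnp \<gamma> n) sequentially" using weight_asymp by (intro order_tendstoD) auto
  then obtain N1 where N1: "\<And>n. n \<ge> N1 \<Longrightarrow> 1 / 2 < a n * lnp \<gamma> n" unfolding eventually_sequentially by blast
  have "0 < \<eta> / 2" using \<eta> by simp
  then obtain N2 where N2: "\<And>m n. m \<ge> N2 \<Longrightarrow> norm (\<Sum>k=m..<n. a k * (\<pi> k $ c)\<^sup>2) < \<eta> / 2"
    using weighted_prediction[of c] unfolding summable_Cauchy by blast
  define N where "N = max 2 (max N1 N2)"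
  define C where "C = (\<Sum>k<N. (\<pi> k $ c)\<^sup>2)"
  have "(\<Sum>k<n. (\<pi> k $ c)\<^sup>2) \<le> C + \<eta> * lnp \<gamma> n" for n
  proof (cases "n \<le> N")
    case True
    have "(\<Sum>k<n. (\<pi> k $ c)\<^sup>2) \<le> C" unfolding C_def using True by (intro sum_mono2) auto
    moreover have "0 \<le> \<eta> * lnp \<gamma> n" using \<eta> by (simp add: lnp_def)
    ultimately show ?thesis by linarith
  next
    case False
    have "(\<Sum>k<n. (\<pi> k $ c)\<^sup>2) = C + (\<Sum>k=N..<n. (\<pi> k $ c)\<^sup>2)"
      using False unfolding C_def by (simp add: lessThan_atLeast0 sum.atLeastLessThan_concat)
    also have "(\<Sum>k=N..<n. (\<pi> k $ c)\<^sup>2) \<le> (\<Sum>k=N..<n. 2 * lnp \<gamma> n * (a k * (\<pi> k $ c)\<^sup>2))"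
    proof (rule sum_mono)
      fix k assume k: "k \<in> {N..<n}"
      have "1 \<le> 2 * (a k * lnp \<gamma> k)" using N1[of k] k by (simp add: N_def)
      also have "\<dots> \<le> 2 * (a k * lnp \<gamma> n)"
        using k gamma by (intro mult_left_mono lnp_mono a_nonneg) (auto simp: N_def)
      finally have "1 * (\<pi> k $ c)\<^sup>2 \<le> 2 * (a k * lnp \<gamma> n) * (\<pi> k $ c)\<^sup>2" by (intro mult_right_mono) auto
      then show "(\<pi> k $ c)\<^sup>2 \<le> 2 * lnp \<gamma> n * (a k * (\<pi> k $ c)\<^sup>2)" by (simp add: mult_ac)
    qed
    also have "\<dots> = 2 * lnp \<gamma> n * (\<Sum>k=N..<n. a k * (\<pi> k $ c)\<^sup>2)" by (simp add: sum_distrib_left)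
    also have "\<dots> \<le> 2 * lnp \<gamma> n * (\<eta> / 2)"
    proof (rule mult_left_mono)
      have "N2 \<le> N" by (simp add: N_def)
      then show "(\<Sum>k=N..<n. a k * (\<pi> k $ c)\<^sup>2) \<le> \<eta> / 2" using N2[of N n] unfolding real_norm_def by linarith
    qed (simp add: lnp_def)
    finally show ?thesis by (simp add: mult.commute)
  qed
  then show ?thesis by blast
qed

text \<open>An entry of \<open>n\<close> times the difference of the two empirical covariances: the
  product of \<open>\<pi> + \<epsilon>\<close> with itself, without the pure noise term.\<close>

definition cross :: "nat \<Rightarrow> 'd \<Rightarrow> 'd \<Rightarrow> real" where
  "cross n b c = (\<Sum>k<n. \<pi> k $ b * \<pi> k $ c) + (\<Sum>k<n. \<pi> k $ b * \<epsilon> (Suc k) $ c) + (\<Sum>k<n. \<pi> k $ c * \<epsilon> (Suc k) $ b)"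

lemma tracking_difference:
  "real n * (avg_outer (\<lambda>k. X (int k) - x k) n - avg_outer \<epsilon> n) $ b $ c = cross n b c"
proof (cases "n = 0")
  case False
  have "X (int (Suc k)) - x (Suc k) = \<pi> k + \<epsilon> (Suc k)" for k unfolding output_eq by simp
  then have "(\<Sum>k=1..n. outer (X (int k) - x k) (X (int k) - x k)) = (\<Sum>k<n. outer (\<pi> k + \<epsilon> (Suc k)) (\<pi> k + \<epsilon> (Suc k)))"
    by (simp add: sum.atLeast1_atMost_eq del: of_nat_Suc)
  moreover have "(\<Sum>k=1..n. outer (\<epsilon> k) (\<epsilon> k)) = (\<Sum>k<n. outer (\<epsilon> (Suc k)) (\<epsilon> (Suc k)))"
    by (simp add: sum.atLeast1_atMost_eq)
  ultimately have "real n * (avg_outer (\<lambda>k. X (int k) - x k) n - avg_outer \<epsilon> n) $ b $ c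
    = (\<Sum>k<n. outer (\<pi> k + \<epsilon> (Suc k)) (\<pi> k + \<epsilon> (Suc k))) $ b $ c - (\<Sum>k<n. outer (\<epsilon> (Suc k)) (\<epsilon> (Suc k))) $ b $ c"
    using False unfolding avg_outer_def by (simp add: right_diff_distrib)
  also have "\<dots> = cross n b c"
    by (simp add: outer_def cross_def sum_subtractf[symmetric] sum.distrib[symmetric] algebra_simps)
  finally show ?thesis .
qed (simp add: cross_def)

lemma cross_bound:
  assumes \<eta>: "0 < \<eta>"
  shows "\<exists>C. \<forall>n. \<bar>cross n b c\<bar> \<le> C + \<eta> * lnp \<gamma> n"
proof -
  \<comment> \<open>Each of the two prediction energies is counted twice, once for the product of
    prediction errors and once for a noise term, where the self-normalised bound with constant 1
    suffices.\<close>
  have \<eta>4: "0 < \<eta> / 4" using \<eta> by simp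
  obtain C1 where C1: "\<And>n. (\<Sum>k<n. (\<pi> k $ b)\<^sup>2) \<le> C1 + \<eta> / 4 * lnp \<gamma> n"
    using prediction_rate[OF \<eta>4, of b] by blast
  obtain C2 where C2: "\<And>n. (\<Sum>k<n. (\<pi> k $ c)\<^sup>2) \<le> C2 + \<eta> / 4 * lnp \<gamma> n"
    using prediction_rate[OF \<eta>4, of c] by blast
  have sn: "\<exists>C. \<forall>n. \<bar>\<Sum>k<n. \<pi> k $ b * \<epsilon> (Suc k) $ c\<bar> \<le> C + (\<Sum>k<n. (\<pi> k $ b)\<^sup>2)" for b c
    using sn_prediction[of b c, unfolded self_normalized_def, rule_format, OF zero_less_one] by simp
  obtain D1 where D1: "\<And>n. \<bar>\<Sum>k<n. \<pi> k $ b * \<epsilon> (Suc k) $ c\<bar> \<le> D1 + (\<Sum>k<n. (\<pi> k $ b)\<^sup>2)"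
    using sn[of b c] by blast
  obtain D2 where D2: "\<And>n. \<bar>\<Sum>k<n. \<pi> k $ c * \<epsilon> (Suc k) $ b\<bar> \<le> D2 + (\<Sum>k<n. (\<pi> k $ c)\<^sup>2)"
    using sn[of c b] by blast
  have "\<bar>cross n b c\<bar> \<le> (2 * C1 + 2 * C2 + D1 + D2) + \<eta> * lnp \<gamma> n" for n
  proof -
    have "\<bar>\<Sum>k<n. \<pi> k $ b * \<pi> k $ c\<bar> \<le> (\<Sum>k<n. (\<pi> k $ b)\<^sup>2 + (\<pi> k $ c)\<^sup>2)"
    proof (rule order_trans[OF sum_abs sum_mono])
      fix k
      have "2 * (\<bar>\<pi> k $ b\<bar> * \<bar>\<pi> k $ c\<bar>) \<le> (\<pi> k $ b)\<^sup>2 + (\<pi> k $ c)\<^sup>2"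
        using sum_squares_bound[of "\<bar>\<pi> k $ b\<bar>" "\<bar>\<pi> k $ c\<bar>"] by (simp add: mult.assoc)
      moreover have "0 \<le> \<bar>\<pi> k $ b\<bar> * \<bar>\<pi> k $ c\<bar>" by simp
      ultimately show "\<bar>\<pi> k $ b * \<pi> k $ c\<bar> \<le> (\<pi> k $ b)\<^sup>2 + (\<pi> k $ c)\<^sup>2" unfolding abs_mult by linarith
    qed
    then have "\<bar>\<Sum>k<n. \<pi> k $ b * \<pi> k $ c\<bar> \<le> (\<Sum>k<n. (\<pi> k $ b)\<^sup>2) + (\<Sum>k<n. (\<pi> k $ c)\<^sup>2)" by (simp add: sum.distrib)
    moreover have "\<eta> * lnp \<gamma> n = 4 * (\<eta> / 4 * lnp \<gamma> n)" by simp
    ultimately show ?thesis using D1[of n] D2[of n] C1[of n] C2[of n] unfolding cross_def by linarith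
  qed
  then show ?thesis by blast
qed

lemma tracking_rate:
  "(\<lambda>n. norm (avg_outer (\<lambda>k. X (int k) - x k) n - avg_outer \<epsilon> n)) \<in> o(\<lambda>n. ln (real n) powr (1 + \<gamma>) / real n)"
proof (rule small_o_lnp[OF gamma])
  fix \<eta> :: real assume \<eta>: "0 < \<eta>"
  let ?N = "real CARD('d)"
  \<comment> \<open>One share for each entry of the matrix.\<close>
  define \<eta>' where "\<eta>' = \<eta> / (?N * ?N)"
  have \<eta>': "0 < \<eta>'" "?N * (?N * \<eta>') = \<eta>" using \<eta> by (auto simp: \<eta>'_def)
  obtain C where C: "\<And>b c n. \<bar>cross n b c\<bar> \<le> C b c + \<eta>' * lnp \<gamma> n"
    using cross_bound[OF \<eta>'(1)] by metis
  have "real n * norm (avg_outer (\<lambda>k. X (int k) - x k) n - avg_outer \<epsilon> n) \<le> (\<Sum>b\<in>UNIV. \<Sum>c\<in>UNIV. C b c) + \<eta> * lnp \<gamma> n" for n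
  proof -
    let ?D = "avg_outer (\<lambda>k. X (int k) - x k) n - avg_outer \<epsilon> n"
    have "real n * norm ?D \<le> real n * (\<Sum>b\<in>UNIV. \<Sum>c\<in>UNIV. \<bar>?D $ b $ c\<bar>)"
      by (intro mult_left_mono norm_matrix_le_sum) auto
    also have "\<dots> = (\<Sum>b\<in>UNIV. \<Sum>c\<in>UNIV. \<bar>real n * ?D $ b $ c\<bar>)" by (simp only: abs_mult abs_of_nat sum_distrib_left)
    also have "\<dots> \<le> (\<Sum>b\<in>UNIV. \<Sum>c\<in>UNIV. C b c + \<eta>' * lnp \<gamma> n)"
      unfolding tracking_difference by (intro sum_mono C)
    also have "\<dots> = (\<Sum>b\<in>UNIV. \<Sum>c\<in>UNIV. C b c) + (?N * (?N * \<eta>')) * lnp \<gamma> n" by (simp add: sum.distrib)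
    finally show ?thesis unfolding \<eta>'(2) .
  qed
  then show "\<exists>C. \<forall>n. real n * norm (avg_outer (\<lambda>k. X (int k) - x k) n - avg_outer \<epsilon> n) \<le> C + \<eta> * lnp \<gamma> n" by blast
qed simp

lemma rate_null: "(\<lambda>n. ln (real n) powr (1 + \<gamma>) / real n) \<longlonglongrightarrow> 0"
  using lnp_over_n[OF gamma] by (simp add: lnp_def)

lemma tracking_optimal: "(\<lambda>n. avg_outer (\<lambda>k. X (int k) - x k) n) \<longlonglongrightarrow> \<Gamma>"
proof -
  obtain c where "0 < c" and ev: "eventually (\<lambda>n. norm (norm (avg_outer (\<lambda>k. X (int k) - x k) n - avg_outer \<epsilon> n))
      \<le> c * norm (ln (real n) powr (1 + \<gamma>) / real n)) sequentially"
    by (rule landau_o.bigE[OF landau_o.small_imp_big[OF tracking_rate]])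
  have "(\<lambda>n. c * norm (ln (real n) powr (1 + \<gamma>) / real n)) \<longlonglongrightarrow> c * norm (0 :: real)"
    by (intro tendsto_intros rate_null)
  then have "(\<lambda>n. c * norm (ln (real n) powr (1 + \<gamma>) / real n)) \<longlonglongrightarrow> 0" by simp
  from tendsto_norm_zero_cancel[OF Lim_null_comparison[OF ev this]]
  have "(\<lambda>n. avg_outer (\<lambda>k. X (int k) - x k) n - avg_outer \<epsilon> n) \<longlonglongrightarrow> 0" .
  from tendsto_add[OF this Gamma_n] show ?thesis by simp
qed

lemma estimation_rate: "(\<lambda>n. (norm (th n - \<theta>))\<^sup>2) \<in> O(\<lambda>n. ln (real n) powr (1 + \<gamma>) / real n)"
proof -
  obtain l N where l: "0 < l" "2 \<le> N"
    "\<And>n v. n \<ge> N \<Longrightarrow> l * (norm v)\<^sup>2 * (real n / lnp \<gamma> n) \<le> v \<bullet> (wls_T a \<Phi> (Suc n) *v v)"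
    using gram_lower_bound by blast
  obtain C where C: "\<And>c n. col n c \<bullet> (wls_T a \<Phi> n *v col n c) \<le> C c" using lyapunov_bounded by metis
  have nrm: "(norm (th n - \<theta>))\<^sup>2 = (\<Sum>c\<in>UNIV. (norm (col n c))\<^sup>2)" for n
  proof -
    have "(norm (th n - \<theta>))\<^sup>2 = (\<Sum>r\<in>UNIV. (norm ((th n - \<theta>) $ r))\<^sup>2)"
      unfolding norm_vec_def[of "th n - \<theta>"] L2_set_def by (simp add: sum_nonneg)
    also have "\<dots> = (\<Sum>r\<in>UNIV. \<Sum>c\<in>UNIV. ((th n - \<theta>) $ r $ c)\<^sup>2)" by (simp only: norm_power2_vec)
    also have "\<dots> = (\<Sum>c\<in>UNIV. (norm (col n c))\<^sup>2)" by (subst sum.swap) (simp add: norm_power2_vec col_def)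
    finally show ?thesis .
  qed
  have bound: "(norm (th (Suc n) - \<theta>))\<^sup>2 \<le> ((\<Sum>c\<in>UNIV. C c) / l) * (lnp \<gamma> n / real n)" if n: "n \<ge> N" for n
  proof -
    have b: "0 < lnp \<gamma> n" "0 < real n" using n l(2) by (auto intro: lnp_pos)
    have "(norm (col (Suc n) c))\<^sup>2 \<le> C c / l * (lnp \<gamma> n / real n)" for c
    proof -
      have "l * (norm (col (Suc n) c))\<^sup>2 * (real n / lnp \<gamma> n) \<le> C c" using l(3)[OF n] C order_trans by blast
      then show ?thesis using b l(1) by (simp add: field_simps)
    qed
    then have "(norm (th (Suc n) - \<theta>))\<^sup>2 \<le> (\<Sum>c\<in>UNIV. C c / l * (lnp \<gamma> n / real n))" unfolding nrm by (rule sum_mono)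
    then show ?thesis by (simp only: sum_distrib_right[symmetric] sum_divide_distrib[symmetric])
  qed
  have K0: "0 \<le> (\<Sum>c\<in>UNIV. C c) / l"
  proof -
    have "0 \<le> C c" for c using C[of 0 c] W.T_ge[of "col 0 c" 0] inner_ge_zero[of "col 0 c"] by linarith
    then show ?thesis using l(1) by (intro divide_nonneg_nonneg sum_nonneg) auto
  qed
  show ?thesis
  proof (rule landau_o.bigI)
    \<comment> \<open>The Gram bound at index \<open>n - 1\<close> controls the estimate at
      \<open>n\<close>; the factor 2 converts the denominator, and the added 1 makes the constant
      positive.\<close>
    show "\<forall>\<^sub>F n in sequentially. norm ((norm (th n - \<theta>))\<^sup>2) \<le> (2 * ((\<Sum>c\<in>UNIV. C c) / l) + 1) * norm (ln (real n) powr (1 + \<gamma>) / real n)"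
      using eventually_ge_at_top[of "Suc N"]
    proof eventually_elim
      case (elim n)
      then obtain m where m: "n = Suc m" "N \<le> m" by (cases n) auto
      have b: "0 < lnp \<gamma> m" "0 < real m" "0 < lnp \<gamma> n" using m l(2) by (auto intro: lnp_pos)
      have "lnp \<gamma> m / real m \<le> lnp \<gamma> n / real m" using m l(2) gamma b by (intro divide_right_mono lnp_mono) auto
      also have "\<dots> \<le> lnp \<gamma> n * (2 / real n)" using m l(2) b by (simp add: field_simps)
      also have "\<dots> = 2 * (lnp \<gamma> n / real n)" by simp
      finally have q: "lnp \<gamma> m / real m \<le> 2 * (lnp \<gamma> n / real n)" .
      have "(norm (th n - \<theta>))\<^sup>2 \<le> ((\<Sum>c\<in>UNIV. C c) / l) * (lnp \<gamma> m / real m)" unfolding m(1) by (rule bound[OF m(2)])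
      also have "\<dots> \<le> ((\<Sum>c\<in>UNIV. C c) / l) * (2 * (lnp \<gamma> n / real n))" using K0 q by (intro mult_left_mono)
      also have "\<dots> \<le> (2 * ((\<Sum>c\<in>UNIV. C c) / l) + 1) * (lnp \<gamma> n / real n)"
      proof -
        have gen: "0 \<le> y \<Longrightarrow> K * (2 * y) \<le> (2 * K + 1) * y" for K y :: real by (simp add: algebra_simps)
        show ?thesis by (rule gen) (use b in simp)
      qed
      finally show ?case by (simp add: lnp_def)
    qed
  qed (use K0 in linarith)
qed

lemma estimation_consistent: "th \<longlonglongrightarrow> \<theta>"
proof -
  obtain c where "0 < c" and ev: "eventually (\<lambda>n. norm ((norm (th n - \<theta>))\<^sup>2)
      \<le> c * norm (ln (real n) powr (1 + \<gamma>) / real n)) sequentially"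
    by (rule landau_o.bigE[OF estimation_rate])
  have "(\<lambda>n. c * norm (ln (real n) powr (1 + \<gamma>) / real n)) \<longlonglongrightarrow> c * norm (0 :: real)"
    by (intro tendsto_intros rate_null)
  then have "(\<lambda>n. c * norm (ln (real n) powr (1 + \<gamma>) / real n)) \<longlonglongrightarrow> 0" by simp
  from Lim_null_comparison[OF ev this]
  have "(\<lambda>n. sqrt ((norm (th n - \<theta>))\<^sup>2)) \<longlonglongrightarrow> sqrt 0" by (rule tendsto_real_sqrt)
  then have "(\<lambda>n. norm (th n - \<theta>)) \<longlonglongrightarrow> 0" by simp
  from tendsto_norm_zero_cancel[OF this] show ?thesis by (rule LIM_zero_cancel)
qed

end
end

section \<open>Measurability\<close>

lemma borel_measurable_vec_iff:
  fixes f :: "'w \<Rightarrow> ('a::euclidean_space)^'n"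
  shows "f \<in> borel_measurable N \<longleftrightarrow> (\<forall>i. (\<lambda>\<omega>. f \<omega> $ i) \<in> borel_measurable N)"
proof
  assume "f \<in> borel_measurable N"
  then show "\<forall>i. (\<lambda>\<omega>. f \<omega> $ i) \<in> borel_measurable N"
    by (intro allI borel_measurable_continuous_on[where f="\<lambda>v. v $ _"] continuous_intros)
next
  assume *: "\<forall>i. (\<lambda>\<omega>. f \<omega> $ i) \<in> borel_measurable N"
  show "f \<in> borel_measurable N"
  proof (subst borel_measurable_euclidean_space, rule ballI)
    fix b :: "'a^'n" assume "b \<in> Basis"
    then obtain i u where b: "b = axis i u" by (auto simp: Basis_vec_def)
    show "(\<lambda>\<omega>. f \<omega> \<bullet> b) \<in> borel_measurable N"
      unfolding b inner_axis using * by (intro borel_measurable_inner borel_measurable_const) auto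
  qed
qed

lemma borel_measurable_vecI:
  "(\<And>i. (\<lambda>\<omega>. f \<omega> $ i) \<in> borel_measurable N) \<Longrightarrow> f \<in> borel_measurable N"
  for f :: "'w \<Rightarrow> ('a::euclidean_space)^'n"
  by (simp add: borel_measurable_vec_iff)

lemma borel_measurable_vecD:
  "f \<in> borel_measurable N \<Longrightarrow> (\<lambda>\<omega>. f \<omega> $ i) \<in> borel_measurable N"
  for f :: "'w \<Rightarrow> ('a::euclidean_space)^'n"
  by (simp add: borel_measurable_vec_iff)

lemma borel_measurable_matrix_vector:
  fixes M :: "'w \<Rightarrow> real^'n^'m"
  assumes "M \<in> borel_measurable N" "v \<in> borel_measurable N"
  shows "(\<lambda>\<omega>. M \<omega> *v v \<omega>) \<in> borel_measurable N"
  by (intro borel_measurable_vecI) (auto simp: matrix_vector_mult_def intro!: borel_measurable_sum borel_measurable_times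
      borel_measurable_vecD assms)

lemma borel_measurable_transpose:
  fixes M :: "'w \<Rightarrow> real^'n^'m"
  assumes "M \<in> borel_measurable N"
  shows "(\<lambda>\<omega>. transpose (M \<omega>)) \<in> borel_measurable N"
  by (intro borel_measurable_vecI) (simp add: transpose_def borel_measurable_vecD assms)

lemma borel_measurable_outer:
  fixes u :: "'w \<Rightarrow> real^'m" and v :: "'w \<Rightarrow> real^'n"
  assumes "u \<in> borel_measurable N" "v \<in> borel_measurable N"
  shows "(\<lambda>\<omega>. outer (u \<omega>) (v \<omega>)) \<in> borel_measurable N"
  by (intro borel_measurable_vecI) (simp add: outer_def borel_measurable_vecD borel_measurable_times assms)

lemma borel_measurable_det:
  fixes M :: "'w \<Rightarrow> real^'n^'n"
  assumes "\<And>i j. (\<lambda>\<omega>. M \<omega> $ i $ j) \<in> borel_measurable N"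
  shows "(\<lambda>\<omega>. det (M \<omega>)) \<in> borel_measurable N"
  unfolding det_def by (intro borel_measurable_sum borel_measurable_times borel_measurable_const borel_measurable_prod assms)

text \<open>Cramer's rule replaces the inverse by quotients of determinants, which are polynomials
  in the measurable entries.\<close>

lemma borel_measurable_solve:
  fixes M :: "'w \<Rightarrow> real^'n^'n"
  assumes M: "M \<in> borel_measurable N" and v: "v \<in> borel_measurable N"
    and inv: "\<And>\<omega>. \<omega> \<in> space N \<Longrightarrow> invertible (M \<omega>)"
  shows "(\<lambda>\<omega>. matrix_inv (M \<omega>) *v v \<omega>) \<in> borel_measurable N"
proof (rule borel_measurable_vecI)
  fix k
  have Mij: "(\<lambda>\<omega>. M \<omega> $ i $ j) \<in> borel_measurable N" for i j by (intro borel_measurable_vecD M)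
  have "(\<lambda>\<omega>. det (\<chi> i j. if j = k then v \<omega> $ i else M \<omega> $ i $ j) / det (M \<omega>)) \<in> borel_measurable N"
  proof (intro borel_measurable_divide borel_measurable_det Mij)
    fix i j
    show "(\<lambda>\<omega>. (\<chi> i j. if j = k then v \<omega> $ i else M \<omega> $ i $ j) $ i $ j) \<in> borel_measurable N"
      by (cases "j = k") (simp_all add: Mij borel_measurable_vecD v)
  qed
  also have "(\<lambda>\<omega>. det (\<chi> i j. if j = k then v \<omega> $ i else M \<omega> $ i $ j) / det (M \<omega>)) \<in> borel_measurable N
      \<longleftrightarrow> (\<lambda>\<omega>. (matrix_inv (M \<omega>) *v v \<omega>) $ k) \<in> borel_measurable N"
  proof (rule measurable_cong)
    fix \<omega> assume "\<omega> \<in> space N"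
    then have I: "invertible (M \<omega>)" by (rule inv)
    have "M \<omega> *v (matrix_inv (M \<omega>) *v v \<omega>) = v \<omega>"
      by (simp add: matrix_vector_mul_assoc matrix_mult_matrix_inv[OF I])
    then have "matrix_inv (M \<omega>) *v v \<omega> = (\<chi> k. det (\<chi> i j. if j = k then v \<omega> $ i else M \<omega> $ i $ j) / det (M \<omega>))"
      using I cramer[of "M \<omega>"] by (simp add: invertible_det_nz)
    then show "det (\<chi> i j. if j = k then v \<omega> $ i else M \<omega> $ i $ j) / det (M \<omega>) = (matrix_inv (M \<omega>) *v v \<omega>) $ k"
      by (simp only: vec_lambda_beta)
  qed
  finally show "(\<lambda>\<omega>. (matrix_inv (M \<omega>) *v v \<omega>) $ k) \<in> borel_measurable N" .
qed

lemma wls_S_eq: "wls_S a \<Phi> n \<omega> = wls_T (\<lambda>k. a k \<omega>) (\<lambda>k. \<Phi> k \<omega>) (Suc n)"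
  by (simp add: wls_S_def wls_T_def lessThan_Suc_atMost)

theorem theorem4p2:
  fixes M :: "'w measure" and F :: "nat \<Rightarrow> 'w measure"
    and A B :: "nat \<Rightarrow> real^'d^'d" and \<Gamma> :: "real^'d^'d" and \<gamma> :: real
    and X U :: "int \<Rightarrow> 'w \<Rightarrow> real^'d" and \<epsilon> x :: "nat \<Rightarrow> 'w \<Rightarrow> real^'d"
    and P :: "int \<Rightarrow> real^'d^'d"
    and \<theta> :: "real^'d^(('p::{finite,linorder} \<times> 'd) + ('q::{finite,linorder} \<times> 'd))"
    and \<theta>h :: "nat \<Rightarrow> 'w \<Rightarrow> real^'d^(('p \<times> 'd) + ('q \<times> 'd))"
    and \<Phi> :: "nat \<Rightarrow> 'w \<Rightarrow> real^(('p \<times> 'd) + ('q \<times> 'd))"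
    and a :: "nat \<Rightarrow> 'w \<Rightarrow> real"
  assumes prob: "prob_space M"
    and filt: "filtration (space M) F" "\<And>n. subalgebra M (F n)"
    \<comment> \<open>model, for all times \<open>n \<ge> 0\<close>, with initial values known at time 0\<close>
    and \<theta>_def: "\<theta> = arx_param A B"
    and \<Phi>_def: "\<Phi> = regressor X U"
    and model: "\<And>n \<omega>. \<omega> \<in> space M \<Longrightarrow>
      X (int (Suc n)) \<omega> = transpose \<theta> *v \<Phi> n \<omega> + U (int n) \<omega> + \<epsilon> (Suc n) \<omega>"
    and X_init: "\<And>k. - int CARD('p) < k \<Longrightarrow> k \<le> 0 \<Longrightarrow> X k \<in> borel_measurable (F 0)"
    and U_init: "\<And>k. - int CARD('q) \<le> k \<Longrightarrow> k < 0 \<Longrightarrow> U k \<in> borel_measurable (F 0)"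
    \<comment> \<open>noise\<close>
    and Gamma_pd: "pos_definite \<Gamma>"
    and noise: "mart_diff_noise M F \<epsilon> \<Gamma>"
    and Gamma_n: "AE \<omega> in M. (\<lambda>n. avg_outer (\<lambda>k. \<epsilon> k \<omega>) n) \<longlonglongrightarrow> \<Gamma>"
    and white_or_moment: "white_noise M \<epsilon> \<or> cond_moment_gt2 M F \<epsilon>"
    \<comment> \<open>weighted least squares\<close>
    and gamma_pos: "\<gamma> > 0"
    and weights: "wls_weights M F \<gamma> \<Phi> a"
    and \<theta>h_init: "\<theta>h 0 \<in> borel_measurable (F 0)"
    and \<theta>h_step: "\<And>n \<omega>. \<omega> \<in> space M \<Longrightarrow>
      \<theta>h (Suc n) \<omega> = \<theta>h n \<omega> + a n \<omega> *\<^sub>R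
        outer (matrix_inv (wls_S a \<Phi> n \<omega>) *v \<Phi> n \<omega>)
          (X (int (Suc n)) \<omega> - U (int n) \<omega> - transpose (\<theta>h n \<omega>) *v \<Phi> n \<omega>)"
    \<comment> \<open>adaptive tracking control\<close>
    and x_predictable: "\<And>n. x (Suc n) \<in> borel_measurable (F n)"
    and x_small: "AE \<omega> in M. (\<lambda>n. \<Sum>k=1..n. (norm (x k \<omega>))\<^sup>2) \<in> o(\<lambda>n. real n)"
    and control: "\<And>n \<omega>. \<omega> \<in> space M \<Longrightarrow>
      U (int n) \<omega> = x (Suc n) \<omega> - transpose (\<theta>h n \<omega>) *v \<Phi> n \<omega>"
    \<comment> \<open>strong controllability\<close>
    and P_def: "P = arx_P CARD('p) CARD('q) A B"
    and causal: "\<And>z. norm z \<le> 1 \<Longrightarrow> det (B_poly CARD('q) B z) \<noteq> 0"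
    and Pi_det: "det (Pi_mat CARD('p) P :: real^('q \<times> 'd)^('q \<times> 'd)) \<noteq> 0"
  shows "(AE \<omega> in M. (\<lambda>n. (ln (real n) powr (1 + \<gamma>)) *\<^sub>R ((1 / real n) *\<^sub>R wls_S a \<Phi> n \<omega>))
        \<longlonglongrightarrow> Lambda_mat P \<Gamma>) \<and>
    (AE \<omega> in M. (\<lambda>n. avg_outer (\<lambda>k. X (int k) \<omega> - x k \<omega>) n) \<longlonglongrightarrow> \<Gamma>) \<and>
    (AE \<omega> in M. (\<lambda>n. norm (avg_outer (\<lambda>k. X (int k) \<omega> - x k \<omega>) n - avg_outer (\<lambda>k. \<epsilon> k \<omega>) n))
        \<in> o(\<lambda>n. ln (real n) powr (1 + \<gamma>) / real n)) \<and>
    (AE \<omega> in M. (\<lambda>n. \<theta>h n \<omega>) \<longlonglongrightarrow> \<theta>) \<and>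
    (AE \<omega> in M. (\<lambda>n. (norm (\<theta>h n \<omega> - \<theta>))\<^sup>2) \<in> O(\<lambda>n. ln (real n) powr (1 + \<gamma>) / real n))"
proof -
  interpret prob_space M by (rule prob)
  have spF: "space (F n) = space M" for n using filt(1) by (simp add: filtration_def)
  have F_mono: "f \<in> borel_measurable (F m) \<Longrightarrow> m \<le> n \<Longrightarrow> f \<in> borel_measurable (F n)"
    for f :: "'w \<Rightarrow> 'b::topological_space" and m n
    using filt(1) by (intro measurable_from_subalg[of "F n" "F m"]) (auto simp: filtration_def subalgebra_def)
  define \<pi> where "\<pi> n \<omega> = transpose (\<theta> - \<theta>h n \<omega>) *v \<Phi> n \<omega>" for n \<omega>
  define e where "e n \<omega> = (if n = 0 then 0 else \<epsilon> n \<omega>)" for n \<omega>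
  define z where "z n \<omega> = wls_gain (\<lambda>k. a k \<omega>) (\<lambda>k. \<Phi> k \<omega>) n" for n \<omega>
  define f where "f n \<omega> = leverage (\<lambda>k. a k \<omega>) (\<lambda>k. \<Phi> k \<omega>) n" for n \<omega>
  have a_F: "a n \<in> borel_measurable (F n)" for n using weights by (simp add: wls_weights_def)
  have a0: "0 \<le> a n \<omega>" if "\<omega> \<in> space M" for n \<omega> using weights that by (simp add: wls_weights_def)
  have W: "wls (\<lambda>k. a k \<omega>)" if "\<omega> \<in> space M" for \<omega> by unfold_locales (rule a0[OF that])
  have \<epsilon>_F: "\<epsilon> (Suc n) \<in> borel_measurable (F (Suc n))" for n using noise by (simp add: mart_diff_noise_def)
  have e_F: "e n \<in> borel_measurable (F n)" for n
    by (cases n) (simp_all add: e_def[abs_def] \<epsilon>_F)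
  have z_F: "z n \<in> borel_measurable (F n)" if \<Phi>_F: "\<And>k. k \<le> n \<Longrightarrow> \<Phi> k \<in> borel_measurable (F k)" for n
  proof -
    have "(\<lambda>\<omega>. wls_T (\<lambda>k. a k \<omega>) (\<lambda>k. \<Phi> k \<omega>) (Suc n)) \<in> borel_measurable (F n)"
      unfolding wls_T_def lessThan_Suc_atMost
    proof (intro borel_measurable_add borel_measurable_sum borel_measurable_scaleR borel_measurable_const borel_measurable_outer)
      fix k assume "k \<in> {..n}"
      then have "k \<le> n" by simp
      show "a k \<in> borel_measurable (F n)" using F_mono[OF a_F \<open>k \<le> n\<close>] .
      show "\<Phi> k \<in> borel_measurable (F n)" "\<Phi> k \<in> borel_measurable (F n)"
        using F_mono[OF \<Phi>_F[OF \<open>k \<le> n\<close>] \<open>k \<le> n\<close>] by auto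
    qed
    then show ?thesis unfolding z_def wls_gain_def
      by (intro borel_measurable_solve \<Phi>_F wls.T_invertible[OF W]) (auto simp: spF)
  qed
  \<comment> \<open>Causal order of one step: estimate and regressor at \<open>n\<close> determine
    the input, the next noise then gives the next output, and these give the next estimate and
    regressor. The four families depend on each other, hence one joint induction.\<close>
  have main: "(\<forall>k. - int CARD('p) < k \<longrightarrow> k \<le> int n \<longrightarrow> X k \<in> borel_measurable (F n)) \<and>
      (\<forall>k. - int CARD('q) \<le> k \<longrightarrow> k < int n \<longrightarrow> U k \<in> borel_measurable (F n)) \<and>
      (\<forall>k\<le>n. \<theta>h k \<in> borel_measurable (F k)) \<and> (\<forall>k\<le>n. \<Phi> k \<in> borel_measurable (F k))" for n
  proof (induction n)
    case 0
    have "\<Phi> 0 \<in> borel_measurable (F 0)"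
    proof (rule borel_measurable_vecI)
      fix r
      show "(\<lambda>\<omega>. \<Phi> 0 \<omega> $ r) \<in> borel_measurable (F 0)"
      proof (cases r)
        case (Inl ib)
        obtain i b where ib: "ib = (i, b)" by fastforce
        have "X (int 0 - int (pos i) + 1) \<in> borel_measurable (F 0)"
          using pos_ge_1[of i] pos_le[of i] by (intro X_init) auto
        from borel_measurable_vecD[OF this, of b] show ?thesis by (simp add: \<Phi>_def regressor_def Inl ib)
      next
        case (Inr ib)
        obtain i b where ib: "ib = (i, b)" by fastforce
        have "U (int 0 - int (pos i)) \<in> borel_measurable (F 0)"
          using pos_ge_1[of i] pos_le[of i] by (intro U_init) auto
        from borel_measurable_vecD[OF this, of b] show ?thesis by (simp add: \<Phi>_def regressor_def Inr ib)
      qed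
    qed
    then show ?case using X_init U_init \<theta>h_init by simp
  next
    case (Suc n)
    then have X: "\<And>k. - int CARD('p) < k \<Longrightarrow> k \<le> int n \<Longrightarrow> X k \<in> borel_measurable (F n)"
      and U: "\<And>k. - int CARD('q) \<le> k \<Longrightarrow> k < int n \<Longrightarrow> U k \<in> borel_measurable (F n)"
      and th: "\<And>k. k \<le> n \<Longrightarrow> \<theta>h k \<in> borel_measurable (F k)"
      and \<Phi>: "\<And>k. k \<le> n \<Longrightarrow> \<Phi> k \<in> borel_measurable (F k)" by blast+
    have Un: "U (int n) \<in> borel_measurable (F n)"
    proof -
      have "(\<lambda>\<omega>. x (Suc n) \<omega> - transpose (\<theta>h n \<omega>) *v \<Phi> n \<omega>) \<in> borel_measurable (F n)"
        by (intro borel_measurable_diff x_predictable borel_measurable_matrix_vector borel_measurable_transpose th \<Phi>) auto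
      then show ?thesis by (subst measurable_cong[OF control]) (simp_all add: spF)
    qed
    have Xn: "X (int (Suc n)) \<in> borel_measurable (F (Suc n))"
    proof -
      have "(\<lambda>\<omega>. transpose \<theta> *v \<Phi> n \<omega> + U (int n) \<omega> + \<epsilon> (Suc n) \<omega>) \<in> borel_measurable (F (Suc n))"
        by (intro borel_measurable_add borel_measurable_matrix_vector borel_measurable_const \<epsilon>_F
            F_mono[OF Un] F_mono[OF \<Phi>]) auto
      then show ?thesis by (subst measurable_cong[OF model]) (simp_all add: spF)
    qed
    have X': "X k \<in> borel_measurable (F (Suc n))" if "- int CARD('p) < k" "k \<le> int (Suc n)" for k
    proof (cases "k = int (Suc n)")
      case True then show ?thesis using Xn by simp
    next
      case False
      then show ?thesis using that by (intro F_mono[OF X]) auto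
    qed
    have U': "U k \<in> borel_measurable (F (Suc n))" if "- int CARD('q) \<le> k" "k < int (Suc n)" for k
    proof (cases "k = int n")
      case True then show ?thesis using F_mono[OF Un, of "Suc n"] by simp
    next
      case False
      then show ?thesis using that by (intro F_mono[OF U]) auto
    qed
    have th': "\<theta>h (Suc n) \<in> borel_measurable (F (Suc n))"
    proof -
      have "(\<lambda>\<omega>. \<theta>h n \<omega> + a n \<omega> *\<^sub>R outer (z n \<omega>) (X (int (Suc n)) \<omega> - U (int n) \<omega> - transpose (\<theta>h n \<omega>) *v \<Phi> n \<omega>))
         \<in> borel_measurable (F (Suc n))"
        by (intro borel_measurable_add borel_measurable_scaleR borel_measurable_outer borel_measurable_diff
            borel_measurable_matrix_vector borel_measurable_transpose Xn F_mono[OF Un] F_mono[OF th] F_mono[OF \<Phi>]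
            F_mono[OF a_F] F_mono[OF z_F[OF \<Phi>]]) auto
      then show ?thesis
        by (subst measurable_cong[OF \<theta>h_step]) (simp_all add: spF z_def wls_gain_def wls_S_eq)
    qed
    have \<Phi>': "\<Phi> (Suc n) \<in> borel_measurable (F (Suc n))"
    proof (rule borel_measurable_vecI)
      fix r
      show "(\<lambda>\<omega>. \<Phi> (Suc n) \<omega> $ r) \<in> borel_measurable (F (Suc n))"
      proof (cases r)
        case (Inl ib)
        obtain i b where ib: "ib = (i, b)" by fastforce
        have "X (int (Suc n) - int (pos i) + 1) \<in> borel_measurable (F (Suc n))"
          using pos_ge_1[of i] pos_le[of i] by (intro X') auto
        from borel_measurable_vecD[OF this, of b] show ?thesis by (simp add: \<Phi>_def regressor_def Inl ib)
      next
        case (Inr ib)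
        obtain i b where ib: "ib = (i, b)" by fastforce
        have "U (int (Suc n) - int (pos i)) \<in> borel_measurable (F (Suc n))"
          using pos_ge_1[of i] pos_le[of i] by (intro U') auto
        from borel_measurable_vecD[OF this, of b] show ?thesis by (simp add: \<Phi>_def regressor_def Inr ib)
      qed
    qed
    show ?case using X' U' th' \<Phi>' th \<Phi> by (auto simp: le_Suc_eq)
  qed
  have th_F: "\<theta>h n \<in> borel_measurable (F n)" and \<Phi>_F: "\<Phi> n \<in> borel_measurable (F n)" for n
    using main[of n] by auto
  have \<pi>_F: "\<pi> n \<in> borel_measurable (F n)" for n
    unfolding \<pi>_def[abs_def]
    by (intro borel_measurable_matrix_vector borel_measurable_transpose borel_measurable_diff borel_measurable_const th_F \<Phi>_F)
  have f_F: "f n \<in> borel_measurable (F n)" for n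
    unfolding f_def[abs_def] leverage_def z_def[symmetric]
    by (intro borel_measurable_times a_F borel_measurable_inner \<Phi>_F z_F)
  have md: "mart_diff M F (\<lambda>n \<omega>. \<epsilon> (Suc n) \<omega> $ c) (\<Gamma> $ c $ c)" for c
  proof (intro mart_diff.intro mart_diff_axioms.intro prob filt)
    show "(\<lambda>\<omega>. \<epsilon> (Suc n) \<omega> $ c) \<in> borel_measurable (F (Suc n))" for n
      by (rule borel_measurable_vecD[OF \<epsilon>_F])
  qed (use noise in \<open>simp_all add: mart_diff_noise_def power2_eq_square\<close>)
  have sn: "AE \<omega> in M. self_normalized (\<lambda>k. w k \<omega>) (\<lambda>k. \<epsilon> (Suc k) \<omega> $ c)"
    if "\<And>k. w k \<in> borel_measurable (F k)" for w c
    using mart_diff.self_normalized_AE[OF md that] .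
  have lag_F: "(\<lambda>\<omega>. lag j (\<lambda>k. e k \<omega> $ b) k) \<in> borel_measurable (F k)" for j b k
    by (cases "j \<le> k") (auto simp: lag_def intro!: borel_measurable_vecD F_mono[OF e_F])
  \<comment> \<open>Finitely many components here, and countably many lags in \<open>ae3\<close>,
    keep the exceptional set null.\<close>
  have ae1: "AE \<omega> in M. \<forall>c\<in>UNIV. self_normalized (\<lambda>k. x (Suc k) \<omega> $ c + \<pi> k \<omega> $ c) (\<lambda>k. \<epsilon> (Suc k) \<omega> $ c)"
    by (intro AE_finite_allI finite_class.finite_UNIV sn borel_measurable_add borel_measurable_vecD x_predictable \<pi>_F)
  have ae2: "AE \<omega> in M. \<forall>c\<in>UNIV. self_normalized (\<lambda>k. a k \<omega> * (1 - f k \<omega>) * \<pi> k \<omega> $ c) (\<lambda>k. \<epsilon> (Suc k) \<omega> $ c)"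
    by (intro AE_finite_allI finite_class.finite_UNIV sn borel_measurable_times borel_measurable_diff borel_measurable_const
        borel_measurable_vecD a_F f_F \<pi>_F)
  have ae3: "AE \<omega> in M. \<forall>b\<in>UNIV. \<forall>c\<in>UNIV. \<forall>j. self_normalized (\<lambda>k. lag j (\<lambda>k. e k \<omega> $ b) k) (\<lambda>k. \<epsilon> (Suc k) \<omega> $ c)"
    unfolding AE_all_countable[symmetric]
    by (intro AE_finite_allI finite_class.finite_UNIV) (simp add: AE_all_countable sn[OF lag_F])
  have ae4: "AE \<omega> in M. \<forall>b\<in>UNIV. \<forall>c\<in>UNIV. self_normalized (\<lambda>k. \<pi> k \<omega> $ b) (\<lambda>k. \<epsilon> (Suc k) \<omega> $ c)"
    by (intro AE_finite_allI finite_class.finite_UNIV sn borel_measurable_vecD \<pi>_F)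
  have f0: "0 \<le> f n \<omega>" if "\<omega> \<in> space M" for n \<omega>
    unfolding f_def by (rule wls.leverage_nonneg[OF W[OF that]])
  have ae5: "AE \<omega> in M. \<forall>c\<in>UNIV. summable (\<lambda>k. a k \<omega> * f k \<omega>) \<longrightarrow> summable (\<lambda>k. a k \<omega> * f k \<omega> * (\<epsilon> (Suc k) \<omega> $ c)\<^sup>2)"
  proof -
    have "AE \<omega> in M. summable (\<lambda>k. a k \<omega> * f k \<omega>) \<longrightarrow> summable (\<lambda>k. a k \<omega> * f k \<omega> * (\<epsilon> (Suc k) \<omega> $ c)\<^sup>2)" for c
      by (intro mart_diff.weighted_squares_summable_AE[OF md] borel_measurable_times a_F f_F mult_nonneg_nonneg a0 f0)
    then show ?thesis by (intro AE_finite_allI finite_class.finite_UNIV)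
  qed
  have "AE \<omega> in M. ((\<lambda>n. (ln (real n) powr (1 + \<gamma>)) *\<^sub>R ((1 / real n) *\<^sub>R wls_S a \<Phi> n \<omega>))
        \<longlonglongrightarrow> Lambda_mat P \<Gamma>) \<and>
    ((\<lambda>n. avg_outer (\<lambda>k. X (int k) \<omega> - x k \<omega>) n) \<longlonglongrightarrow> \<Gamma>) \<and>
    ((\<lambda>n. norm (avg_outer (\<lambda>k. X (int k) \<omega> - x k \<omega>) n - avg_outer (\<lambda>k. \<epsilon> k \<omega>) n))
        \<in> o(\<lambda>n. ln (real n) powr (1 + \<gamma>) / real n)) \<and>
    ((\<lambda>n. \<theta>h n \<omega>) \<longlonglongrightarrow> \<theta>) \<and>
    ((\<lambda>n. (norm (\<theta>h n \<omega> - \<theta>))\<^sup>2) \<in> O(\<lambda>n. ln (real n) powr (1 + \<gamma>) / real n))"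
    using AE_space ae1 ae2 ae3 ae4 ae5 Gamma_n x_small
  proof eventually_elim
    case (elim \<omega>)
    interpret L: closed_loop "CARD('p)" "CARD('q)" A B "\<lambda>k. X k \<omega>" "\<lambda>k. U k \<omega>" "\<lambda>k. \<epsilon> k \<omega>" "\<lambda>k. x k \<omega>"
      \<Gamma> \<gamma> \<theta> "\<lambda>n. \<theta>h n \<omega>" "\<lambda>n. \<Phi> n \<omega>" "\<lambda>n. a n \<omega>" "\<lambda>n. \<pi> n \<omega>" "\<lambda>n. e n \<omega>" "\<lambda>n. energy \<Phi> n \<omega>"
    proof
      show "\<And>z. norm z \<le> 1 \<Longrightarrow> det (B_poly CARD('q) B z) \<noteq> 0" by (rule causal)
      show "\<And>n i b. \<Phi> n \<omega> $ Inl (i, b) = X (int n - int (pos i) + 1) \<omega> $ b" by (simp add: \<Phi>_def regressor_def)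
      show "\<And>n i b. \<Phi> n \<omega> $ Inr (i, b) = U (int n - int (pos i)) \<omega> $ b" by (simp add: \<Phi>_def regressor_def)
      show "\<And>n. X (int (Suc n)) \<omega> = transpose \<theta> *v \<Phi> n \<omega> + U (int n) \<omega> + \<epsilon> (Suc n) \<omega>" using model[OF elim(1)] .
      show "\<And>n. \<theta>h (Suc n) \<omega> = \<theta>h n \<omega> + a n \<omega> *\<^sub>R
        outer (wls_gain (\<lambda>n. a n \<omega>) (\<lambda>n. \<Phi> n \<omega>) n) (X (int (Suc n)) \<omega> - U (int n) \<omega> - transpose (\<theta>h n \<omega>) *v \<Phi> n \<omega>)"
        using \<theta>h_step[OF elim(1)] by (simp only: wls_gain_def wls_S_eq)
      show "\<And>n. U (int n) \<omega> = x (Suc n) \<omega> - transpose (\<theta>h n \<omega>) *v \<Phi> n \<omega>" using control[OF elim(1)] .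
      show "\<And>n. 1 < energy \<Phi> n \<omega> \<Longrightarrow> a n \<omega> = (1 / ln (energy \<Phi> n \<omega>)) powr (1 + \<gamma>)"
        using weights elim(1) by (simp add: wls_weights_def)
      show "\<And>c. summable (\<lambda>k. a k \<omega> * leverage (\<lambda>n. a n \<omega>) (\<lambda>n. \<Phi> n \<omega>) k) \<Longrightarrow>
        summable (\<lambda>k. a k \<omega> * leverage (\<lambda>n. a n \<omega>) (\<lambda>n. \<Phi> n \<omega>) k * (\<epsilon> (Suc k) \<omega> $ c)\<^sup>2)"
        using elim(6) by (simp add: f_def)
      show "\<And>c. self_normalized (\<lambda>k. a k \<omega> * (1 - leverage (\<lambda>n. a n \<omega>) (\<lambda>n. \<Phi> n \<omega>) k) * \<pi> k \<omega> $ c) (\<lambda>k. \<epsilon> (Suc k) \<omega> $ c)"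
        using elim(3) by (simp add: f_def)
      show "\<And>j b c. self_normalized (lag j (\<lambda>k. e k \<omega> $ b)) (\<lambda>k. \<epsilon> (Suc k) \<omega> $ c)" using elim(4) by simp
    qed (use elim a0 \<theta>_def gamma_pos Gamma_pd in \<open>auto simp: \<pi>_def e_def energy_def\<close>)
    have Pi: "det (Pi_mat CARD('p) (arx_P CARD('p) CARD('q) A B) :: real^('q \<times> 'd)^('q \<times> 'd)) \<noteq> 0"
      using Pi_det by (simp add: P_def)
    have "(\<lambda>n. (ln (real n) powr (1 + \<gamma>)) *\<^sub>R ((1 / real n) *\<^sub>R wls_S a \<Phi> n \<omega>)) \<longlonglongrightarrow> Lambda_mat P \<Gamma>"
      using L.gram_limit by (simp add: wls_S_eq lnp_def P_def)
    then show ?case using L.tracking_optimal[OF Pi] L.tracking_rate[OF Pi] L.estimation_consistent[OF Pi] L.estimation_rate[OF Pi]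
      by blast
  qed
  then show ?thesis unfolding AE_conj_iff .
qed

end
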